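(* Let $A$ and $B$ be $C^{*}$-algebras and let $\varphi:A \to B$ be a completely positive order zero map. Set $C:= C^{*}(\varphi(A)) \subset B$. Then there are a positive element $h \in \mathcal{M}(C) \cap C'$ with $\| h \| = \|\varphi \|$ and a $*$-homomorphism \[ \pi_{\varphi}:A \to \mathcal{M}(C) \cap \{h\}' \] such that \[ \pi_{\varphi}(a)h = \varphi(a) \quad \text{for all } a \in A. \] If $A$ is unital, then $h = \varphi(\mathbf{1}_{A}) \in C$.
   Context: Two elements $a,b$ of a $C^{*}$-algebra are orthogonal, written $a \perp b$, if $ab=ba=a^{*}b=ab^{*}=0$. A completely positive map $\varphi:A\to B$ between $C^{*}$-algebras has order zero if, for all $a,b\in A_{+}$, $a\perp b$ implies $\varphi(a)\perp\varphi(b)$. $C^{*}(\varphi(A))$ denotes the $C^{*}$-subalgebra of $B$ generated by $\varphi(A)$; $\mathcal{M}(C)$ denotes the multiplier algebra of $C$; $C'$ and $\{h\}'$ denote commutants, so $\mathcal{M}(C)\cap C'$ is the set of elements of $\mathcal{M}(C)$ commuting with $C$, and $\mathcal{M}(C)\cap\{h\}'$ the set of elements of $\mathcal{M}(C)$ commuting with $h$. *)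

theory Defs
  imports "HOL-Analysis.Analysis" "Jordan_Normal_Form.Matrix"
begin

section \<open>C*-algebras\<close>

text \<open>No unit is required, and the zero algebra is allowed.\<close>

class c_star_algebra = real_normed_algebra + banach +
  fixes scaleC :: "complex \<Rightarrow> 'a \<Rightarrow> 'a"  (infixr "*\<^sub>C" 75)
    and star :: "'a \<Rightarrow> 'a"
  assumes scaleC_add_right: "c *\<^sub>C (x + y) = c *\<^sub>C x + c *\<^sub>C y"
    and scaleC_add_left: "(c + d) *\<^sub>C x = c *\<^sub>C x + d *\<^sub>C x"
    and scaleC_scaleC: "c *\<^sub>C d *\<^sub>C x = (c * d) *\<^sub>C x"
    and scaleC_of_real: "complex_of_real r *\<^sub>C x = r *\<^sub>R x"
    and mult_scaleC_left: "(c *\<^sub>C x) * y = c *\<^sub>C (x * y)"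
    and mult_scaleC_right: "x * (c *\<^sub>C y) = c *\<^sub>C (x * y)"
    and norm_scaleC: "norm (c *\<^sub>C x) = cmod c * norm x"
    and star_star: "star (star x) = x"
    and star_add: "star (x + y) = star x + star y"
    and star_scaleC: "star (c *\<^sub>C x) = cnj c *\<^sub>C star x"
    and star_mult: "star (x * y) = star y * star x"
    and norm_star_mult_self: "norm (star x * x) = (norm x)\<^sup>2"

definition positive :: "'a::c_star_algebra \<Rightarrow> bool" where
  "positive a \<longleftrightarrow> (\<exists>x. a = star x * x)"

definition orthogonal_elements :: "'a::c_star_algebra \<Rightarrow> 'a \<Rightarrow> bool" (infix "\<bottom>\<^sub>C" 50) where
  "a \<bottom>\<^sub>C b \<longleftrightarrow> a * b = 0 \<and> b * a = 0 \<and> star a * b = 0 \<and> a * star b = 0"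

definition is_unit_element :: "'a::c_star_algebra \<Rightarrow> bool" where
  "is_unit_element e \<longleftrightarrow> (\<forall>a. e * a = a \<and> a * e = a)"

definition c_star_subalgebra :: "'a::c_star_algebra set \<Rightarrow> bool" where
  "c_star_subalgebra C \<longleftrightarrow> closed C \<and> 0 \<in> C \<and>
     (\<forall>x\<in>C. \<forall>y\<in>C. x + y \<in> C) \<and> (\<forall>c. \<forall>x\<in>C. c *\<^sub>C x \<in> C) \<and>
     (\<forall>x\<in>C. \<forall>y\<in>C. x * y \<in> C) \<and> (\<forall>x\<in>C. star x \<in> C)"

definition c_star_generated :: "'a::c_star_algebra set \<Rightarrow> 'a set" where
  "c_star_generated S = c_star_subalgebra hull S"


section \<open>Completely positive maps of order zero\<close>

definition clinear_map :: "('a::c_star_algebra \<Rightarrow> 'b::c_star_algebra) \<Rightarrow> bool" where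
  "clinear_map f \<longleftrightarrow> (\<forall>x y. f (x + y) = f x + f y) \<and> (\<forall>c x. f (c *\<^sub>C x) = c *\<^sub>C f x)"

definition star_mat :: "'a::c_star_algebra mat \<Rightarrow> 'a mat" where
  "star_mat X = map_mat star (transpose_mat X)"

definition positive_mat :: "nat \<Rightarrow> 'a::c_star_algebra mat \<Rightarrow> bool" where
  "positive_mat n P \<longleftrightarrow> (\<exists>X \<in> carrier_mat n n. P = star_mat X * X)"

definition completely_positive :: "('a::c_star_algebra \<Rightarrow> 'b::c_star_algebra) \<Rightarrow> bool" where
  "completely_positive f \<longleftrightarrow>
     clinear_map f \<and> (\<forall>n P. positive_mat n P \<longrightarrow> positive_mat n (map_mat f P))"

definition order_zero :: "('a::c_star_algebra \<Rightarrow> 'b::c_star_algebra) \<Rightarrow> bool" where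
  "order_zero f \<longleftrightarrow> (\<forall>a b. positive a \<longrightarrow> positive b \<longrightarrow> a \<bottom>\<^sub>C b \<longrightarrow> f a \<bottom>\<^sub>C f b)"


section \<open>The multiplier algebra of a C*-subalgebra\<close>

text \<open>
  \<open>\<M>(C)\<close> is the algebra of double centralizers \<open>(L, R)\<close> of \<open>C\<close>: a multiplier \<open>m\<close> is represented
  by \<open>L x = m x\<close> and \<open>R x = x m\<close>.  The maps are extensional (\<^const>\<open>undefined\<close> off \<open>C\<close>), so that
  equality of pairs is equality of multipliers.
\<close>

type_synonym 'b multiplier = "('b \<Rightarrow> 'b) \<times> ('b \<Rightarrow> 'b)"

definition bounded_clinear_on :: "'b::c_star_algebra set \<Rightarrow> ('b \<Rightarrow> 'b) \<Rightarrow> bool" where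
  "bounded_clinear_on C f \<longleftrightarrow>
     (\<forall>x\<in>C. \<forall>y\<in>C. f (x + y) = f x + f y) \<and> (\<forall>c. \<forall>x\<in>C. f (c *\<^sub>C x) = c *\<^sub>C f x) \<and>
     (\<exists>K. \<forall>x\<in>C. norm (f x) \<le> K * norm x)"

definition multipliers :: "'b::c_star_algebra set \<Rightarrow> 'b multiplier set" where
  "multipliers C = {(L, R).
     L \<in> C \<rightarrow>\<^sub>E C \<and> R \<in> C \<rightarrow>\<^sub>E C \<and> bounded_clinear_on C L \<and> bounded_clinear_on C R \<and>
     (\<forall>x\<in>C. \<forall>y\<in>C. L (x * y) = L x * y \<and> R (x * y) = x * R y \<and> R x * y = x * L y)}"

definition m_add :: "'b::c_star_algebra set \<Rightarrow> 'b multiplier \<Rightarrow> 'b multiplier \<Rightarrow> 'b multiplier" where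
  "m_add C m n = (\<lambda>x\<in>C. fst m x + fst n x, \<lambda>x\<in>C. snd m x + snd n x)"

definition m_scale :: "'b::c_star_algebra set \<Rightarrow> complex \<Rightarrow> 'b multiplier \<Rightarrow> 'b multiplier" where
  "m_scale C c m = (\<lambda>x\<in>C. c *\<^sub>C fst m x, \<lambda>x\<in>C. c *\<^sub>C snd m x)"

definition m_mult :: "'b::c_star_algebra set \<Rightarrow> 'b multiplier \<Rightarrow> 'b multiplier \<Rightarrow> 'b multiplier" where
  "m_mult C m n = (compose C (fst m) (fst n), compose C (snd n) (snd m))"

definition m_star :: "'b::c_star_algebra set \<Rightarrow> 'b multiplier \<Rightarrow> 'b multiplier" where
  "m_star C m = (\<lambda>x\<in>C. star (snd m (star x)), \<lambda>x\<in>C. star (fst m (star x)))"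

text \<open>For a double centralizer the operator norms of \<open>L\<close> and \<open>R\<close> agree.\<close>

definition m_norm :: "'b::c_star_algebra set \<Rightarrow> 'b multiplier \<Rightarrow> real" where
  "m_norm C m = (SUP x\<in>{x \<in> C. norm x \<le> 1}. norm (fst m x))"

definition m_embed :: "'b::c_star_algebra set \<Rightarrow> 'b \<Rightarrow> 'b multiplier" where
  "m_embed C c = (\<lambda>x\<in>C. c * x, \<lambda>x\<in>C. x * c)"

definition m_positive :: "'b::c_star_algebra set \<Rightarrow> 'b multiplier \<Rightarrow> bool" where
  "m_positive C h \<longleftrightarrow> (\<exists>k \<in> multipliers C. h = m_mult C (m_star C k) k)"

definition m_commutant :: "'b::c_star_algebra set \<Rightarrow> 'b multiplier set \<Rightarrow> 'b multiplier set" where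
  "m_commutant C S = {m \<in> multipliers C. \<forall>s\<in>S. m_mult C m s = m_mult C s m}"

definition star_hom_to_multipliers ::
  "'b::c_star_algebra set \<Rightarrow> ('a::c_star_algebra \<Rightarrow> 'b multiplier) \<Rightarrow> bool" where
  "star_hom_to_multipliers C \<pi> \<longleftrightarrow> (\<forall>a. \<pi> a \<in> multipliers C) \<and>
     (\<forall>a b. \<pi> (a + b) = m_add C (\<pi> a) (\<pi> b)) \<and> (\<forall>c a. \<pi> (c *\<^sub>C a) = m_scale C c (\<pi> a)) \<and>
     (\<forall>a b. \<pi> (a * b) = m_mult C (\<pi> a) (\<pi> b)) \<and> (\<forall>a. \<pi> (star a) = m_star C (\<pi> a))"

end

theory Submission
  imports Defs
begin

text \<open>
  If \<open>w v = 0\<close> then \<open>w* w\<close> and \<open>v v*\<close> are orthogonal, and 2-positivity upgrades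
  \<open>\<phi>(w* w) \<phi>(v v*) = 0\<close> to \<open>\<phi>(w) \<phi>(v) = 0\<close>.  A bounded bilinear map that vanishes on zero products
  is balanced over self-adjoint elements, by a partition of unity in the functional calculus; hence
  \<open>\<phi>(ab) \<phi>(c) = \<phi>(a) \<phi>(bc)\<close>.  This identity makes \<open>\<pi>(a) : \<phi>(b) x \<mapsto> \<phi>(ab) x\<close> a well-defined
  *-representation on the algebra generated by \<open>\<phi>(A)\<close>; it is contractive because of the C*-identity
  and so extends to \<open>C\<close>.  The multiplier \<open>h\<close> is the strict limit of \<open>\<phi>(u)\<close> along the approximate units
  \<open>u\<close> of \<open>A\<close>, and the same identity shows that it is central.  Positivity is treated without spectra:
  a self-adjoint \<open>a\<close> is positive iff \<open>\<parallel>t - a\<parallel> \<le> t\<close> for some \<open>t \<ge> 0\<close>, which by an iteration for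
  \<open>\<surd>(1 - w)\<close>, \<open>\<parallel>w\<parallel> \<le> 1\<close>, means that \<open>a\<close> is a square.
\<close>


text \<open>With a unit in \<open>A\<close> and \<open>h\<close> invertible one would put h =
  \<phi>(1) and divide \<phi>(a) by \<open>h\<close>. In general neither is possible inside
  \<open>B\<close>, and the usual escape is the bidual, with a weak limit for \<open>h\<close> and a
  support projection. Here the balanced identity does both jobs: \<phi>(u) \<phi>(v c) = \<phi>(u v)
  \<phi>(c) converges in norm along approximate units, and division by \<open>h\<close> is replaced
  by the equations \<phi>(b) y = \<phi>(b a) x for all \<open>b\<close>, which determine
  \<open>y\<close> within \<open>C\<close>. A unit is still wanted for partitions of unity and for
  the norm criterion of positivity, hence the unitization; elements multiplied by one of the
  original algebra fall back into it. Multipliers are pairs of maps on the set \<open>C\<close>, not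
  elements of an algebra to which the results on positive elements apply. Positivity of
  \<open>h\<close> therefore has to be shown by a root built on \<open>C\<close> itself, and this is
  why the root iteration is carried out for operators on a closed subspace.\<close>

section \<open>Elementary consequences of the C*-axioms\<close>

lemma star_zero [simp]: "star 0 = (0::'a::c_star_algebra)"
  using star_add[of 0 "0::'a"] by simp

lemma star_minus: "star (- x) = - star (x::'a::c_star_algebra)"
  using star_add[of x "- x"] by (simp add: eq_neg_iff_add_eq_0 add.commute)

lemma star_diff: "star (x - y) = star x - star (y::'a::c_star_algebra)"
  using star_add[of x "- y"] by (simp add: star_minus)

lemma star_scaleR: "star (r *\<^sub>R x) = r *\<^sub>R star (x::'a::c_star_algebra)"
  by (metis complex_cnj_complex_of_real scaleC_of_real star_scaleC)

lemma scaleC_zero_left [simp]: "0 *\<^sub>C x = (0::'a::c_star_algebra)"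
  using scaleC_of_real[of 0 x] by simp

lemma scaleC_zero_right [simp]: "c *\<^sub>C 0 = (0::'a::c_star_algebra)"
  using scaleC_add_right[of c 0 "0::'a"] by simp

lemma scaleC_one [simp]: "1 *\<^sub>C x = (x::'a::c_star_algebra)"
  using scaleC_of_real[of 1 x] by simp

lemma scaleC_minus_left: "(- c) *\<^sub>C x = - (c *\<^sub>C (x::'a::c_star_algebra))"
  using scaleC_add_left[of c "- c" x] by (simp add: eq_neg_iff_add_eq_0 add.commute)

lemma scaleC_minus_one [simp]: "(- 1) *\<^sub>C x = - (x::'a::c_star_algebra)"
  by (simp add: scaleC_minus_left)

lemma scaleC_minus_right: "c *\<^sub>C (- x) = - (c *\<^sub>C (x::'a::c_star_algebra))"
  using scaleC_add_right[of c x "- x"] by (simp add: eq_neg_iff_add_eq_0 add.commute)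

lemma scaleC_diff_right: "c *\<^sub>C (x - y) = c *\<^sub>C x - c *\<^sub>C (y::'a::c_star_algebra)"
  using scaleC_add_right[of c x "- y"] by (simp add: scaleC_minus_right)

lemma scaleC_scaleR: "c *\<^sub>C (r *\<^sub>R x) = r *\<^sub>R (c *\<^sub>C (x::'a::c_star_algebra))"
  by (metis mult.commute scaleC_of_real scaleC_scaleC)

lemma norm_star [simp]: "norm (star x) = norm (x::'a::c_star_algebra)"
proof -
  have le: "norm y \<le> norm (star y)" for y :: 'a
  proof (cases "y = 0")
    case False
    have "norm y * norm y \<le> norm (star y) * norm y"
      using norm_mult_ineq[of "star y" y] by (simp add: norm_star_mult_self power2_eq_square)
    then show ?thesis using False by simp
  qed simp
  show ?thesis using le[of x] le[of "star x"] by (simp add: star_star)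
qed

lemma norm_mult_star_self: "norm (x * star x) = (norm (x::'a::c_star_algebra))\<^sup>2"
  using norm_star_mult_self[of "star x"] by (simp add: star_star)

lemma star_mult_self_eq_0_iff [simp]: "star x * x = 0 \<longleftrightarrow> x = (0::'a::c_star_algebra)"
  by (metis norm_eq_zero norm_star_mult_self zero_eq_power2 mult_zero_right)

lemma bounded_linear_star: "bounded_linear (star :: 'a::c_star_algebra \<Rightarrow> 'a)"
  by (rule bounded_linear_intro[where K=1]) (simp_all add: star_add star_scaleR)

lemma bounded_linear_scaleC: "bounded_linear (\<lambda>x::'a::c_star_algebra. c *\<^sub>C x)"
  by (rule bounded_linear_intro[where K="cmod c"])
    (simp_all add: scaleC_add_right scaleC_scaleR norm_scaleC mult.commute)

lemmas tendsto_star = bounded_linear.tendsto[OF bounded_linear_star]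
lemmas tendsto_scaleC = bounded_linear.tendsto[OF bounded_linear_scaleC]

lemma sa_decomposition:
  fixes x :: "'a::c_star_algebra"
  obtains u v where "star u = u" "star v = v" "x = u + \<i> *\<^sub>C v" "norm u \<le> norm x" "norm v \<le> norm x"
proof
  let ?u = "(1/2) *\<^sub>R (x + star x)" and ?v = "(- \<i> / 2) *\<^sub>C (x - star x)"
  show "star ?u = ?u" by (simp add: star_scaleR star_add star_star add.commute)
  have "star ?v = (\<i>/2) *\<^sub>C (star x - x)"
    by (simp add: star_scaleC star_diff star_star)
  also have "\<dots> = (- (\<i>/2)) *\<^sub>C (- (star x - x))"
    by (simp only: scaleC_minus_left scaleC_minus_right minus_minus)
  finally show "star ?v = ?v" by simp
  have "\<i> *\<^sub>C ?v = (1/2) *\<^sub>R (x - star x)"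
    using scaleC_of_real[of "1/2" "x - star x"] by (simp add: scaleC_scaleC)
  then show "x = ?u + \<i> *\<^sub>C ?v"
    by (simp add: scaleR_add_right scaleR_diff_right flip: scaleR_left_distrib)
  show "norm ?u \<le> norm x" using norm_triangle_ineq[of x "star x"] by simp
  show "norm ?v \<le> norm x" using norm_triangle_ineq4[of x "star x"] by (simp add: norm_scaleC norm_divide)
qed

section \<open>Unitization\<close>

text \<open>The term \<open>\<bar>scal x\<bar>\<close> in the norm below keeps it definite when the algebra already has a unit.\<close>

datatype 'a unitization = Unitization (elem: 'a) (scal: complex)

definition left_action :: "'a::c_star_algebra unitization \<Rightarrow> 'a \<Rightarrow> 'a" where
  "left_action x b = elem x * b + scal x *\<^sub>C b"

lemma bounded_linear_left_action: "bounded_linear (left_action x)"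
  unfolding left_action_def
  by (intro bounded_linear_add bounded_linear_scaleC bounded_linear_mult_right)

instantiation unitization :: (c_star_algebra) real_normed_algebra_1
begin

definition "0 = Unitization 0 (0::complex)"
definition "1 = Unitization 0 (1::complex)"
definition "x + y = Unitization (elem x + elem y) (scal x + scal y)" for x y :: "'a unitization"
definition "x - y = Unitization (elem x - elem y) (scal x - scal y)" for x y :: "'a unitization"
definition "- x = Unitization (- elem x) (- scal x)" for x :: "'a unitization"
definition "x * y = Unitization (elem x * elem y + scal x *\<^sub>C elem y + scal y *\<^sub>C elem x) (scal x * scal y)" for x y :: "'a unitization"
definition "r *\<^sub>R x = Unitization (r *\<^sub>R elem x) (r *\<^sub>R scal x)" for x :: "'a unitization"
definition "norm x = max (onorm (left_action x)) (cmod (scal x))" for x :: "'a unitization"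
definition "sgn x = scaleR (inverse (norm x)) (x::'a unitization)"
definition "dist x y = norm (x - (y::'a unitization))"
definition "(uniformity :: ('a unitization \<times> 'a unitization) filter) = (INF e\<in>{0 <..}. principal {(x, y). dist x y < e})"
definition "open (U :: 'a unitization set) \<longleftrightarrow> (\<forall>x\<in>U. eventually (\<lambda>(x', y). x' = x \<longrightarrow> y \<in> U) uniformity)"

lemma elem_scal_simps [simp]:
  "elem 0 = 0" "scal 0 = 0" "elem 1 = 0" "scal 1 = 1"
  "elem (x + y) = elem x + elem y" "scal (x + y) = scal x + scal y"
  "elem (x - y) = elem x - elem y" "scal (x - y) = scal x - scal y"
  "elem (- x) = - elem x" "scal (- x) = - scal x"
  "elem (x * y) = elem x * elem y + scal x *\<^sub>C elem y + scal y *\<^sub>C elem x" "scal (x * y) = scal x * scal y"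
  "elem (r *\<^sub>R x) = r *\<^sub>R elem x" "scal (r *\<^sub>R x) = r *\<^sub>R scal x"
  by (simp_all add: zero_unitization_def one_unitization_def plus_unitization_def minus_unitization_def
      uminus_unitization_def times_unitization_def scaleR_unitization_def)

lemma unitization_eqI: "elem x = elem y \<Longrightarrow> scal x = scal y \<Longrightarrow> x = y"
  by (cases x; cases y) simp

lemma left_action_mult: "left_action (x * y) = left_action x \<circ> left_action y"
  by (auto simp: left_action_def fun_eq_iff algebra_simps scaleC_add_right mult_scaleC_left
      mult_scaleC_right scaleC_scaleC)

lemma left_action_add: "left_action (x + y) = (\<lambda>b. left_action x b + left_action y b)"
  by (auto simp: left_action_def fun_eq_iff algebra_simps scaleC_add_left)

lemma scaleR_scaleC: "(r *\<^sub>R c) *\<^sub>C b = r *\<^sub>R (c *\<^sub>C (b::'a))"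
proof -
  have "r *\<^sub>R c = complex_of_real r * c" by (rule scaleR_conv_of_real)
  then show ?thesis by (simp only: scaleC_of_real flip: scaleC_scaleC)
qed

lemma left_action_scaleR: "left_action (r *\<^sub>R x) = (\<lambda>b. r *\<^sub>R left_action x b)"
  by (simp add: left_action_def fun_eq_iff scaleR_add_right scaleR_scaleC)

lemma norm_left_action_le: "norm (left_action x b) \<le> norm x * norm b"
proof -
  have "norm (left_action x b) \<le> onorm (left_action x) * norm b"
    by (rule onorm[OF bounded_linear_left_action])
  also have "\<dots> \<le> norm x * norm b"
    by (intro mult_right_mono) (simp_all add: norm_unitization_def)
  finally show ?thesis .
qed

lemma norm_scal_le: "cmod (scal x) \<le> norm x"
  by (simp add: norm_unitization_def)

instance
proof
  fix x y z :: "'a unitization" and r s :: real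
  show "x + y + z = x + (y + z)" "x + y = y + x" "0 + x = x" "- x + x = 0" "x - y = x + - y"
    "r *\<^sub>R (x + y) = r *\<^sub>R x + r *\<^sub>R y" "(r + s) *\<^sub>R x = r *\<^sub>R x + s *\<^sub>R x"
    "r *\<^sub>R s *\<^sub>R x = (r * s) *\<^sub>R x" "1 *\<^sub>R x = x"
    by (rule unitization_eqI; simp add: algebra_simps)+
  show "(x + y) * z = x * z + y * z" "x * (y + z) = x * y + x * z"
    by (rule unitization_eqI; simp add: algebra_simps scaleC_add_left scaleC_add_right)+
  show "x * y * z = x * (y * z)"
    by (rule unitization_eqI; simp add: algebra_simps scaleC_add_left scaleC_add_right
      mult_scaleC_left mult_scaleC_right scaleC_scaleC)
  show "1 * x = x" "x * 1 = x"
    by (rule unitization_eqI; simp)+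
  show "r *\<^sub>R x * y = r *\<^sub>R (x * y)" "x * r *\<^sub>R y = r *\<^sub>R (x * y)"
    by (rule unitization_eqI; simp add: algebra_simps scaleR_scaleC scaleC_scaleR)+
  show "(0::'a unitization) \<noteq> 1" by (metis elem_scal_simps(2,4) zero_neq_one)
  show "norm x = 0 \<longleftrightarrow> x = 0"
  proof
    assume n0: "norm x = 0"
    then have s: "scal x = 0" using norm_scal_le[of x] by simp
    \<comment> \<open>Once the scalar part is 0 the action is left multiplication by
      \<open>elem x\<close>, which the test vector \<open>star (elem x)\<close> detects by the
      C*-identity.\<close>
    have "norm (left_action x (star (elem x))) \<le> 0"
      using norm_left_action_le[of x] n0 by (metis mult_zero_left)
    then have "elem x * star (elem x) = 0" by (simp add: left_action_def s)
    then have "elem x = 0" by (metis norm_mult_star_self norm_eq_zero zero_eq_power2)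
    with s show "x = 0" by (auto intro: unitization_eqI)
  next
    assume "x = 0"
    moreover have "left_action 0 = (\<lambda>b::'a. 0)" by (auto simp: left_action_def)
    ultimately show "norm x = 0" by (simp add: norm_unitization_def onorm_zero)
  qed
  show "norm (x + y) \<le> norm x + norm y"
    unfolding norm_unitization_def left_action_add
    using onorm_triangle[OF bounded_linear_left_action bounded_linear_left_action, of x y]
      norm_triangle_ineq[of "scal x" "scal y"] by (auto simp: max_def)
  show "norm (r *\<^sub>R x) = \<bar>r\<bar> * norm x"
    unfolding norm_unitization_def left_action_scaleR onorm_scaleR[OF bounded_linear_left_action]
    by (simp add: max_mult_distrib_left)
  show "norm (x * y) \<le> norm x * norm y"
  proof -
    have "onorm (left_action (x * y)) \<le> onorm (left_action x) * onorm (left_action y)"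
      unfolding left_action_mult by (intro onorm_compose bounded_linear_left_action)
    also have "\<dots> \<le> norm x * norm y"
      by (intro mult_mono) (auto simp: norm_unitization_def onorm_pos_le bounded_linear_left_action le_max_iff_disj)
    finally show ?thesis
      using mult_mono[OF norm_scal_le[of x] norm_scal_le[of y]]
      by (simp add: norm_unitization_def[of "x * y"] norm_mult le_max_iff_disj)
        (metis norm_scal_le norm_ge_zero order_trans)
  qed
  have "left_action 1 = (\<lambda>b::'a. b)" by (auto simp: left_action_def)
  then show "norm (1::'a unitization) = 1"
    using onorm_id_le by (simp add: norm_unitization_def max_def)
qed (rule sgn_unitization_def dist_unitization_def open_unitization_def uniformity_unitization_def)+

end

definition incl :: "'a::c_star_algebra \<Rightarrow> 'a unitization" where
  "incl a = Unitization a 0"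

lemma elem_incl [simp]: "elem (incl a) = a" and scal_incl [simp]: "scal (incl a) = 0"
  by (simp_all add: incl_def)

lemma norm_incl [simp]: "norm (incl a) = norm a"
proof -
  have la: "left_action (incl a) b = a * b" for b by (simp add: left_action_def)
  have "onorm (left_action (incl a)) \<le> norm a"
    by (intro onorm_bound) (simp_all add: la norm_mult_ineq)
  moreover have "norm a \<le> norm (incl a)"
  proof (cases "a = 0")
    case False
    have "norm a * norm a \<le> norm (incl a) * norm a"
      using norm_left_action_le[of "incl a" "star a"]
      by (simp add: la norm_mult_star_self power2_eq_square)
    then show ?thesis using False by simp
  qed simp
  ultimately show ?thesis by (simp add: norm_unitization_def max_def split: if_splits)
qed

lemma elem_incl_iff: "scal x = 0 \<longleftrightarrow> x = incl (elem x)"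
  by (cases x) (simp add: incl_def)

lemma incl_algebra:
  "incl (a + b) = incl a + incl b" "incl (a - b) = incl a - incl b" "incl 0 = 0"
  "incl (a * b) = incl a * incl b" "incl (r *\<^sub>R a) = r *\<^sub>R incl a" "incl (- a) = - incl a"
  by (auto intro: unitization_eqI)

lemma incl_eq_iff [simp]: "incl a = incl b \<longleftrightarrow> a = b"
  by (simp add: incl_def)

lemma bounded_linear_incl: "bounded_linear incl"
  by (rule bounded_linear_intro[where K=1]) (simp_all add: incl_algebra)

text \<open>Together with \<open>norm_unitization_le\<close> this makes the norm equivalent to the
  sum of the coordinate norms, whence completeness. The 2 comes from subtracting the scalar part,
  itself bounded by the norm.\<close>

lemma norm_elem_le: "norm (elem x) \<le> 2 * norm (x::'a::c_star_algebra unitization)"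
proof -
  have n: "norm (Unitization (0::'a) c) \<le> cmod c" for c
  proof -
    have "onorm (left_action (Unitization (0::'a) c)) \<le> cmod c"
      by (intro onorm_bound) (simp_all add: left_action_def norm_scaleC)
    then show ?thesis by (simp add: norm_unitization_def)
  qed
  have "incl (elem x) = x - Unitization 0 (scal x)" by (auto intro: unitization_eqI)
  then have "norm (elem x) \<le> norm x + norm (Unitization (0::'a) (scal x))"
    by (metis norm_incl norm_triangle_ineq4)
  also have "\<dots> \<le> norm x + norm x" using n norm_scal_le order_trans by (intro add_left_mono) blast
  finally show ?thesis by simp
qed

lemma norm_unitization_le: "norm x \<le> norm (elem x) + cmod (scal (x::'a::c_star_algebra unitization))"
proof -
  have "onorm (left_action x) \<le> norm (elem x) + cmod (scal x)"
  proof (intro onorm_bound)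
    show "norm (left_action x b) \<le> (norm (elem x) + cmod (scal x)) * norm b" for b
      unfolding left_action_def
      by (rule norm_triangle_le) (simp add: norm_mult_ineq norm_scaleC distrib_right)
  qed simp
  then show ?thesis by (simp add: norm_unitization_def)
qed

lemma bounded_linear_elem: "bounded_linear (elem :: 'a::c_star_algebra unitization \<Rightarrow> 'a)"
  by (rule bounded_linear_intro[where K=2]) (simp_all only: elem_scal_simps mult.commute[of _ 2] norm_elem_le)

lemma bounded_linear_scal: "bounded_linear (scal :: 'a::c_star_algebra unitization \<Rightarrow> complex)"
  by (rule bounded_linear_intro[where K=1]) (simp_all add: norm_scal_le)

instantiation unitization :: (c_star_algebra) c_star_algebra
begin

definition "c *\<^sub>C x = Unitization (c *\<^sub>C elem x) (c * scal x)" for x :: "'a unitization"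
definition "star x = Unitization (star (elem x)) (cnj (scal x))" for x :: "'a unitization"

lemma elem_scal_star_simps [simp]:
  "elem (c *\<^sub>C x) = c *\<^sub>C elem x" "scal (c *\<^sub>C x) = c * scal x"
  "elem (star x) = star (elem x)" "scal (star x) = cnj (scal x)"
  by (simp_all add: scaleC_unitization_def star_unitization_def)

text \<open>The algebra is an ideal of its unitization, so \<open>left_action x b\<close> lies in it
  and the C*-identity already known there applies to it.\<close>

lemma norm_power2_unitization_le: "(norm x)\<^sup>2 \<le> norm (star x * (x::'a unitization))"
proof -
  have "(norm (left_action x b))\<^sup>2 \<le> norm (star x * x) * (norm b)\<^sup>2" for b
  proof -
    have "star (left_action x b) * left_action x b = star b * left_action (star x * x) b"
      by (simp add: left_action_def star_add star_mult star_scaleC algebra_simps mult_scaleC_left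
          mult_scaleC_right scaleC_add_right scaleC_scaleC)
    then have "(norm (left_action x b))\<^sup>2 \<le> norm b * norm (left_action (star x * x) b)"
      by (metis norm_star_mult_self norm_mult_ineq norm_star)
    also have "\<dots> \<le> norm b * (norm (star x * x) * norm b)"
      by (intro mult_left_mono norm_left_action_le norm_ge_zero)
    finally show ?thesis by (simp add: power2_eq_square algebra_simps)
  qed
  then have "norm (left_action x b) \<le> sqrt (norm (star x * x)) * norm b" for b
    by (metis real_le_rsqrt real_sqrt_mult real_sqrt_abs abs_norm_cancel)
  then have "onorm (left_action x) \<le> sqrt (norm (star x * x))"
    by (intro onorm_bound) auto
  moreover have "cmod (scal x) \<le> sqrt (norm (star x * x))"
    using norm_scal_le[of "star x * x"] by (intro real_le_rsqrt) (simp add: norm_mult power2_eq_square)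
  ultimately have "norm x \<le> sqrt (norm (star x * x))"
    by (simp add: norm_unitization_def)
  then show ?thesis by (metis norm_ge_zero power_mono real_sqrt_pow2)
qed

instance
proof
  fix x y :: "'a unitization" and c d :: complex and r :: real
  show "c *\<^sub>C (x + y) = c *\<^sub>C x + c *\<^sub>C y" "(c + d) *\<^sub>C x = c *\<^sub>C x + d *\<^sub>C x"
    "c *\<^sub>C d *\<^sub>C x = (c * d) *\<^sub>C x"
    by (rule unitization_eqI; simp add: scaleC_add_right scaleC_add_left scaleC_scaleC algebra_simps)+
  show "complex_of_real r *\<^sub>C x = r *\<^sub>R x"
    by (rule unitization_eqI) (simp_all only: elem_scal_simps elem_scal_star_simps scaleC_of_real scaleR_conv_of_real[where 'a=complex])
  show "(c *\<^sub>C x) * y = c *\<^sub>C (x * y)" "x * (c *\<^sub>C y) = c *\<^sub>C (x * y)"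
    by (rule unitization_eqI; simp add: scaleC_add_right mult_scaleC_left mult_scaleC_right scaleC_scaleC algebra_simps)+
  have le: "norm (e *\<^sub>C z) \<le> cmod e * norm z" for e and z :: "'a unitization"
  proof -
    have "onorm (left_action (e *\<^sub>C z)) \<le> cmod e * norm z"
    proof (intro onorm_bound)
      fix b :: 'a
      have "left_action (e *\<^sub>C z) b = e *\<^sub>C left_action z b"
        by (simp add: left_action_def scaleC_add_right mult_scaleC_left scaleC_scaleC)
      then show "norm (left_action (e *\<^sub>C z) b) \<le> cmod e * norm z * norm b"
        using norm_left_action_le[of z b] by (simp add: norm_scaleC mult.assoc mult_left_mono)
    qed simp
    moreover have "cmod (scal (e *\<^sub>C z)) \<le> cmod e * norm z"
      by (simp add: norm_mult mult_left_mono norm_scal_le)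
    ultimately show ?thesis by (simp add: norm_unitization_def[of "e *\<^sub>C z"])
  qed
  show "norm (c *\<^sub>C x) = cmod c * norm x"
  proof (cases "c = 0")
    case True
    then show ?thesis using le[of c x] by simp
  next
    case False
    have "inverse c *\<^sub>C c *\<^sub>C x = x"
      by (rule unitization_eqI) (use False in \<open>simp_all add: scaleC_scaleC\<close>)
    then have "norm x \<le> norm (c *\<^sub>C x) / cmod c"
      using le[of "inverse c" "c *\<^sub>C x"] by (simp add: norm_inverse divide_inverse mult.commute)
    then show ?thesis using le[of c x] False by (simp add: field_simps)
  qed
  show "star (star x) = x" "star (x + y) = star x + star y" "star (c *\<^sub>C x) = cnj c *\<^sub>C star x"
    "star (x * y) = star y * star x"
    by (rule unitization_eqI; simp add: star_star star_add star_scaleC star_mult algebra_simps)+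
  show "norm (star x * x) = (norm x)\<^sup>2"
  proof -
    have le: "norm z \<le> norm (star z)" for z :: "'a unitization"
    proof (cases "z = 0")
      case False
      have "norm z * norm z \<le> norm (star z) * norm z"
        using norm_mult_ineq[of "star z" z] norm_power2_unitization_le[of z] by (simp add: power2_eq_square)
      then show ?thesis using False by simp
    qed simp
    have "star (star x) = x" by (rule unitization_eqI; simp add: star_star)
    then have "norm (star x) = norm x" using le[of x] le[of "star x"] by simp
    then have "norm (star x * x) \<le> (norm x)\<^sup>2"
      using norm_mult_ineq[of "star x" x] by (simp add: power2_eq_square)
    then show ?thesis using norm_power2_unitization_le[of x] by simp
  qed
  show "Cauchy X \<Longrightarrow> convergent X" for X :: "nat \<Rightarrow> 'a unitization"
  proof -
    assume X: "Cauchy X"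
    obtain a where a: "(\<lambda>n. elem (X n)) \<longlonglongrightarrow> a"
      using bounded_linear.Cauchy[OF bounded_linear_elem X] by (metis Cauchy_convergent convergent_def)
    obtain l where l: "(\<lambda>n. scal (X n)) \<longlonglongrightarrow> l"
      using bounded_linear.Cauchy[OF bounded_linear_scal X] by (metis Cauchy_convergent convergent_def)
    have "(\<lambda>n. norm (elem (X n) - a) + cmod (scal (X n) - l)) \<longlonglongrightarrow> 0 + 0"
      by (intro tendsto_add tendsto_norm_zero LIM_zero a l)
    then have lim: "(\<lambda>n. norm (elem (X n) - a) + cmod (scal (X n) - l)) \<longlonglongrightarrow> 0"
      by (simp only: add_0)
    have le: "norm (X n - Unitization a l) \<le> norm (elem (X n) - a) + cmod (scal (X n) - l)" for n
      using norm_unitization_le[of "X n - Unitization a l"]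
      by (simp only: elem_scal_simps unitization.sel)
    have "(\<lambda>n. X n - Unitization a l) \<longlonglongrightarrow> 0"
      by (rule Lim_null_comparison[OF _ lim]) (rule always_eventually, rule allI, rule le)
    then have "X \<longlonglongrightarrow> Unitization a l" by (rule LIM_zero_cancel)
    then show "convergent X" by (rule convergentI)
  qed
qed

end

lemma star_incl [simp]: "star (incl a) = incl (star a)"
  by (rule unitization_eqI) simp_all


section \<open>Square roots of contractions\<close>

text \<open>The iteration \<open>z \<mapsto> (w + z\<^sup>2) / 2\<close> converges to \<open>1 - \<surd>(1 - w)\<close>.  All its terms are polynomials in \<open>w\<close>
  with nonnegative coefficients, so for \<open>\<parallel>w\<parallel> \<le> 1\<close> the scalar iteration with \<open>w = 1\<close> is a majorant.\<close>

primrec root_iter :: "('a::real_vector \<Rightarrow> 'a) \<Rightarrow> nat \<Rightarrow> 'a \<Rightarrow> 'a" where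
  "root_iter w 0 = (\<lambda>x. 0)"
| "root_iter w (Suc n) = (\<lambda>x. (1/2) *\<^sub>R (w x + root_iter w n (root_iter w n x)))"

primrec majorant :: "nat \<Rightarrow> real" where
  "majorant 0 = 0"
| "majorant (Suc n) = (1 + (majorant n)\<^sup>2) / 2"

lemma majorant_bounds: "0 \<le> majorant n \<and> majorant n \<le> 1"
proof (induction n)
  case (Suc n)
  then have "(majorant n)\<^sup>2 \<le> 1" by (simp add: power_le_one)
  then show ?case by simp
qed simp

lemma majorant_mono: "incseq majorant"
proof (rule incseq_SucI)
  show "majorant n \<le> majorant (Suc n)" for n
    using sum_squares_ge_zero[of "1 - majorant n" 0] by (simp add: power2_eq_square algebra_simps)
qed

lemma majorant_Cauchy: "Cauchy majorant"
  using incseq_convergent[OF majorant_mono, of 1] majorant_bounds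
  by (meson LIMSEQ_imp_Cauchy)

definition root_op :: "('a::real_normed_vector \<Rightarrow> 'a) \<Rightarrow> 'a \<Rightarrow> 'a" where
  "root_op w x = x - lim (\<lambda>n. root_iter w n x)"

text \<open>Stated for operators so that one construction covers left and right multiplications and,
  later, the operator of \<open>h\<close> on \<open>C\<close>.\<close>

locale contraction_on =
  fixes S :: "'a::banach set" and w :: "'a \<Rightarrow> 'a"
  assumes sub: "subspace S" and closed: "closed S"
    and into: "x \<in> S \<Longrightarrow> w x \<in> S"
    and add: "x \<in> S \<Longrightarrow> y \<in> S \<Longrightarrow> w (x + y) = w x + w y"
    and scale: "x \<in> S \<Longrightarrow> w (r *\<^sub>R x) = r *\<^sub>R w x"
    and contr: "x \<in> S \<Longrightarrow> norm (w x) \<le> norm x"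
begin

abbreviation "z \<equiv> root_iter w"

lemma z_in: "x \<in> S \<Longrightarrow> z n x \<in> S"
  by (induction n arbitrary: x) (auto intro!: subspace_0 subspace_scale subspace_add sub into)

lemma z_add: "x \<in> S \<Longrightarrow> y \<in> S \<Longrightarrow> z n (x + y) = z n x + z n y"
  by (induction n arbitrary: x y) (simp_all add: add z_in scaleR_add_right algebra_simps)

lemma z_scale: "x \<in> S \<Longrightarrow> z n (r *\<^sub>R x) = r *\<^sub>R z n x"
  by (induction n arbitrary: x) (simp_all add: scale z_in scaleR_add_right mult.commute)

lemma z_diff: "x \<in> S \<Longrightarrow> y \<in> S \<Longrightarrow> z n (x - y) = z n x - z n y"
  using z_add[of x "(-1) *\<^sub>R y" n] z_scale[of y n "-1"] sub by (simp add: subspace_neg)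

lemma z_norm: "x \<in> S \<Longrightarrow> norm (z n x) \<le> majorant n * norm x"
proof (induction n arbitrary: x)
  case (Suc n)
  have "norm (z n (z n x)) \<le> majorant n * norm (z n x)" by (rule Suc.IH) (rule z_in[OF Suc.prems])
  also have "\<dots> \<le> majorant n * (majorant n * norm x)"
    by (intro mult_left_mono Suc.IH Suc.prems) (simp add: majorant_bounds)
  finally have "norm (w x + z n (z n x)) \<le> norm x + (majorant n)\<^sup>2 * norm x"
    using contr[OF Suc.prems] by (intro norm_triangle_le add_mono) (simp_all add: power2_eq_square)
  then show ?case by (simp add: distrib_right del: scaleR_add_right)
qed simp

lemma z_norm_le: "x \<in> S \<Longrightarrow> norm (z n x) \<le> norm x"
  using z_norm[of x n] majorant_bounds[of n] by (meson mult_left_le_one_le norm_ge_zero order_trans)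

text \<open>The factorisation \<open>m'^2 - m^2 = m' (m' - m) + (m' - m) m\<close> for operators
  under composition. Its second term needs the induction hypothesis at the vector
  \<open>z n x\<close> instead of \<open>x\<close>.\<close>

lemma z_step: "x \<in> S \<Longrightarrow> norm (z (Suc n) x - z n x) \<le> (majorant (Suc n) - majorant n) * norm x"
proof (induction n arbitrary: x)
  case 0
  then show ?case using contr[of x] by simp
next
  case (Suc n)
  let ?d = "z (Suc n) x - z n x" and ?m = "majorant n" and ?m' = "majorant (Suc n)"
  note [simp del] = root_iter.simps(2) majorant.simps(2)
  have inS: "z k x \<in> S" for k by (rule z_in[OF Suc.prems])
  have dS: "?d \<in> S" using inS sub by (simp add: subspace_diff)
  have "z (Suc (Suc n)) x - z (Suc n) x = (1/2) *\<^sub>R (z (Suc n) (z (Suc n) x) - z n (z n x))"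
    using arg_cong2[where f=minus, OF root_iter.simps(2)[of w "Suc n", THEN fun_cong, of x] root_iter.simps(2)[of w n, THEN fun_cong, of x]]
    by (simp only: add_diff_cancel_left flip: scaleR_diff_right)
  also have "z (Suc n) (z (Suc n) x) - z n (z n x) = z (Suc n) ?d + (z (Suc n) (z n x) - z n (z n x))"
    by (simp add: z_diff inS)
  finally have eq: "z (Suc (Suc n)) x - z (Suc n) x = (1/2) *\<^sub>R (z (Suc n) ?d + (z (Suc n) (z n x) - z n (z n x)))" .
  have "norm (z (Suc n) ?d) \<le> ?m' * norm ?d" by (rule z_norm[OF dS])
  also have "\<dots> \<le> ?m' * ((?m' - ?m) * norm x)"
    by (intro mult_left_mono Suc) (simp add: majorant_bounds)
  finally have 1: "norm (z (Suc n) ?d) \<le> ?m' * ((?m' - ?m) * norm x)" .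
  have "norm (z (Suc n) (z n x) - z n (z n x)) \<le> (?m' - ?m) * norm (z n x)" by (rule Suc.IH[OF inS])
  also have "\<dots> \<le> (?m' - ?m) * (?m * norm x)"
    using incseqD[OF majorant_mono, of n "Suc n"]
    by (intro mult_left_mono z_norm Suc.prems) simp
  finally have "norm (z (Suc (Suc n)) x - z (Suc n) x)
      \<le> (1/2) * (?m' * ((?m' - ?m) * norm x) + (?m' - ?m) * (?m * norm x))"
    unfolding eq norm_scaleR using 1 by (auto intro!: norm_triangle_le)
  also have "\<dots> = (majorant (Suc (Suc n)) - majorant (Suc n)) * norm x"
  proof -
    have half: "M = (1 + p) / 2 \<Longrightarrow> M' = (1 + q) / 2 \<Longrightarrow> M - M' = (1/2) * (p - q)" for M M' p q :: real
      by (simp add: field_simps)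
    have "majorant (Suc (Suc n)) - ?m' = (1/2) * (?m' * ?m' - ?m * ?m)"
      by (rule half; subst majorant.simps(2); simp only: power2_eq_square)
    then show ?thesis by (simp only:) (simp add: algebra_simps)
  qed
  finally show ?case .
qed

lemma z_dist: "x \<in> S \<Longrightarrow> norm (z (n + k) x - z n x) \<le> (majorant (n + k) - majorant n) * norm x"
proof (induction k)
  case (Suc k)
  have "norm (z (n + Suc k) x - z n x) \<le> norm (z (Suc (n + k)) x - z (n + k) x) + norm (z (n + k) x - z n x)"
    using norm_triangle_ineq[of "z (Suc (n + k)) x - z (n + k) x" "z (n + k) x - z n x"]
    by (simp del: root_iter.simps)
  also have "\<dots> \<le> (majorant (Suc (n + k)) - majorant (n + k)) * norm x + (majorant (n + k) - majorant n) * norm x"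
    by (intro add_mono z_step Suc.prems Suc.IH)
  also have "\<dots> = (majorant (n + Suc k) - majorant n) * norm x"
    by (simp add: left_diff_distrib del: majorant.simps)
  finally show ?case .
qed simp

definition Z where "Z x = lim (\<lambda>n. z n x)"

lemma z_tendsto: "x \<in> S \<Longrightarrow> (\<lambda>n. z n x) \<longlonglongrightarrow> Z x"
proof -
  assume x: "x \<in> S"
  have "Cauchy (\<lambda>n. z n x)"
  proof (rule CauchyI')
    fix e :: real assume e: "0 < e"
    define d where "d = e / (norm x + 1)"
    have "0 < d" using e by (simp add: d_def add_nonneg_pos)
    then obtain M where M: "\<And>m n. M \<le> m \<Longrightarrow> M \<le> n \<Longrightarrow> norm (majorant m - majorant n) < d"
      using CauchyD[OF majorant_Cauchy] by metis
    have "norm (z m x - z n x) < e" if "m \<ge> M" "m < n" for m n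
    proof -
      have "norm (z m x - z n x) \<le> (majorant n - majorant m) * norm x"
        using z_dist[OF x, of m "n - m"] that by (simp add: norm_minus_commute)
      also have "\<dots> \<le> d * norm x"
        using M[of n m] that by (intro mult_right_mono) auto
      also have "\<dots> < d * (norm x + 1)" using \<open>0 < d\<close> by simp
      also have "\<dots> = e" by (simp add: d_def add_nonneg_eq_0_iff)
      finally show ?thesis .
    qed
    then show "\<exists>M. \<forall>m\<ge>M. \<forall>n>m. dist (z m x) (z n x) < e" unfolding dist_norm by blast
  qed
  then show ?thesis unfolding Z_def by (simp add: Cauchy_convergent_iff convergent_LIMSEQ_iff)
qed

lemma Z_in: "x \<in> S \<Longrightarrow> Z x \<in> S"
  using closed_sequentially[OF closed, of "\<lambda>n. z n x"] z_in z_tendsto by blast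

lemma Z_add: "x \<in> S \<Longrightarrow> y \<in> S \<Longrightarrow> Z (x + y) = Z x + Z y"
  using tendsto_add[OF z_tendsto z_tendsto, of x y] z_tendsto[of "x + y"] sub
  by (simp add: z_add subspace_add LIMSEQ_unique)

lemma Z_scale: "x \<in> S \<Longrightarrow> Z (r *\<^sub>R x) = r *\<^sub>R Z x"
  using tendsto_scaleR[OF tendsto_const z_tendsto, of x r] z_tendsto[of "r *\<^sub>R x"] sub
  by (simp add: z_scale subspace_scale LIMSEQ_unique)

lemma Z_norm: "x \<in> S \<Longrightarrow> norm (Z x) \<le> norm x"
  using z_norm_le by (intro Lim_norm_ubound[OF _ z_tendsto]) auto

text \<open>Pointwise convergence of \<open>z n\<close> passes to compositions because the
  \<open>z n\<close> are uniformly contractive. The result is the fixed-point equation of the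
  iteration and amounts to \<open>(1 - Z)^2 = 1 - w\<close>.\<close>

lemma Z_eq: assumes x: "x \<in> S" shows "2 *\<^sub>R Z x = w x + Z (Z x)"
proof -
  have "(\<lambda>n. z n (z n x - Z x)) \<longlonglongrightarrow> 0"
  proof (rule Lim_null_comparison)
    show "\<forall>\<^sub>F n in sequentially. norm (z n (z n x - Z x)) \<le> norm (z n x - Z x)"
      using sub by (intro always_eventually allI z_norm_le subspace_diff z_in Z_in x)
    show "(\<lambda>n. norm (z n x - Z x)) \<longlonglongrightarrow> 0"
      by (intro tendsto_norm_zero LIM_zero z_tendsto x)
  qed
  then have "(\<lambda>n. z n (z n x) - z n (Z x)) \<longlonglongrightarrow> 0"
    by (simp add: z_diff z_in Z_in x)
  from tendsto_add[OF this z_tendsto[OF Z_in[OF x]]]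
  have "(\<lambda>n. z n (z n x)) \<longlonglongrightarrow> Z (Z x)" by simp
  then have "(\<lambda>n. w x + z n (z n x)) \<longlonglongrightarrow> w x + Z (Z x)" by (intro tendsto_intros)
  moreover have "(\<lambda>n. 2 *\<^sub>R z (Suc n) x) \<longlonglongrightarrow> 2 *\<^sub>R Z x"
    by (intro tendsto_intros LIMSEQ_Suc z_tendsto x)
  ultimately show ?thesis by (simp add: LIMSEQ_unique)
qed

lemma root_eq: "root_op w x = x - Z x"
  by (simp add: root_op_def Z_def)

lemma root_in: "x \<in> S \<Longrightarrow> root_op w x \<in> S"
  using sub by (simp add: root_eq subspace_diff Z_in)

lemma root_add: "x \<in> S \<Longrightarrow> y \<in> S \<Longrightarrow> root_op w (x + y) = root_op w x + root_op w y"
  by (simp add: root_eq Z_add)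

lemma root_scale: "x \<in> S \<Longrightarrow> root_op w (r *\<^sub>R x) = r *\<^sub>R root_op w x"
  by (simp add: root_eq Z_scale scaleR_diff_right)

lemma root_contr: "x \<in> S \<Longrightarrow> norm (x - root_op w x) \<le> norm x"
  by (simp add: root_eq Z_norm)

lemma root_root: assumes x: "x \<in> S" shows "root_op w (root_op w x) = x - w x"
proof -
  have "Z (x - Z x) = Z x - Z (Z x)"
    using Z_add[of x "(-1) *\<^sub>R Z x"] Z_scale[of "Z x" "-1"] x Z_in sub by (simp add: subspace_neg)
  then have "root_op w (root_op w x) = x - 2 *\<^sub>R Z x + Z (Z x)"
    by (simp add: root_eq scaleR_2)
  then show ?thesis by (simp add: Z_eq[OF x])
qed

end

text \<open>The source of the algebraic properties of roots: commutation and compatibility with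
  products or with the involution are all intertwining relations. \<open>X\<close> is taken real
  linear to admit the conjugate-linear \<open>star\<close>.\<close>

lemma root_op_intertwine:
  assumes w: "contraction_on S w" and w': "contraction_on S' w'"
    and X: "bounded_linear X" and XS: "\<And>x. x \<in> S \<Longrightarrow> X x \<in> S'"
    and Xw: "\<And>x. x \<in> S \<Longrightarrow> X (w x) = w' (X x)" and x: "x \<in> S"
  shows "X (root_op w x) = root_op w' (X x)"
proof -
  interpret w: contraction_on S w by fact
  interpret w': contraction_on S' w' by fact
  interpret X: bounded_linear X by fact
  have it: "y \<in> S \<Longrightarrow> X (root_iter w n y) = root_iter w' n (X y)" for n y
    by (induction n arbitrary: y) (simp_all add: X.zero X.add X.scaleR Xw w.z_in)
  have "X (w.Z x) = w'.Z (X x)"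
    using X.tendsto[OF w.z_tendsto[OF x]] w'.z_tendsto[OF XS[OF x]] by (simp add: it x LIMSEQ_unique)
  then show ?thesis by (simp add: w.root_eq w'.root_eq X.diff)
qed


section \<open>Positive elements of a unital C*-algebra\<close>

class unital_c_star_algebra = c_star_algebra + real_normed_algebra_1

instance unitization :: (c_star_algebra) unital_c_star_algebra ..

lemma mult_left_commute_of: "a * b = b * a \<Longrightarrow> a * (b * c) = b * (a * c)"
  for a b c :: "'a::semigroup_mult"
  by (metis mult.assoc)

lemma star_one [simp]: "star 1 = (1::'a::unital_c_star_algebra)"
  by (metis mult.right_neutral star_mult star_star)

lemma norm_sa_square: "star a = a \<Longrightarrow> norm (a * a) = (norm (a::'a::c_star_algebra))\<^sup>2"
  using norm_star_mult_self[of a] by simp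

lemma sa_square_eq_0: "star a = a \<Longrightarrow> a * a = 0 \<Longrightarrow> a = (0::'a::c_star_algebra)"
  using star_mult_self_eq_0_iff[of a] by simp

definition root1 :: "'a::unital_c_star_algebra \<Rightarrow> 'a" where
  "root1 w = root_op ((*) w) 1"

lemma contraction_left:
  fixes w :: "'a::unital_c_star_algebra"
  assumes "norm w \<le> 1" "subspace S" "closed S" "\<And>x. x \<in> S \<Longrightarrow> w * x \<in> S"
  shows "contraction_on S ((*) w)"
proof
  show "norm (w * x) \<le> norm x" for x
    using norm_mult_ineq[of w x] mult_left_le_one_le[of "norm x" "norm w"] assms(1) by simp
qed (use assms in \<open>auto simp: algebra_simps\<close>)

lemma contraction_right:
  fixes w :: "'a::unital_c_star_algebra"
  assumes "norm w \<le> 1" "subspace S" "closed S" "\<And>x. x \<in> S \<Longrightarrow> x * w \<in> S"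
  shows "contraction_on S (\<lambda>x. x * w)"
proof
  show "norm (x * w) \<le> norm x" for x
    using norm_mult_ineq[of x w] mult_right_le_one_le[of "norm x" "norm w"] assms(1) by simp
qed (use assms in \<open>auto simp: algebra_simps\<close>)

text \<open>Right multiplication by \<open>x\<close> commutes with left multiplication by
  \<open>w\<close>, so the operator root is itself a left multiplication, by its value at 1.\<close>

lemma root_op_mult: "norm w \<le> 1 \<Longrightarrow> root_op ((*) w) x = root1 w * x"
  for w :: "'a::unital_c_star_algebra"
  using root_op_intertwine[OF contraction_left contraction_left, of w UNIV w UNIV "\<lambda>y. y * x" 1]
  by (simp add: root1_def bounded_linear_mult_left mult.assoc)

lemma root1_intertwine:
  fixes w w' y :: "'a::unital_c_star_algebra"
  assumes "norm w \<le> 1" "norm w' \<le> 1" "y * w = w' * y"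
  shows "y * root1 w = root1 w' * y"
proof -
  have "y * root_op ((*) w) 1 = root_op ((*) w') (y * 1)"
    by (rule root_op_intertwine[of UNIV "(*) w" UNIV "(*) w'"])
      (use assms in \<open>auto intro!: contraction_left bounded_linear_mult_right simp flip: mult.assoc\<close>)
  then show ?thesis using root_op_mult[OF assms(2), of y] by (simp add: root1_def)
qed

lemma root1:
  fixes w :: "'a::unital_c_star_algebra"
  assumes w: "norm w \<le> 1"
  shows root1_square: "root1 w * root1 w = 1 - w"
    and root1_norm: "norm (1 - root1 w) \<le> 1"
    and root1_star: "star w = w \<Longrightarrow> star (root1 w) = root1 w"
proof -
  interpret contraction_on UNIV "(*) w"
    by (rule contraction_left) (use w in auto)
  show "root1 w * root1 w = 1 - w"
    using root_root[of 1] by (simp add: root_op_mult w)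
  show "norm (1 - root1 w) \<le> 1"
    using root_contr[of 1] by (simp add: root_op_mult w)
  assume sw: "star w = w"
  \<comment> \<open>The involution turns the root of left multiplication by \<open>w\<close> into
    that of right multiplication. Both multiplications coincide on the commutant \<open>S\<close> of
    \<open>w\<close>, and 1 lies in \<open>S\<close>, so the two roots agree at 1.\<close>
  define S where "S = {x. w * x = x * w}"
  have S: "subspace S" by (auto simp: S_def subspace_def algebra_simps)
  have "closed S" unfolding S_def
    by (intro closed_Collect_eq continuous_intros)
  have "w * x \<in> S" "x * w \<in> S" if "x \<in> S" for x
  proof -
    from that have x: "w * x = x * w" by (simp add: S_def)
    have "w * (x * w) = (x * w) * w" by (simp only: x flip: mult.assoc)
    then show "w * x \<in> S" "x * w \<in> S" by (simp_all add: S_def x)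
  qed
  then have c: "contraction_on S ((*) w)" "contraction_on S (\<lambda>x. x * w)"
    by (intro contraction_left contraction_right w S \<open>closed S\<close>; blast)+
  have "star (root_op ((*) w) 1) = root_op (\<lambda>x. x * w) (star 1)"
    by (rule root_op_intertwine[of UNIV "(*) w" UNIV "\<lambda>x. x * w"])
      (auto intro!: contraction_left contraction_right w bounded_linear_star simp: star_mult sw)
  moreover have "root_op ((*) w) 1 = root_op (\<lambda>x. x * w) 1"
    by (rule root_op_intertwine[OF c, of "\<lambda>x. x"])
      (auto simp: S_def bounded_linear_ident)
  ultimately show "star (root1 w) = root1 w" by (simp add: root1_def)
qed

text \<open>The witness \<open>t\<close> is not tied to the norm of \<open>a\<close>, so closure
  under sums is the triangle inequality. That every bound of the norm is a witness is shown in
  \<open>pos_complement\<close>.\<close>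

definition pos :: "'a::unital_c_star_algebra \<Rightarrow> bool" where
  "pos a \<longleftrightarrow> star a = a \<and> (\<exists>t\<ge>0. norm (t *\<^sub>R 1 - a) \<le> t)"

lemma pos_star: "pos a \<Longrightarrow> star a = a"
  by (simp add: pos_def)

lemma pos_0 [simp]: "pos 0"
  by (auto simp: pos_def)

lemma pos_add: assumes "pos a" "pos b" shows "pos (a + b)"
proof -
  obtain s t where "s \<ge> 0" "norm (s *\<^sub>R 1 - a) \<le> s" "t \<ge> 0" "norm (t *\<^sub>R 1 - b) \<le> t"
    using assms by (auto simp: pos_def)
  moreover have "(s + t) *\<^sub>R 1 - (a + b) = (s *\<^sub>R 1 - a) + (t *\<^sub>R 1 - b)"
    by (simp add: algebra_simps)
  ultimately have "s + t \<ge> 0" "norm ((s + t) *\<^sub>R 1 - (a + b)) \<le> s + t"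
    by (simp_all only: norm_triangle_mono add_nonneg_nonneg)
  then show ?thesis using assms unfolding pos_def by (metis star_add)
qed

lemma pos_scaleR: assumes "pos a" "r \<ge> 0" shows "pos (r *\<^sub>R a)"
proof -
  obtain t where t: "t \<ge> 0" "norm (t *\<^sub>R 1 - a) \<le> t" using assms by (auto simp: pos_def)
  have "norm ((r * t) *\<^sub>R 1 - r *\<^sub>R a) = r * norm (t *\<^sub>R 1 - a)"
    using assms(2) by (metis abs_of_nonneg norm_scaleR scaleR_diff_right scaleR_scaleR)
  also have "\<dots> \<le> r * t" using t assms by (intro mult_left_mono)
  finally have "norm ((r * t) *\<^sub>R 1 - r *\<^sub>R a) \<le> r * t" "r * t \<ge> 0" using t assms by auto
  then show ?thesis using assms unfolding pos_def by (metis star_scaleR)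
qed

lemma pos_sum: "(\<And>i. i \<in> I \<Longrightarrow> pos (f i)) \<Longrightarrow> pos (sum f I)"
  by (induction I rule: infinite_finite_induct) (auto intro: pos_add)

text \<open>The criterion says that \<open>w = 1 - a / t\<close> is a contraction, and the bound on
  \<open>1 - root1 w\<close> is the criterion for the root, with witness \<open>sqrt t\<close>. The
  commutation clause stands in for a functional calculus.\<close>

lemma pos_root:
  assumes "pos a"
  obtains k where "pos k" "k * k = a" "\<And>y. y * a = a * y \<Longrightarrow> y * k = k * y"
proof -
  obtain t where t: "t \<ge> 0" "norm (t *\<^sub>R 1 - a) \<le> t" using assms by (auto simp: pos_def)
  show thesis
  proof (cases "t = 0")
    case True
    then have "a = 0" using t by simp
    then show thesis using that[of 0] by simp
  next
    case False
    then have t0: "t > 0" using t by simp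
    define w where "w = 1 - (1/t) *\<^sub>R a"
    have "w = (1/t) *\<^sub>R (t *\<^sub>R 1 - a)" using t0 by (simp add: w_def scaleR_diff_right)
    then have "norm w = norm (t *\<^sub>R 1 - a) / t" using t0 by simp
    then have w: "norm w \<le> 1" using t t0 by simp
    have sw: "star w = w" using assms by (simp add: w_def star_diff star_scaleR pos_def)
    define k where "k = sqrt t *\<^sub>R root1 w"
    have "norm (sqrt t *\<^sub>R 1 - k) = sqrt t * norm (1 - root1 w)"
      using t0 by (simp add: k_def flip: scaleR_diff_right)
    also have "\<dots> \<le> sqrt t" using root1_norm[OF w] t0 by (simp add: mult_left_le)
    finally have "pos k" unfolding pos_def using root1_star[OF w sw] t0
      by (intro conjI exI[of _ "sqrt t"]) (auto simp: k_def star_scaleR)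
    moreover have "k * k = a"
    proof -
      have "k * k = t *\<^sub>R (root1 w * root1 w)" using t0 by (simp add: k_def)
      also have "\<dots> = a" unfolding root1_square[OF w] using t0 by (simp add: w_def)
      finally show ?thesis .
    qed
    moreover have "y * k = k * y" if "y * a = a * y" for y
      using root1_intertwine[OF w w, of y] that by (simp add: k_def w_def algebra_simps)
    ultimately show thesis using that by blast
  qed
qed

text \<open>For commuting self-adjoint \<open>u\<close> and \<open>v\<close>, both \<open>u + \<i>v\<close> and \<open>u - \<i>v\<close> have
  square-norm \<open>\<parallel>u\<^sup>2 + v\<^sup>2\<parallel>\<close>, and \<open>u\<close> is their mean.\<close>

lemma norm_square_le_sum_squares:
  fixes u v :: "'a::c_star_algebra"
  assumes "star u = u" "star v = v" "u * v = v * u"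
  shows "(norm u)\<^sup>2 \<le> norm (u * u + v * v)"
proof -
  let ?n = "sqrt (norm (u * u + v * v))"
  let ?x = "u + \<i> *\<^sub>C v" and ?y = "u - \<i> *\<^sub>C v"
  have "star ?x = ?y" "star ?y = ?x"
    using assms by (simp_all add: star_add star_diff star_scaleC scaleC_minus_left)
  moreover have "?y * ?x = u * u + v * v" "?x * ?y = u * u + v * v"
    using assms(3) by (simp_all add: algebra_simps mult_scaleC_left mult_scaleC_right scaleC_scaleC
        scaleC_diff_right scaleC_add_right)
  ultimately have "(norm ?x)\<^sup>2 = norm (u * u + v * v)" "(norm ?y)\<^sup>2 = norm (u * u + v * v)"
    by (metis norm_star_mult_self)+
  then have "norm ?x = ?n" "norm ?y = ?n"
    by (metis norm_ge_zero real_sqrt_unique)+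
  moreover have "2 *\<^sub>R u = (u + \<i> *\<^sub>C v) + (u - \<i> *\<^sub>C v)" by (simp add: scaleR_2)
  ultimately have "2 * norm u \<le> 2 * ?n"
    using norm_triangle_ineq[of "u + \<i> *\<^sub>C v" "u - \<i> *\<^sub>C v"]
    by (metis abs_numeral norm_scaleR mult_2)
  then have "norm u \<le> ?n" by simp
  then have "(norm u)\<^sup>2 \<le> ?n\<^sup>2" by (intro power_mono) auto
  then show ?thesis by simp
qed

text \<open>For scalars this is the circle \<open>u^2 + r^2 = t\<close>. The root of
  \<open>1 - r^2 / t\<close> commutes with \<open>r\<close>, so
  \<open>norm_square_le_sum_squares\<close> bounds \<open>u\<close> by the norm of
  \<open>u^2 + r^2\<close>.\<close>

lemma sa_square_complement:
  fixes r :: "'a::unital_c_star_algebra"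
  assumes r: "star r = r" and t: "(norm r)\<^sup>2 \<le> t"
  obtains u where "star u = u" "u * u = t *\<^sub>R 1 - r * r" "norm (u * u) \<le> t"
proof (cases "t = 0")
  case True
  then have "r = 0" using t by simp
  then show ?thesis using that[of 0] True by simp
next
  case False
  then have t0: "t > 0" using t by (smt (verit) zero_le_power2)
  define w where "w = (1/t) *\<^sub>R (r * r)"
  have "norm w = (norm r)\<^sup>2 / t" using t0 r by (simp add: w_def norm_sa_square)
  then have w: "norm w \<le> 1" using t t0 by simp
  have sw: "star w = w" using r by (simp add: w_def star_scaleR star_mult)
  define u where "u = sqrt t *\<^sub>R root1 w"
  have su: "star u = u" by (simp add: u_def star_scaleR root1_star w sw)
  have uu: "u * u = t *\<^sub>R 1 - r * r"
  proof -
    have "u * u = t *\<^sub>R (root1 w * root1 w)" using t0 by (simp add: u_def)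
    also have "\<dots> = t *\<^sub>R 1 - r * r"
      unfolding root1_square[OF w] using t0 by (simp add: w_def scaleR_diff_right)
    finally show ?thesis .
  qed
  have "r * root1 w = root1 w * r"
    by (rule root1_intertwine[OF w w]) (simp add: w_def mult.assoc)
  then have ur: "u * r = r * u" by (simp add: u_def)
  have "(norm u)\<^sup>2 \<le> norm (u * u + r * r)" by (rule norm_square_le_sum_squares[OF su r ur])
  also have "\<dots> = t" using t0 by (simp add: uu)
  finally show ?thesis using that[OF su uu] su by (simp add: norm_sa_square)
qed

lemma pos_square: "star r = r \<Longrightarrow> pos (r * r)"
proof -
  assume r: "star r = r"
  obtain u where u: "u * u = (norm r)\<^sup>2 *\<^sub>R 1 - r * r" "norm (u * u) \<le> (norm r)\<^sup>2"
    using sa_square_complement[OF r order_refl] by metis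
  then show ?thesis unfolding pos_def
    by (intro conjI exI[of _ "(norm r)\<^sup>2"]) (simp_all only: star_mult r u zero_le_power2 flip: u(1))
qed

lemma pos_complement:
  assumes "pos a" "norm a \<le> t"
  shows "pos (t *\<^sub>R 1 - a)" and "norm (t *\<^sub>R 1 - a) \<le> t"
proof -
  obtain r where r: "pos r" "r * r = a" using pos_root[OF assms(1)] by metis
  then have "(norm r)\<^sup>2 \<le> t" using assms norm_sa_square[OF pos_star[OF r(1)]] by simp
  then obtain u where u: "star u = u" "u * u = t *\<^sub>R 1 - r * r" "norm (u * u) \<le> t"
    using sa_square_complement[OF pos_star[OF r(1)]] by metis
  show "pos (t *\<^sub>R 1 - a)" using pos_square[OF u(1)] u r by simp
  show "norm (t *\<^sub>R 1 - a) \<le> t" using u r by simp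
qed

text \<open>A root commutes with whatever commutes with its square, so the two roots commute and
  \<open>a * b\<close> is the square of their self-adjoint product.\<close>

lemma pos_mult:
  assumes "pos a" "pos b" "a * b = b * a"
  shows "pos (a * b)"
proof -
  obtain r where r: "pos r" "r * r = a" "\<And>y. y * a = a * y \<Longrightarrow> y * r = r * y"
    using pos_root[OF assms(1)] by metis
  obtain s where s: "pos s" "s * s = b" "\<And>y. y * b = b * y \<Longrightarrow> y * s = s * y"
    using pos_root[OF assms(2)] by metis
  have "b * r = r * b" using r(3)[of b] assms(3) by simp
  then have rs: "r * s = s * r" using s(3)[of r] by simp
  have "star (r * s) = r * s" by (simp only: star_mult pos_star[OF r(1)] pos_star[OF s(1)] rs)
  then have "pos (r * s * (r * s))" by (rule pos_square)
  also have "r * s * (r * s) = r * (s * r) * s" by (simp only: mult.assoc)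
  also have "\<dots> = r * r * (s * s)" by (simp only: mult.assoc flip: rs)
  finally show ?thesis by (simp only: r(2) s(2))
qed

lemma pos_antisym:
  assumes "pos a" "pos (- a)"
  shows "a = 0"
proof -
  obtain r where r: "pos r" "r * r = a" "\<And>y. y * a = a * y \<Longrightarrow> y * r = r * y"
    using pos_root[OF assms(1)] by metis
  obtain s where s: "pos s" "s * s = - a" "\<And>y. y * (- a) = (- a) * y \<Longrightarrow> y * s = s * y"
    using pos_root[OF assms(2)] by metis
  have "r * a = a * r" using r(2) by (metis mult.assoc)
  then have "r * s = s * r" by (intro s(3)) simp
  then have "(norm r)\<^sup>2 \<le> norm (r * r + s * s)"
    by (intro norm_square_le_sum_squares) (auto intro: pos_star r(1) s(1))
  then show ?thesis using r(2) s(2) by simp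
qed

lemma pos_norm_le:
  assumes "pos a" "pos (t *\<^sub>R 1 - a)" "t \<ge> 0"
  shows "norm a \<le> t"
proof -
  obtain r where r: "pos r" "r * r = a" "\<And>y. y * a = a * y \<Longrightarrow> y * r = r * y"
    using pos_root[OF assms(1)] by metis
  obtain s where s: "pos s" "s * s = t *\<^sub>R 1 - a" "\<And>y. y * (t *\<^sub>R 1 - a) = (t *\<^sub>R 1 - a) * y \<Longrightarrow> y * s = s * y"
    using pos_root[OF assms(2)] by metis
  have "r * a = a * r" using r(2) by (metis mult.assoc)
  then have "r * s = s * r" by (intro s(3)) (simp add: algebra_simps)
  then have "(norm r)\<^sup>2 \<le> norm (r * r + s * s)"
    by (intro norm_square_le_sum_squares) (auto intro: pos_star r(1) s(1))
  then show ?thesis using r(2) s(2) assms(3) norm_sa_square[OF pos_star[OF r(1)]] by simp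
qed

lemma pos_norm_mono:
  assumes "pos a" "pos (b - a)"
  shows "norm a \<le> norm b"
proof -
  have "pos b" using pos_add[OF assms] by simp
  then have "pos (norm b *\<^sub>R 1 - b)" by (rule pos_complement) simp
  from pos_add[OF this assms(2)] show ?thesis by (intro pos_norm_le assms) (simp_all add: algebra_simps)
qed

lemma pos_limit:
  assumes "f \<longlonglongrightarrow> a" "\<And>n. pos (f n)"
  shows "pos a"
proof -
  have "bounded (range f)" using assms(1) convergent_imp_bounded by blast
  then obtain t where t: "\<And>n. norm (f n) \<le> t" by (auto simp: bounded_iff)
  have "norm (t *\<^sub>R 1 - f n) \<le> t" for n by (rule pos_complement[OF assms(2) t])
  then have "norm (t *\<^sub>R 1 - a) \<le> t"
    by (intro Lim_norm_ubound[of sequentially "\<lambda>n. t *\<^sub>R 1 - f n"] tendsto_intros assms(1)) auto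
  moreover have "t \<ge> 0" using t[of 0] norm_ge_zero order_trans by blast
  moreover have "(\<lambda>n. star (f n)) \<longlonglongrightarrow> star a" by (rule tendsto_star[OF assms(1)])
  then have "star a = a" using assms LIMSEQ_unique by (simp add: pos_star)
  ultimately show ?thesis by (auto simp: pos_def)
qed

text \<open>With \<open>d = x - y\<close> one has \<open>d (x + y) = 0\<close>, so the positive
  elements \<open>x d^2\<close> and \<open>y d^2\<close> add up to 0 and both vanish; subtracting
  gives \<open>d^3 = 0\<close>.\<close>

lemma pos_root_unique_commuting:
  assumes "pos x" "pos y" "x * y = y * x" "x * x = y * y"
  shows "x = y"
proof -
  define d where "d = x - y"
  have sd: "star d = d" using assms by (simp add: d_def star_diff pos_star)
  have dx: "d * x = x * d" "d * y = y * d"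
    by (simp_all add: d_def left_diff_distrib right_diff_distrib assms(3))
  have sum: "d * (x + y) = 0"
    by (simp add: d_def distrib_left left_diff_distrib assms(3,4))
  have e: "pos (x * (d * d))" "pos (y * (d * d))"
    by (intro pos_mult assms pos_square sd; simp only: mult.assoc dx; simp only: dx flip: mult.assoc)+
  have "x * (d * d) + y * (d * d) = (d * (x + y)) * d"
    by (simp only: distrib_left distrib_right dx mult.assoc)
  then have 0: "x * (d * d) + y * (d * d) = 0" by (simp only: sum mult_zero_left)
  then have "y * (d * d) = - (x * (d * d))" by (simp add: eq_neg_iff_add_eq_0 add.commute)
  then have "x * (d * d) = 0" using pos_antisym e by metis
  moreover from this have "y * (d * d) = 0" using 0 by simp
  ultimately have "(x - y) * (d * d) = 0" by (simp add: left_diff_distrib)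
  then have "d * (d * d) = 0" by (simp only: d_def[symmetric])
  then have "(d * d) * (d * d) = 0" by (simp add: mult.assoc)
  then have "d * d = 0" by (rule sa_square_eq_0[rotated]) (simp only: star_mult sd)
  then have "d = 0" by (rule sa_square_eq_0[OF sd])
  then show ?thesis by (simp add: d_def)
qed

text \<open>Both are compared with a third root \<open>k\<close>, which commutes with
  \<open>x\<close> and \<open>y\<close> because these commute with their common square.\<close>

lemma pos_root_unique:
  assumes "pos x" "pos y" "x * x = y * y"
  shows "x = y"
proof -
  obtain k where k: "pos k" "k * k = x * x" "\<And>z. z * (x * x) = (x * x) * z \<Longrightarrow> z * k = k * z"
    using pos_root[OF pos_square[OF pos_star[OF assms(1)]]] by metis
  have "x * k = k * x" by (rule k(3)) (simp only: mult.assoc)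
  then have "x = k" by (rule pos_root_unique_commuting[OF assms(1) k(1)]) (simp only: k(2))
  moreover have "y * k = k * y" by (rule k(3)) (simp only: mult.assoc assms(3))
  then have "y = k" by (rule pos_root_unique_commuting[OF assms(2) k(1)]) (simp only: k(2) assms(3))
  ultimately show ?thesis by simp
qed

text \<open>Here \<open>s = \<bar>a\<bar>\<close>.  The element \<open>b = s + a\<close> has \<open>b\<^sup>2 = 2sb\<close>, so \<open>b\<^sup>3 = 2sb\<^sup>2\<close> is positive; by uniqueness of
  roots it is \<open>\<bar>b\<bar>\<^sup>3\<close>, and this forces \<open>b = \<bar>b\<bar>\<close>.\<close>

lemma pos_add_abs:
  assumes s: "pos s" and a: "star a = a" and comm: "s * a = a * s" and sq: "s * s = a * a"
  shows "pos (s + a)"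
proof -
  define b where "b = s + a"
  have sb: "star b = b" using a pos_star[OF s] by (simp add: b_def star_add)
  have bs: "s * b = b * s" by (simp add: b_def distrib_left distrib_right comm)
  have bb: "b * b = 2 *\<^sub>R (s * b)" by (simp add: b_def distrib_left distrib_right comm sq scaleR_2)
  have "pos (s * (b * b))"
    by (intro pos_mult s pos_square sb) (simp only: mult.assoc bs mult_left_commute_of[OF bs])
  moreover have "2 *\<^sub>R (s * (b * b)) = b * (b * b)"
    using arg_cong[OF bb, of "\<lambda>z. z * b"] by (simp add: mult.assoc)
  ultimately have b3: "pos (b * (b * b))" using pos_scaleR[of "s * (b * b)" 2] by simp
  obtain c where c: "pos c" "c * c = b * b" "\<And>y. y * (b * b) = (b * b) * y \<Longrightarrow> y * c = c * y"
    using pos_root[OF pos_square[OF sb]] by metis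
  have cb: "b * c = c * b" by (rule c(3)) (simp add: mult.assoc)
  have c3: "pos (c * (c * c))" by (intro pos_mult c(1) pos_square pos_star) (simp only: mult.assoc)
  have "c * (c * c) * (c * (c * c)) = (c * c) * (c * c) * (c * c)" by (simp add: mult.assoc)
  also have "\<dots> = b * (b * b) * (b * (b * b))" unfolding c(2) by (simp add: mult.assoc)
  finally have "c * (c * c) = b * (b * b)" by (rule pos_root_unique[OF c3 b3])
  then have eq: "c * (b * b) = b * (b * b)" by (simp add: c(2))
  \<comment> \<open>From \<open>d b^2 = 0\<close> and \<open>b^2 = c^2\<close>, both
    \<open>b d\<close> and \<open>c d\<close> square to 0, hence vanish, and \<open>d^2\<close> is
    their difference.\<close>
  define d where "d = c - b"
  have sd: "star d = d" using sb pos_star[OF c(1)] by (simp add: d_def star_diff)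
  have dc: "d * b = b * d" "d * c = c * d" by (simp_all add: d_def left_diff_distrib right_diff_distrib cb)
  have "d * (b * b) = 0" using eq by (simp add: d_def algebra_simps)
  then have dbb: "d * (d * (b * b)) = 0" by simp
  have "b * d * (b * d) = d * (d * (b * b))"
    by (simp only: mult.assoc dc mult_left_commute_of[OF dc(1)])
  then have "b * d * (b * d) = 0" by (simp only: dbb)
  then have "b * d = 0" by (rule sa_square_eq_0[rotated]) (simp only: star_mult sb sd dc)
  moreover have "c * d * (c * d) = d * (d * (c * c))"
    by (simp only: mult.assoc dc mult_left_commute_of[OF dc(2)])
  then have "c * d * (c * d) = 0" by (simp only: c(2) dbb)
  then have "c * d = 0"
    by (rule sa_square_eq_0[rotated]) (simp only: star_mult pos_star[OF c(1)] sd dc)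
  ultimately have "(c - b) * d = 0" by (simp add: left_diff_distrib)
  then have "d * d = 0" by (simp only: d_def[symmetric])
  then have "d = 0" by (rule sa_square_eq_0[OF sd])
  then show ?thesis using c(1) by (simp add: d_def b_def)
qed

lemma pos_parts:
  fixes a :: "'a::unital_c_star_algebra"
  assumes a: "star a = a"
  obtains p q where "pos p" "pos q" "a = p - q" "p * q = 0" "q * p = 0"
    "norm p \<le> norm a" "norm q \<le> norm a"
    "\<And>y. y * a = a * y \<Longrightarrow> y * p = p * y" "\<And>y. y * a = a * y \<Longrightarrow> y * q = q * y"
proof -
  obtain s where s: "pos s" "s * s = a * a" "\<And>y. y * (a * a) = (a * a) * y \<Longrightarrow> y * s = s * y"
    using pos_root[OF pos_square[OF a]] by metis
  have as: "a * s = s * a" by (rule s(3)) (simp add: mult.assoc)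
  define p q where "p = (1/2) *\<^sub>R (s + a)" and "q = (1/2) *\<^sub>R (s - a)"
  have "pos (s + a)" by (rule pos_add_abs) (simp_all only: s(1,2) a as)
  then have p: "pos p" by (simp add: p_def pos_scaleR del: scaleR_add_right)
  have "pos (s + (- a))" by (rule pos_add_abs) (simp_all add: s(1,2) a as star_minus)
  then have q: "pos q" by (simp add: q_def pos_scaleR del: scaleR_add_right)
  have "norm s = norm a"
    using norm_sa_square[OF a] norm_sa_square[OF pos_star[OF s(1)]] s(2) by (metis norm_ge_zero power2_eq_iff_nonneg)
  then have n: "norm p \<le> norm a" "norm q \<le> norm a"
    using norm_triangle_ineq[of s a] norm_triangle_ineq4[of s a] by (simp_all add: p_def q_def)
  have "(s + a) * (s - a) = 0" "(s - a) * (s + a) = 0"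
    by (simp_all add: distrib_left distrib_right left_diff_distrib right_diff_distrib as s(2))
  then have pq: "p * q = 0" "q * p = 0"
    by (simp_all only: p_def q_def mult_scaleR_left mult_scaleR_right scaleR_zero_right)
  have "a = p - q" by (simp add: p_def q_def algebra_simps flip: scaleR_left_distrib)
  moreover have "y * p = p * y" "y * q = q * y" if "y * a = a * y" for y
  proof -
    have "y * s = s * y" by (rule s(3)) (simp only: mult.assoc that mult_left_commute_of[OF that])
    then show "y * p = p * y" "y * q = q * y"
      by (simp_all add: p_def q_def distrib_left distrib_right left_diff_distrib right_diff_distrib that)
  qed
  ultimately show thesis using that p q n pq by blast
qed

text \<open>Whatever intertwines two elements intertwines equal polynomials in them. A common scale
  \<open>t\<close> makes both roots limits of the same polynomials, and uniqueness of positive roots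
  identifies these limits with \<open>c\<close> and \<open>d\<close>.\<close>

lemma pos_root_intertwine:
  fixes y :: "'a::unital_c_star_algebra"
  assumes "pos c" "pos d" "y * (c * c) = (d * d) * y"
  shows "y * c = d * y"
proof -
  define t where "t = max (max ((norm c)\<^sup>2) ((norm d)\<^sup>2)) 1"
  have t0: "t > 0" by (simp add: t_def)
  define w where "w e = 1 - (1/t) *\<^sub>R (e * e)" for e :: 'a
  have root: "norm (w e) \<le> 1 \<and> sqrt t *\<^sub>R root1 (w e) = e" if e: "pos e" "(norm e)\<^sup>2 \<le> t" for e
  proof -
    have "norm (t *\<^sub>R 1 - e * e) \<le> t"
      using e by (intro pos_complement pos_square pos_star) (simp_all add: norm_sa_square pos_star)
    moreover have "w e = (1/t) *\<^sub>R (t *\<^sub>R 1 - e * e)"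
      using t0 by (simp add: w_def scaleR_diff_right)
    ultimately have n: "norm (w e) \<le> 1" using t0 by simp
    have "star (w e) = w e" using e by (simp add: w_def star_diff star_scaleR star_mult pos_star)
    then have s: "star (root1 (w e)) = root1 (w e)" by (rule root1_star[OF n])
    have "pos (root1 (w e))" unfolding pos_def
      using root1_norm[OF n] s by (intro conjI exI[of _ 1]) simp_all
    then have "pos (sqrt t *\<^sub>R root1 (w e))" using t0 by (intro pos_scaleR) simp_all
    moreover have "sqrt t *\<^sub>R root1 (w e) * (sqrt t *\<^sub>R root1 (w e)) = e * e"
    proof -
      have "sqrt t *\<^sub>R root1 (w e) * (sqrt t *\<^sub>R root1 (w e)) = t *\<^sub>R (root1 (w e) * root1 (w e))"
        using t0 by simp
      also have "\<dots> = e * e" unfolding root1_square[OF n] using t0 by (simp add: w_def)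
      finally show ?thesis .
    qed
    ultimately show ?thesis using n pos_root_unique e by blast
  qed
  have c: "norm (w c) \<le> 1" "sqrt t *\<^sub>R root1 (w c) = c" using root[of c] assms by (auto simp: t_def)
  have d: "norm (w d) \<le> 1" "sqrt t *\<^sub>R root1 (w d) = d" using root[of d] assms by (auto simp: t_def)
  have "y * root1 (w c) = root1 (w d) * y"
    using assms(3) by (intro root1_intertwine c d) (simp add: w_def algebra_simps)
  then show ?thesis by (metis c(2) d(2) mult_scaleR_left mult_scaleR_right)
qed

text \<open>With \<open>x* x = p - q\<close> and \<open>y = xq\<close> one has \<open>y* y = - q\<^sup>3\<close>, while \<open>y y* = y* y + y y* + q\<^sup>3\<close> is
  positive.  Then \<open>y*\<close> intertwines \<open>y y*\<close> with \<open>- q\<^sup>3\<close>, and with \<open>q\<^sup>3\<close> after taking moduli,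
  which forces \<open>y = 0\<close>.\<close>

lemma pos_star_mult_self:
  fixes x :: "'a::unital_c_star_algebra"
  shows "pos (star x * x)"
proof -
  have "star (star x * x) = star x * x" by (simp add: star_mult star_star)
  then obtain p q where pq: "pos p" "pos q" "star x * x = p - q" "p * q = 0" "q * p = 0"
    using pos_parts by metis
  define y where "y = x * q"
  define d where "d = q * (q * q)"
  have d: "pos d" unfolding d_def
    by (intro pos_mult pq(1,2) pos_square pos_star) (simp only: mult.assoc)
  have yy: "star y * y = - d"
  proof -
    have "star y * y = q * (star x * x) * q"
      using pos_star[OF pq(2)] by (simp add: y_def star_mult mult.assoc)
    also have "\<dots> = - d" unfolding pq(3)
      by (simp add: d_def left_diff_distrib right_diff_distrib pq(4,5) mult.assoc)
    finally show ?thesis .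
  qed
  obtain u v where uv: "star u = u" "star v = v" "y = u + \<i> *\<^sub>C v"
    using sa_decomposition by metis
  have "star y * y + y * star y = 2 *\<^sub>R (u * u + v * v)"
    using uv by (simp add: star_add star_scaleC algebra_simps mult_scaleC_left mult_scaleC_right
        scaleC_scaleC scaleC_minus_left scaleC_add_right scaleC_diff_right scaleR_2)
  then have c: "y * star y = 2 *\<^sub>R (u * u + v * v) + d" using yy by (simp add: algebra_simps)
  have "pos (2 *\<^sub>R (u * u + v * v) + d)"
    by (intro pos_add pos_scaleR pos_square uv d) simp
  then have c: "pos (y * star y)" using c by simp
  have yc: "star y * (y * star y) = - d * star y" using yy by (simp flip: mult.assoc)
  then have "star y * (y * star y * (y * star y)) = d * d * star y"
    by (metis minus_mult_minus mult.assoc)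
  then have "star y * (y * star y) = d * star y" by (rule pos_root_intertwine[OF c d])
  then have "2 *\<^sub>R (star y * (y * star y)) = - d * star y + d * star y"
    unfolding scaleR_2 using yc by (intro arg_cong2[where f=plus])
  then have "star y * (y * star y) = 0" by simp
  then have "star (y * star y) * (y * star y) = 0"
    by (simp add: star_mult star_star mult.assoc)
  then have "star (star y) * star y = 0" by (simp add: star_star)
  then have "y = 0" by (metis star_mult_self_eq_0_iff star_star star_zero)
  then have "d = 0" using yy by simp
  then have "q * q * (q * q) = 0" by (simp add: d_def mult.assoc)
  then have "q = 0" using pos_star[OF pq(2)] sa_square_eq_0 by (metis star_mult)
  then show ?thesis using pq by simp
qed

lemma pos_conj: assumes "pos a" shows "pos (star x * a * x)"
proof -
  obtain k where k: "pos k" "k * k = a" using pos_root[OF assms] by metis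
  have "star x * a * x = star (k * x) * (k * x)"
    by (simp only: star_mult mult.assoc pos_star[OF k(1)] flip: k(2))
  then show ?thesis using pos_star_mult_self by metis
qed


section \<open>Positive elements without a unit\<close>

text \<open>A root found in the unitization lies in the algebra itself: \<open>scal\<close> is
  multiplicative, so \<open>scal k\<close> squares to 0.\<close>

lemma positive_iff_pos_incl: "positive a \<longleftrightarrow> pos (incl a)"
proof
  assume "positive a"
  then obtain x where "a = star x * x" by (auto simp: positive_def)
  then have "incl a = star (incl x) * incl x" by (simp add: incl_algebra)
  then show "pos (incl a)" by (simp only: pos_star_mult_self)
next
  assume "pos (incl a)"
  then obtain k where k: "pos k" "k * k = incl a" using pos_root by metis
  from arg_cong[OF k(2), of scal] have "scal k = 0" by simp
  then obtain r where r: "k = incl r" by (metis elem_incl_iff)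
  have "star r = r" using pos_star[OF k(1)] by (simp add: r)
  moreover have "r * r = a" using k(2) by (simp add: r flip: incl_algebra)
  ultimately show "positive a" unfolding positive_def by metis
qed

lemma positive_star: "positive a \<Longrightarrow> star a = a"
  by (auto simp: positive_def star_mult star_star)

lemma positive_star_mult_self [simp]: "positive (star x * x)"
  by (auto simp: positive_def)

lemma positive_0 [simp]: "positive 0"
  using positive_star_mult_self[of 0] by simp

lemma positive_add: "positive a \<Longrightarrow> positive b \<Longrightarrow> positive (a + b)"
  by (simp add: positive_iff_pos_incl incl_algebra pos_add)

lemma positive_scaleR: "positive a \<Longrightarrow> r \<ge> 0 \<Longrightarrow> positive (r *\<^sub>R a)"
  by (simp add: positive_iff_pos_incl incl_algebra pos_scaleR)

lemma positive_sum: "(\<And>i. i \<in> I \<Longrightarrow> positive (f i)) \<Longrightarrow> positive (sum f I)"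
  by (induction I rule: infinite_finite_induct) (auto intro: positive_add)

lemma positive_limit:
  assumes "f \<longlonglongrightarrow> a" "\<And>n. positive (f n)"
  shows "positive a"
  using pos_limit[OF bounded_linear.tendsto[OF bounded_linear_incl assms(1)]] assms(2)
  by (simp add: positive_iff_pos_incl)

lemma positive_norm_mono: "positive a \<Longrightarrow> positive (b - a) \<Longrightarrow> norm a \<le> norm b"
  using pos_norm_mono[of "incl a" "incl b"] by (simp add: positive_iff_pos_incl incl_algebra)

lemma norm_power2_le_norm_add: "(norm x)\<^sup>2 \<le> norm (star x * x + star y * y)"
  using positive_norm_mono[of "star x * x" "star x * x + star y * y"]
  by (simp add: norm_star_mult_self)

text \<open>Meant for \<open>p = \<phi> u\<close> and \<open>t\<close> the norm of
  \<open>\<phi>\<close>: in the limit it makes \<open>1 - h / t\<close> a contraction, the input for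
  the root of \<open>h\<close>.\<close>

lemma norm_scaleR_diff_mult_le:
  assumes "positive p" "norm p \<le> t"
  shows "norm (t *\<^sub>R x - p * x) \<le> t * norm x"
proof -
  have le: "norm (t *\<^sub>R 1 - incl p) \<le> t"
    using assms by (intro pos_complement) (simp_all add: positive_iff_pos_incl)
  have "incl (t *\<^sub>R x - p * x) = (t *\<^sub>R 1 - incl p) * incl x"
    by (simp add: incl_algebra left_diff_distrib)
  then have "norm (t *\<^sub>R x - p * x) \<le> norm (t *\<^sub>R 1 - incl p) * norm x"
    using norm_mult_ineq[of "t *\<^sub>R 1 - incl p" "incl x"] by (metis norm_incl)
  also have "\<dots> \<le> t * norm x" by (intro mult_right_mono le norm_ge_zero)
  finally show ?thesis .
qed

lemma sa_eq_diff_positive: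
  assumes a: "star a = (a::'a::c_star_algebra)"
  obtains p q where "positive p" "positive q" "a = p - q" "norm p \<le> norm a" "norm q \<le> norm a"
proof -
  have "star (incl a) = incl a" by (simp add: a)
  then obtain p q where pq: "pos p" "pos q" "incl a = p - q" "p * q = 0"
    "norm p \<le> norm (incl a)" "norm q \<le> norm (incl a)"
    using pos_parts by metis
  \<comment> \<open>Scalar parts with difference 0 and product 0 vanish, so \<open>p\<close> and
    \<open>q\<close> come from the algebra.\<close>
  have "scal p - scal q = 0" using arg_cong[OF pq(3), of scal] by simp
  moreover have "scal p * scal q = 0" using arg_cong[OF pq(4), of scal] by simp
  ultimately have "scal p = 0" "scal q = 0" by auto
  then obtain p' q' where p': "p = incl p'" "q = incl q'" by (metis elem_incl_iff)
  show thesis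
    by (rule that[of p' q']) (use pq in \<open>simp_all add: p' positive_iff_pos_incl flip: incl_algebra\<close>)
qed

section \<open>Approximate units\<close>

lemma pos_1 [simp]: "pos 1"
  using pos_square[of 1] by simp

lemma pos_power: assumes "pos g" shows "pos (g ^ n)"
proof (induction n)
  case (Suc n)
  show ?case unfolding power_Suc by (rule pos_mult[OF assms Suc]) (simp only: power_commutes)
qed simp

text \<open>With \<open>g = 1 - p\<close>, the element \<open>1 - g ^ (n + 1)\<close> is
  \<open>p\<close> times the sum of the \<open>g ^ k\<close> for \<open>k \<le> n\<close>, each at
  least \<open>g ^ n\<close>. In the induction the gap grows by the positive term
  \<open>(n + 1) p^2 g ^ n\<close>.\<close>

lemma norm_mult_power_complement:
  fixes p :: "'a::unital_c_star_algebra"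
  assumes p: "pos p" "norm p \<le> 1"
  shows "(real n + 1) * norm (p * (1 - p) ^ n) \<le> 1"
proof -
  define g where "g = 1 - p"
  have g: "pos g" using pos_complement[OF p] by (simp add: g_def)
  have pg: "p * g = g * p" by (simp add: g_def algebra_simps)
  have pgn: "p * g ^ n = g ^ n * p" for n using power_commuting_commutes[OF pg[symmetric]] by simp
  have pos1: "pos (p * g ^ n)" for n by (intro pos_mult p pos_power g pgn)
  have "pos (1 - g ^ Suc n - (real n + 1) *\<^sub>R (p * g ^ n))"
  proof (induction n)
    case 0
    then show ?case by (simp add: g_def)
  next
    case (Suc n)
    have p_eq: "p = 1 - g" by (simp add: g_def)
    have ppg: "p * (p * g ^ n) = p * g ^ n - p * g ^ Suc n"
      using pgn[of n] by (simp add: p_eq left_diff_distrib right_diff_distrib)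
    have "g ^ Suc n - g ^ Suc (Suc n) = p * g ^ Suc n"
      by (simp add: p_eq left_diff_distrib)
    then have g2: "g ^ Suc (Suc n) = g ^ Suc n - p * g ^ Suc n" by (simp only: diff_eq_eq eq_diff_eq add.commute)
    have "1 - (a - y) - (real (Suc n) + 1) *\<^sub>R y = (1 - a - (real n + 1) *\<^sub>R z) + (real n + 1) *\<^sub>R (z - y)" for a y z :: 'a
      by (simp add: scaleR_left_distrib scaleR_diff_right scaleR_2)
    then have eq: "1 - g ^ Suc (Suc n) - (real (Suc n) + 1) *\<^sub>R (p * g ^ Suc n)
        = (1 - g ^ Suc n - (real n + 1) *\<^sub>R (p * g ^ n)) + (real n + 1) *\<^sub>R (p * (p * g ^ n))"
      by (simp only: g2 ppg)
    have "pos (p * (p * g ^ n))"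
      by (rule pos_mult[OF p(1) pos1]) (simp only: pgn[symmetric] mult.assoc)
    then have "pos ((real n + 1) *\<^sub>R (p * (p * g ^ n)))" by (rule pos_scaleR) simp
    then show ?case unfolding eq by (rule pos_add[OF Suc])
  qed
  then have "pos (1 - g ^ Suc n - (real n + 1) *\<^sub>R (p * g ^ n) + g ^ Suc n)"
    by (rule pos_add) (rule pos_power[OF g])
  moreover have "1 - a - z + a = 1 *\<^sub>R 1 - z" for a z :: 'a by simp
  ultimately have "pos (1 *\<^sub>R 1 - (real n + 1) *\<^sub>R (p * g ^ n))" by (simp only:)
  then have "norm ((real n + 1) *\<^sub>R (p * g ^ n)) \<le> 1"
    by (rule pos_norm_le[OF pos_scaleR[OF pos1], rotated]) simp_all
  then show ?thesis by (simp only: norm_scaleR g_def)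
qed

text \<open>Take \<open>u = 1 - g ^ n\<close> with \<open>g = 1 - p\<close> and \<open>p\<close> the
  normalised sum of all \<open>a * star a\<close>. Each summand lies below the sum, so
  \<open>\<parallel>g ^ n a\<parallel>^2 = \<parallel>g ^ n a (star a) g ^ n\<parallel> \<le> s
  \<parallel>p g ^ (2 n)\<parallel> \<le> s / (2 n + 1)\<close> for all \<open>a\<close> at
  once.\<close>

lemma approximate_unit:
  fixes F :: "'a::c_star_algebra set"
  assumes "finite F" "\<epsilon> > 0"
  obtains u where "positive u" "norm u \<le> 1" "\<And>a. a \<in> F \<Longrightarrow> norm (u * a - a) < \<epsilon>"
proof -
  define P where "P = (\<Sum>a\<in>F. incl (a * star a))"
  define s where "s = norm P + 1"
  define p where "p = (1/s) *\<^sub>R P"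
  define g where "g = 1 - p"
  have s: "s > 0" by (simp add: s_def add_nonneg_pos)
  have aa: "pos (incl (a * star a))" for a :: 'a
    using pos_star_mult_self[of "star (incl a)"] by (simp add: star_star incl_algebra)
  have p: "pos p" unfolding p_def P_def using s by (intro pos_scaleR pos_sum aa) simp
  have pn: "norm p \<le> 1" using s by (simp add: p_def s_def)
  have g: "pos g" "norm g \<le> 1" using pos_complement[OF p pn] by (simp_all add: g_def)
  have gn: "pos (g ^ n)" "norm (g ^ n) \<le> 1" for n
    using pos_power[OF g(1)] norm_power_ineq[of g n] power_le_one[of "norm g" n] g(2) by auto
  obtain n where n: "s / \<epsilon>\<^sup>2 < real n" using reals_Archimedean2 by blast
  define u where "u = 1 - g ^ n"
  have u: "pos u" "norm u \<le> 1" using pos_complement[OF gn] by (simp_all add: u_def)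
  \<comment> \<open>\<open>g\<close> has scalar part 1, so \<open>1 - g ^ n\<close> has scalar part
    0 and comes from the algebra.\<close>
  have "scal P = 0" unfolding P_def by (induction F rule: infinite_finite_induct) simp_all
  then have "scal g = 1" by (simp add: g_def p_def)
  then have "scal (g ^ n) = 1" by (induction n) simp_all
  then have "scal u = 0" by (simp add: u_def)
  then obtain v where v: "u = incl v" by (metis elem_incl_iff)
  show thesis
  proof (rule that)
    show "positive v" "norm v \<le> 1" using u by (simp_all add: v positive_iff_pos_incl)
    fix a assume a: "a \<in> F"
    define x where "x = g ^ n * incl a"
    have "incl (v * a - a) = - x" by (simp add: incl_algebra x_def left_diff_distrib u_def flip: v)
    then have nx: "norm (v * a - a) = norm x" by (metis norm_incl norm_minus_cancel)
    have sg: "star (g ^ n) = g ^ n" by (rule pos_star[OF gn(1)])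
    have "P - incl (a * star a) = (\<Sum>b\<in>F - {a}. incl (b * star b))"
      using a assms(1) by (simp add: P_def sum.remove)
    then have "pos (P - incl (a * star a))" using pos_sum aa by metis
    from pos_conj[OF this, of "g ^ n"]
    have "pos (g ^ n * P * g ^ n - g ^ n * incl (a * star a) * g ^ n)"
      by (simp add: sg left_diff_distrib right_diff_distrib)
    moreover have "pos (g ^ n * incl (a * star a) * g ^ n)"
      using pos_conj[OF aa, of "g ^ n"] by (simp add: sg)
    ultimately have "norm (g ^ n * incl (a * star a) * g ^ n) \<le> norm (g ^ n * P * g ^ n)"
      by (intro pos_norm_mono)
    moreover have "g ^ n * incl (a * star a) * g ^ n = x * star x"
      by (simp add: x_def star_mult sg incl_algebra mult.assoc)
    moreover have "g ^ n * P * g ^ n = s *\<^sub>R (p * g ^ (2 * n))"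
    proof -
      have "p * g = g * p" by (simp add: g_def algebra_simps)
      then have "g ^ n * p = p * g ^ n" using power_commuting_commutes[of g p n] by simp
      then have "g ^ n * p * g ^ n = p * g ^ (2 * n)" by (simp add: mult.assoc mult_2 power_add)
      moreover have "P = s *\<^sub>R p" using s by (simp add: p_def)
      ultimately show ?thesis by simp
    qed
    ultimately have "(norm x)\<^sup>2 \<le> s * norm (p * g ^ (2 * n))"
      using s by (simp add: norm_mult_star_self)
    moreover have "(real (2 * n) + 1) * norm (p * g ^ (2 * n)) \<le> 1"
      unfolding g_def by (rule norm_mult_power_complement[OF p pn])
    then have "norm (p * g ^ (2 * n)) \<le> 1 / (real (2 * n) + 1)"
      by (simp add: pos_le_divide_eq mult.commute)
    then have "s * norm (p * g ^ (2 * n)) \<le> s * (1 / (real (2 * n) + 1))"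
      using s by (intro mult_left_mono) simp_all
    moreover have "s * (1 / (real (2 * n) + 1)) < \<epsilon>\<^sup>2"
    proof -
      have "s < \<epsilon>\<^sup>2 * real n" using n assms(2) by (simp add: pos_divide_less_eq mult.commute)
      also have "\<dots> \<le> \<epsilon>\<^sup>2 * (real (2 * n) + 1)" by (intro mult_left_mono) simp_all
      finally show ?thesis by (simp add: pos_divide_less_eq)
    qed
    ultimately have "(norm x)\<^sup>2 < \<epsilon>\<^sup>2" by linarith
    then show "norm (v * a - a) < \<epsilon>" using assms(2) by (simp add: nx power2_less_imp_less)
  qed
qed

section \<open>Spectral partitions\<close>

text \<open>\<open>G j\<close> is the clamp of \<open>x\<close> to the \<open>j\<close>-th of \<open>N\<close> intervals that subdivide \<open>[-M, M]\<close>, rescaled to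
  \<open>[0, 1]\<close>.  With \<open>c t\<close> and \<open>d t\<close> the positive and negative parts of \<open>x - t\<close>, all order relations
  between clamps reduce to \<open>c t d s = 0\<close> for \<open>s \<le> t\<close>.\<close>

lemma spectral_clamps:
  fixes x :: "'a::unital_c_star_algebra"
  assumes sx: "star x = x" and xM: "norm x \<le> M" and M: "M > 0" and N: "N > 0"
  obtains G :: "nat \<Rightarrow> 'a" where
    "G 0 = 1" "G (Suc N) = 0" "\<And>j. pos (G j)" "\<And>j. pos (1 - G j)"
    "\<And>j k. j < k \<Longrightarrow> G k * G j = G k" "\<And>j k. j < k \<Longrightarrow> G j * G k = G k"
    "x + M *\<^sub>R 1 = (2 * M / real N) *\<^sub>R (\<Sum>j=1..N. G j)"
proof -
  have "\<exists>p q. pos p \<and> pos q \<and> x - t *\<^sub>R 1 = p - q \<and> p * q = 0 \<and> q * p = 0 \<and>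
      (\<forall>y. y * x = x * y \<longrightarrow> y * p = p * y \<and> y * q = q * y)" for t :: real
  proof -
    have "star (x - t *\<^sub>R 1) = x - t *\<^sub>R 1" by (simp add: star_diff star_scaleR sx)
    then obtain p q where "pos p" "pos q" "x - t *\<^sub>R 1 = p - q" "p * q = 0" "q * p = 0"
      and *: "\<And>y. y * (x - t *\<^sub>R 1) = (x - t *\<^sub>R 1) * y \<Longrightarrow> y * p = p * y"
        "\<And>y. y * (x - t *\<^sub>R 1) = (x - t *\<^sub>R 1) * y \<Longrightarrow> y * q = q * y"
      using pos_parts by metis
    moreover have "y * p = p * y \<and> y * q = q * y" if "y * x = x * y" for y
      using *[of y] that by (simp add: left_diff_distrib right_diff_distrib)
    ultimately show ?thesis by blast
  qed
  then obtain c d where cd: "\<And>t. pos (c t)" "\<And>t. pos (d t)" "\<And>t. x - t *\<^sub>R 1 = c t - d t"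
    "\<And>t. c t * d t = 0" "\<And>t. d t * c t = 0"
    and comm: "\<And>t y. y * x = x * y \<Longrightarrow> y * c t = c t * y" "\<And>t y. y * x = x * y \<Longrightarrow> y * d t = d t * y"
    by metis
  have xc: "c t * x = x * c t" "d t * x = x * d t" for t
    using comm[of x t] by simp_all
  have cc: "c s * c t = c t * c s" "c s * d t = d t * c s" "d s * d t = d t * d s" for s t
    using comm[OF xc(1)] comm(2)[OF xc(2)] by auto
  have cd0: "c t * d s = 0" if "s \<le> t" for s t
  proof (cases "s = t")
    case False
    then have st: "s < t" using that by simp
    let ?e = "c t * d s"
    \<comment> \<open>Multiplying \<open>t - s\<close> by \<open>c t\<close> and \<open>d s\<close>
      leaves two terms, both with a minus sign. So \<open>c t * d s\<close>, positive as a product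
      of commuting positives, is also negative.\<close>
    have "(t - s) *\<^sub>R 1 = (x - s *\<^sub>R 1) - (x - t *\<^sub>R 1)" by (simp add: scaleR_left_diff_distrib)
    also have "\<dots> = (c s - d s) - (c t - d t)" by (simp only: cd(3))
    finally have "(t - s) *\<^sub>R ?e = c t * ((c s - d s) - (c t - d t)) * d s"
      by (metis mult_scaleR_left mult_scaleR_right mult.right_neutral)
    also have "\<dots> = - (c t * (d s * d s) + c t * c t * d s)"
    proof -
      have "c t * c s * d s = 0" by (simp add: mult.assoc cd)
      moreover have "c t * d t * d s = 0" by (simp add: cd)
      ultimately show ?thesis by (simp add: left_diff_distrib right_diff_distrib mult.assoc)
    qed
    finally have eq: "- ((t - s) *\<^sub>R ?e) = c t * (d s * d s) + c t * c t * d s" by simp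
    have "pos (c t * (d s * d s))"
      by (intro pos_mult cd pos_square pos_star) (simp only: mult.assoc cc(2) mult_left_commute_of[OF cc(2)])
    moreover have "pos (c t * c t * d s)"
      by (intro pos_mult cd pos_square pos_star) (simp only: mult.assoc cc(2) mult_left_commute_of[OF cc(2)])
    ultimately have "pos (- ((t - s) *\<^sub>R ?e))" unfolding eq by (rule pos_add)
    moreover have "pos ((t - s) *\<^sub>R ?e)" using st by (intro pos_scaleR pos_mult cd cc(2)) simp
    ultimately have "(t - s) *\<^sub>R ?e = 0" by (rule pos_antisym[rotated])
    then show ?thesis using st by simp
  qed (simp add: cd)
  have dc0: "d s * c t = 0" if "s \<le> t" for s t using cd0[OF that] cc(2)[of t s] by simp
  have cM: "c M = 0"
  proof -
    have "pos (M *\<^sub>R 1 - x)" unfolding pos_def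
      using M xM by (intro conjI exI[of _ M]) (simp_all add: star_diff star_scaleR sx)
    then have "pos (c M * (M *\<^sub>R 1 - x))"
      by (intro pos_mult cd) (simp_all add: left_diff_distrib right_diff_distrib xc)
    moreover have "c M * (M *\<^sub>R 1 - x) = - (c M * c M)"
    proof -
      have "M *\<^sub>R 1 - x = - (c M - d M)" by (simp flip: cd(3))
      then show ?thesis by (simp add: right_diff_distrib cd)
    qed
    ultimately have "c M * c M = 0" using pos_antisym pos_square pos_star cd(1) by metis
    then show ?thesis by (rule sa_square_eq_0[OF pos_star[OF cd(1)]])
  qed
  have dM: "d (- M) = 0"
  proof -
    have "pos (x + M *\<^sub>R 1)" unfolding pos_def
      using M xM by (intro conjI exI[of _ M]) (simp_all add: star_add star_scaleR sx)
    then have "pos (d (- M) * (x + M *\<^sub>R 1))"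
      by (intro pos_mult cd) (simp_all add: distrib_left distrib_right xc)
    moreover have "d (- M) * (x + M *\<^sub>R 1) = - (d (- M) * d (- M))"
    proof -
      have "x + M *\<^sub>R 1 = c (- M) - d (- M)" by (simp flip: cd(3))
      then show ?thesis by (simp add: right_diff_distrib cd)
    qed
    ultimately have "d (- M) * d (- M) = 0" using pos_antisym pos_square pos_star cd(2) by metis
    then show ?thesis by (rule sa_square_eq_0[OF pos_star[OF cd(2)]])
  qed
  define \<delta> where "\<delta> = 2 * M / real N"
  have \<delta>: "\<delta> > 0" using M N by (simp add: \<delta>_def)
  define t where "t j = - M + real j * \<delta>" for j
  have tle: "t i \<le> t j" if "i \<le> j" for i j using that \<delta> by (simp add: t_def)
  have tN: "t N = M" using N by (simp add: t_def \<delta>_def)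
  \<comment> \<open>\<open>f j\<close> is the clamp of \<open>x\<close> to
    \<open>[t j, t (Suc j)]\<close> minus \<open>t j\<close>; its complement in
    \<open>\<delta>\<close> is a difference of negative parts.\<close>
  define f where "f j = c (t j) - c (t (Suc j))" for j
  have f': "\<delta> *\<^sub>R 1 - f j = d (t (Suc j)) - d (t j)" for j
  proof -
    have "\<delta> *\<^sub>R 1 = (x - t j *\<^sub>R 1) - (x - t (Suc j) *\<^sub>R 1)"
      by (simp add: t_def algebra_simps flip: scaleR_left_distrib)
    then show ?thesis by (simp add: cd(3) f_def)
  qed
  have fc: "f j * (\<delta> *\<^sub>R 1 - f j) = c (t j) * d (t (Suc j))" for j
    unfolding f' unfolding f_def by (simp add: left_diff_distrib right_diff_distrib cd0 tle)
  have sf: "star (f j) = f j" for j by (simp add: f_def star_diff pos_star cd)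
  have pfc: "pos (f j * (\<delta> *\<^sub>R 1 - f j))" for j unfolding fc by (intro pos_mult cd cc)
  \<comment> \<open>\<open>f (\<delta> - f)\<close> is positive as a product of a \<open>c\<close>
    and a \<open>d\<close>; adding \<open>f^2\<close> leaves \<open>\<delta> f\<close>.\<close>
  have pf: "pos (f j)" for j
  proof -
    have "pos (f j * (\<delta> *\<^sub>R 1 - f j) + f j * f j)" by (intro pos_add pfc pos_square sf)
    then have "pos (\<delta> *\<^sub>R f j)" by (simp add: right_diff_distrib)
    from pos_scaleR[OF this, of "1 / \<delta>"] show ?thesis using \<delta> by simp
  qed
  have pf': "pos (\<delta> *\<^sub>R 1 - f j)" for j
  proof -
    have "pos (f j * (\<delta> *\<^sub>R 1 - f j) + (\<delta> *\<^sub>R 1 - f j) * (\<delta> *\<^sub>R 1 - f j))"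
      by (intro pos_add pfc pos_square) (simp add: star_diff star_scaleR sf)
    moreover have "f j * (\<delta> *\<^sub>R 1 - f j) + (\<delta> *\<^sub>R 1 - f j) * (\<delta> *\<^sub>R 1 - f j) = \<delta> *\<^sub>R (\<delta> *\<^sub>R 1 - f j)"
      by (simp add: left_diff_distrib right_diff_distrib scaleR_diff_right)
    ultimately show ?thesis using \<delta> pos_scaleR[of "\<delta> *\<^sub>R (\<delta> *\<^sub>R 1 - f j)" "1 / \<delta>"] by simp
  qed
  have ff: "f k * (\<delta> *\<^sub>R 1 - f j) = 0" "(\<delta> *\<^sub>R 1 - f j) * f k = 0" if "j < k" for j k
    unfolding f' unfolding f_def using that by (simp_all add: left_diff_distrib right_diff_distrib cd0 dc0 tle)
  \<comment> \<open>The shift by one makes room for \<open>G 0 = 1\<close>. With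
    \<open>G (Suc N) = 0\<close> the \<open>N + 1\<close> differences of consecutive values sum to
    1.\<close>
  define G where "G j = (if j = 0 then 1 else if j \<le> N then (1 / \<delta>) *\<^sub>R f (j - 1) else 0)" for j
  have G1: "1 - (1 / \<delta>) *\<^sub>R f j = (1 / \<delta>) *\<^sub>R (\<delta> *\<^sub>R 1 - f j)" for j using \<delta> by (simp add: scaleR_diff_right)
  show thesis
  proof (rule that[of G])
    show "G 0 = 1" "G (Suc N) = 0" by (simp_all add: G_def)
    show "pos (G j)" for j using \<delta> by (auto simp: G_def intro: pos_scaleR pf)
    show "pos (1 - G j)" for j using \<delta> by (auto simp: G_def G1 simp del: scaleR_diff_right intro!: pos_scaleR pf')
    have "G k * (1 - G j) = 0 \<and> (1 - G j) * G k = 0" if "j < k" for j k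
    proof (cases "j = 0 \<or> k > N")
      case True
      then show ?thesis using that by (auto simp: G_def)
    next
      case False
      then have "G k = (1 / \<delta>) *\<^sub>R f (k - 1)" "1 - G j = (1 / \<delta>) *\<^sub>R (\<delta> *\<^sub>R 1 - f (j - 1))"
        using that by (simp_all add: G_def G1 del: scaleR_diff_right)
      moreover have "j - 1 < k - 1" using that False by arith
      ultimately show ?thesis
        using ff by (simp only: mult_scaleR_left mult_scaleR_right scaleR_zero_right)
    qed
    then show "G k * G j = G k" "G j * G k = G k" if "j < k" for j k
      using that by (simp_all add: left_diff_distrib right_diff_distrib)
    have "(\<Sum>j=1..N. G j) = (\<Sum>j<N. (1 / \<delta>) *\<^sub>R f j)"
      by (rule sum.reindex_bij_witness[of _ Suc "\<lambda>j. j - 1"]) (auto simp: G_def)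
    also have "\<dots> = (1 / \<delta>) *\<^sub>R (\<Sum>j<N. c (t j) - c (t (Suc j)))" by (simp add: scaleR_sum_right f_def)
    also have "(\<Sum>j<N. c (t j) - c (t (Suc j))) = c (t 0) - c (t N)"
      by (rule sum_lessThan_telescope')
    also have "\<dots> = x + M *\<^sub>R 1"
      using cd(3)[of "- M"] by (simp add: tN cM dM) (simp add: t_def)
    finally show "x + M *\<^sub>R 1 = (2 * M / real N) *\<^sub>R (\<Sum>j=1..N. G j)" using \<delta> by (simp flip: \<delta>_def)
  qed
qed


text \<open>Write \<open>x\<close> as a combination of a partition of unity \<open>e\<^sub>0, \<dots>, e\<^sub>N\<close> with \<open>e\<^sub>i e\<^sub>k = 0\<close> for
  \<open>\<bar>i - k\<bar> \<ge> 2\<close>.  Then \<open>W x 1 - W 1 x\<close> is \<open>2M/N\<close> times a sum of terms \<open>W e\<^sub>j e\<^sub>j\<^sub>-\<^sub>1\<close> and \<open>W e\<^sub>j\<^sub>-\<^sub>1 e\<^sub>j\<close>,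
  and over one residue class of \<open>j\<close> modulo \<open>3\<close> such a sum is a single value of \<open>W\<close> on elements of norm
  at most \<open>1\<close>.\<close>

lemma zero_product_bilinear_sa:
  fixes W :: "'a::unital_c_star_algebra \<Rightarrow> 'a \<Rightarrow> 'b::real_normed_vector"
  assumes W: "bounded_bilinear W" and zero: "\<And>f g. f * g = 0 \<Longrightarrow> W f g = 0" and sx: "star x = x"
  shows "W x 1 = W 1 x"
proof -
  interpret bounded_bilinear W by (rule W)
  obtain K where K: "K \<ge> 0" "\<And>a b. norm (W a b) \<le> norm a * norm b * K"
    using nonneg_bounded by blast
  define M where "M = norm x + 1"
  have M: "M > 0" "norm x \<le> M" by (simp_all add: M_def add_nonneg_pos)
  \<comment> \<open>The constant is \<open>2 M / N\<close> times two sums, each bounded by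
    \<open>3 K\<close>: one \<open>K\<close> per residue class.\<close>
  have bound: "norm (W x 1 - W 1 x) \<le> 12 * M * K / real N" if N: "N > 0" for N
  proof -
    obtain G :: "nat \<Rightarrow> 'a" where G: "G 0 = 1" "G (Suc N) = 0" "\<And>j. pos (G j)" "\<And>j. pos (1 - G j)"
      "\<And>j k. j < k \<Longrightarrow> G k * G j = G k" "\<And>j k. j < k \<Longrightarrow> G j * G k = G k"
      "x + M *\<^sub>R 1 = (2 * M / real N) *\<^sub>R (\<Sum>j=1..N. G j)"
      by (rule spectral_clamps[OF sx M(2,1) N]) (rule that; assumption)
    define e where "e j = G j - G (Suc j)" for j
    have ee: "e i * e k = 0" if "i + 2 \<le> k \<or> k + 2 \<le> i" for i k
      using that by (auto simp: e_def left_diff_distrib right_diff_distrib G(5,6))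
    have "pos (G j * (1 - G (Suc j)))" for j
      by (intro pos_mult G) (simp add: left_diff_distrib right_diff_distrib G(5,6))
    then have pe: "pos (e j)" for j by (simp add: e_def right_diff_distrib G(6))
    have sum_e: "(\<Sum>j<Suc N. e j) = 1"
      unfolding e_def by (subst sum_lessThan_telescope') (simp add: G)
    have norm_e: "norm (\<Sum>j\<in>S. e (\<alpha> j)) \<le> 1" if "inj_on \<alpha> S" "\<alpha> ` S \<subseteq> {..<Suc N}" for \<alpha> :: "nat \<Rightarrow> nat" and S
    proof -
      have "(\<Sum>j\<in>S. e (\<alpha> j)) = sum e (\<alpha> ` S)" using that by (simp add: sum.reindex)
      moreover have "1 - sum e (\<alpha> ` S) = sum e ({..<Suc N} - \<alpha> ` S)"
        using sum_diff[OF _ that(2), of e] by (simp only: sum_e finite_lessThan)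
      moreover have "norm (sum e (\<alpha> ` S)) \<le> 1"
        by (rule pos_norm_le) (simp_all add: pos_sum pe calculation(2))
      ultimately show ?thesis by simp
    qed
    \<comment> \<open>\<open>G (Suc i)\<close> and \<open>1 - G i\<close> annihilate each other, so
      1 may be replaced by \<open>G i\<close>; the common term
      \<open>W (G (Suc i)) (G (Suc i))\<close> then cancels.\<close>
    have step: "W (G (Suc i)) 1 - W 1 (G (Suc i)) = W (e (Suc i)) (e i) - W (e i) (e (Suc i))" for i
    proof -
      let ?j = "Suc i"
      have "W (G ?j) (1 - G i) = 0" "W (1 - G i) (G ?j) = 0"
        by (rule zero; simp add: left_diff_distrib right_diff_distrib G(5,6))+
      then have 1: "W (G ?j) 1 = W (G ?j) (G i)" "W 1 (G ?j) = W (G i) (G ?j)"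
        by (simp_all add: diff_left diff_right)
      have 2: "W (G (Suc ?j)) (e i) = 0" "W (e i) (G (Suc ?j)) = 0"
        by (rule zero; simp add: e_def left_diff_distrib right_diff_distrib G(5,6))+
      have Gi: "G i = e i + G ?j" and Gj: "G ?j = e ?j + G (Suc ?j)" by (simp_all add: e_def)
      have "W (G ?j) (G i) = W (G ?j) (e i) + W (G ?j) (G ?j)" by (subst Gi) (rule add_right)
      moreover have "W (G i) (G ?j) = W (e i) (G ?j) + W (G ?j) (G ?j)" by (subst Gi) (rule add_left)
      moreover have "W (G ?j) (e i) = W (e ?j) (e i)" by (subst Gj) (simp add: add_left 2)
      moreover have "W (e i) (G ?j) = W (e i) (e ?j)" by (subst Gj) (simp add: add_right 2)
      ultimately show ?thesis by (simp add: 1)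
    qed
    have group: "norm (\<Sum>j<N. W (e (\<alpha> j)) (e (\<beta> j))) \<le> 3 * K"
      if \<alpha>: "\<alpha> = Suc \<and> \<beta> = id \<or> \<alpha> = id \<and> \<beta> = Suc" for \<alpha> \<beta> :: "nat \<Rightarrow> nat"
    proof -
      \<comment> \<open>One of the two indices is shifted by 1, so a gap of 3 within a class still
        leaves the gap of 2 that \<open>ee\<close> asks for.\<close>
      define S where "S r = {j \<in> {..<N}. j mod 3 = r}" for r :: nat
      have Sr: "norm (\<Sum>j\<in>S r. W (e (\<alpha> j)) (e (\<beta> j))) \<le> K" for r
      proof -
        have off: "W (e (\<alpha> i)) (e (\<beta> j)) = 0" if "i \<in> S r" "j \<in> S r" "i \<noteq> j" for i j
        proof -
          have "i mod 3 = j mod 3" using that by (simp add: S_def)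
          then have "i + 3 \<le> j \<or> j + 3 \<le> i" using that(3) by presburger
          then show ?thesis using \<alpha> by (intro zero ee) auto
        qed
        have fin: "finite (S r)" by (simp add: S_def)
        have "W (\<Sum>i\<in>S r. e (\<alpha> i)) (\<Sum>j\<in>S r. e (\<beta> j)) = (\<Sum>i\<in>S r. \<Sum>j\<in>S r. W (e (\<alpha> i)) (e (\<beta> j)))"
          by (simp only: sum_left) (simp only: sum_right)
        also have "\<dots> = (\<Sum>i\<in>S r. W (e (\<alpha> i)) (e (\<beta> i)))"
        proof (rule sum.cong[OF refl])
          fix i assume i: "i \<in> S r"
          have "(\<Sum>j\<in>S r. W (e (\<alpha> i)) (e (\<beta> j))) = (\<Sum>j\<in>{i}. W (e (\<alpha> i)) (e (\<beta> j)))"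
            by (rule sum.mono_neutral_right[OF fin]) (use i off in auto)
          then show "(\<Sum>j\<in>S r. W (e (\<alpha> i)) (e (\<beta> j))) = W (e (\<alpha> i)) (e (\<beta> i))" by simp
        qed
        finally have eq: "(\<Sum>i\<in>S r. W (e (\<alpha> i)) (e (\<beta> i))) = W (\<Sum>i\<in>S r. e (\<alpha> i)) (\<Sum>j\<in>S r. e (\<beta> j))" by simp
        have "norm (\<Sum>j\<in>S r. e (\<alpha> j)) \<le> 1" "norm (\<Sum>j\<in>S r. e (\<beta> j)) \<le> 1"
          using \<alpha> by (intro norm_e[of \<alpha> "S r"] norm_e[of \<beta> "S r"]; auto simp: S_def)+
        then have "norm (\<Sum>j\<in>S r. e (\<alpha> j)) * norm (\<Sum>j\<in>S r. e (\<beta> j)) * K \<le> 1 * K"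
          by (intro mult_right_mono mult_le_one K) simp_all
        then show ?thesis unfolding eq using K(2) order_trans by fastforce
      qed
      have "(\<Sum>j<N. W (e (\<alpha> j)) (e (\<beta> j))) = (\<Sum>r<(3::nat). \<Sum>j\<in>S r. W (e (\<alpha> j)) (e (\<beta> j)))"
        unfolding S_def by (rule sum.group[symmetric]) auto
      also have "norm \<dots> \<le> (\<Sum>r<(3::nat). K)"
        by (rule order_trans[OF norm_sum sum_mono]) (rule Sr)
      finally show ?thesis by simp
    qed
    have "W x 1 - W 1 x = W (x + M *\<^sub>R 1) 1 - W 1 (x + M *\<^sub>R 1)"
      by (simp add: add_left add_right scaleR_left scaleR_right)
    also have "\<dots> = (2 * M / real N) *\<^sub>R (\<Sum>j=1..N. W (G j) 1 - W 1 (G j))"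
      unfolding G(7) by (simp only: scaleR_left scaleR_right sum_left sum_right sum_subtractf scaleR_diff_right)
    also have "(\<Sum>j=1..N. W (G j) 1 - W 1 (G j)) = (\<Sum>i<N. W (G (Suc i)) 1 - W 1 (G (Suc i)))"
      by (rule sum.reindex_bij_witness[of _ Suc "\<lambda>j. j - 1"]) auto
    also have "\<dots> = (\<Sum>i<N. W (e (Suc i)) (e (id i))) - (\<Sum>i<N. W (e (id i)) (e (Suc i)))"
      by (simp only: step sum_subtractf id_apply)
    finally have eq: "W x 1 - W 1 x = (2 * M / real N) *\<^sub>R
      ((\<Sum>i<N. W (e (Suc i)) (e (id i))) - (\<Sum>i<N. W (e (id i)) (e (Suc i))))" .
    have "norm ((\<Sum>i<N. W (e (Suc i)) (e (id i))) - (\<Sum>i<N. W (e (id i)) (e (Suc i)))) \<le> 3 * K + 3 * K"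
      by (intro norm_triangle_le_diff add_mono group[of Suc id] group[of id Suc]) simp_all
    then have "norm (W x 1 - W 1 x) \<le> \<bar>2 * M / real N\<bar> * (3 * K + 3 * K)"
      unfolding eq norm_scaleR by (intro mult_left_mono) simp_all
    also have "\<dots> = 12 * M * K / real N" using M by simp
    finally show ?thesis .
  qed
  have "norm (W x 1 - W 1 x) \<le> 0"
  proof (rule ccontr)
    assume "\<not> ?thesis"
    then have pos: "norm (W x 1 - W 1 x) > 0" by simp
    obtain N where N: "12 * M * K / norm (W x 1 - W 1 x) < real N" using reals_Archimedean2 by blast
    moreover have "0 \<le> 12 * M * K / norm (W x 1 - W 1 x)" using M K by simp
    ultimately have N0: "real N > 0" by linarith
    then have "12 * M * K / real N < norm (W x 1 - W 1 x)"
      using N pos by (simp add: pos_divide_less_eq mult.commute)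
    then show False using bound[of N] N0 by simp
  qed
  then show ?thesis by simp
qed

section \<open>Completely positive maps of order zero\<close>

lemma star_mat_mult_index:
  assumes "X \<in> carrier_mat n n" "i < n" "j < n"
  shows "(star_mat X * X) $$ (i, j) = (\<Sum>k<n. star (X $$ (k, i)) * X $$ (k, j))"
  using assms by (simp add: star_mat_def scalar_prod_def lessThan_atLeast0)

locale cp_order_zero =
  fixes \<phi> :: "'a::c_star_algebra \<Rightarrow> 'b::c_star_algebra"
  assumes cp: "completely_positive \<phi>" and oz: "order_zero \<phi>"
begin

lemma add: "\<phi> (x + y) = \<phi> x + \<phi> y" and scaleC: "\<phi> (c *\<^sub>C x) = c *\<^sub>C \<phi> x"
  using cp by (simp_all add: completely_positive_def clinear_map_def)

lemma scaleR: "\<phi> (r *\<^sub>R x) = r *\<^sub>R \<phi> x"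
  by (metis scaleC scaleC_of_real)

lemma zero: "\<phi> 0 = 0"
  using scaleR[of 0 0] by simp

lemma diff: "\<phi> (x - y) = \<phi> x - \<phi> y"
  using add[of x "(-1) *\<^sub>R y"] scaleR[of "-1" y] by simp

text \<open>\<open>(p, q)\<close> and \<open>(r, s)\<close> play the role of the Stinespring vectors of \<open>w\<close> and \<open>b*\<close>.\<close>

lemma gram:
  obtains p q r s where "\<phi> (star w * w) = star p * p + star q * q" "\<phi> (b * w) = star r * p + star s * q"
proof -
  \<comment> \<open>The row \<open>(w, star b)\<close> over a zero row: the first column of
    \<open>star_mat X * X\<close> is \<open>star w * w\<close>, \<open>b * w\<close>. The columns of
    the factor \<open>Y\<close> are \<open>(p, q)\<close> and \<open>(r, s)\<close>.\<close>
  define X where "X = mat 2 2 (\<lambda>(i, j). if i = 0 then if j = 0 then w else star b else 0)"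
  have X: "X \<in> carrier_mat 2 2" by (simp add: X_def)
  then have "positive_mat 2 (star_mat X * X)" by (auto simp: positive_mat_def)
  then have "positive_mat 2 (map_mat \<phi> (star_mat X * X))"
    using cp by (simp add: completely_positive_def)
  then obtain Y where Y: "Y \<in> carrier_mat 2 2" "map_mat \<phi> (star_mat X * X) = star_mat Y * Y"
    by (auto simp: positive_mat_def)
  have eq: "\<phi> (\<Sum>k<2. star (X $$ (k, i)) * X $$ (k, j)) = (\<Sum>k<2. star (Y $$ (k, i)) * Y $$ (k, j))"
    if "i < 2" "j < 2" for i j
  proof -
    have "map_mat \<phi> (star_mat X * X) $$ (i, j) = \<phi> ((star_mat X * X) $$ (i, j))"
      using that X by (intro index_map_mat) (simp_all add: star_mat_def)
    then show ?thesis
      using star_mat_mult_index[OF X that] star_mat_mult_index[OF Y(1) that] Y(2) by simp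
  qed
  show thesis
    using eq[of 0 0] eq[of 1 0] by (intro that) (simp_all add: X_def numeral_2_eq_2 star_star)
qed

lemma positive: assumes "positive a" shows "positive (\<phi> a)"
proof -
  obtain w where "a = star w * w" using assms by (auto simp: positive_def)
  then show ?thesis using gram[of w 0] by (metis positive_add positive_star_mult_self)
qed

lemma star: "\<phi> (star a) = star (\<phi> a)"
proof -
  have sa: "star (\<phi> u) = \<phi> u" if su: "star u = u" for u
  proof -
    obtain p q where "positive p" "positive q" "u = p - q" using sa_eq_diff_positive[OF su] by metis
    then show ?thesis by (simp add: diff star_diff positive_star positive)
  qed
  obtain u v where "star u = u" "star v = v" "a = u + \<i> *\<^sub>C v" using sa_decomposition by metis
  then show ?thesis by (simp add: star_add star_scaleC add scaleC sa)
qed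

text \<open>Positive elements \<open>b n\<close> of norm 1 with
  \<open>\<parallel>\<phi> (b n)\<parallel> > 4 ^ n\<close> are summed with weights
  \<open>(1 / 2) ^ n\<close>. The sum dominates each term, so its image would have norm at least
  \<open>2 ^ n\<close> for every \<open>n\<close>.\<close>

lemma bounded_on_positive: "\<exists>K\<ge>0. \<forall>a. positive a \<longrightarrow> norm (\<phi> a) \<le> K * norm a"
proof (rule ccontr)
  assume neg: "\<not> ?thesis"
  have "\<exists>b. positive b \<and> norm b = 1 \<and> 4 ^ n < norm (\<phi> b)" for n :: nat
  proof -
    obtain a where a: "positive a" "4 ^ n * norm a < norm (\<phi> a)" using neg by (metis not_less zero_le_power zero_le_numeral)
    have "norm a > 0" using a(2) by (auto simp: zero)
    then show ?thesis using a
      by (intro exI[of _ "(1 / norm a) *\<^sub>R a"]) (simp add: positive_scaleR scaleR pos_less_divide_eq)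
  qed
  then obtain b where b: "\<And>n. positive (b n)" "\<And>n. norm (b n) = 1" "\<And>n. 4 ^ n < norm (\<phi> (b n))" by metis
  define f where "f n = (1 / 2) ^ n *\<^sub>R b n" for n
  have pf: "positive (f n)" for n unfolding f_def by (intro positive_scaleR b) simp
  have "summable f"
    by (rule summable_norm_cancel) (simp add: f_def b summable_geometric)
  then have lim: "(\<lambda>m. sum f {..<m}) \<longlonglongrightarrow> suminf f" by (rule summable_LIMSEQ)
  have "2 ^ n \<le> norm (\<phi> (suminf f))" for n
  proof -
    have "(\<lambda>m. sum f {..<m + Suc n} - f n) \<longlonglongrightarrow> suminf f - f n"
      by (intro tendsto_diff tendsto_const LIMSEQ_ignore_initial_segment lim)
    moreover have "positive (sum f {..<m + Suc n} - f n)" for m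
    proof -
      have "sum f {..<m + Suc n} - f n = sum f ({..<m + Suc n} - {n})"
        by (simp add: sum_diff1)
      then show ?thesis by (simp only: positive_sum pf)
    qed
    ultimately have "positive (suminf f - f n)" by (rule positive_limit)
    then have "norm (\<phi> (f n)) \<le> norm (\<phi> (suminf f))"
      using positive by (intro positive_norm_mono) (auto simp: pf simp flip: diff)
    moreover have "norm (\<phi> (f n)) = (1 / 2) ^ n * norm (\<phi> (b n))" by (simp add: f_def scaleR)
    moreover have "(1 / 2) ^ n * (4::real) ^ n \<le> (1 / 2) ^ n * norm (\<phi> (b n))"
      using b(3)[of n] by (intro mult_left_mono) simp_all
    moreover have "(1 / 2) ^ n * (4::real) ^ n = 2 ^ n" by (simp flip: power_mult_distrib)
    ultimately show ?thesis by linarith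
  qed
  moreover obtain n where "norm (\<phi> (suminf f)) < 2 ^ n" using real_arch_pow[of 2] by auto
  ultimately show False by (meson not_less)
qed

lemma bounded_linear: "bounded_linear \<phi>"
proof -
  obtain K where K: "K \<ge> 0" "\<And>a. positive a \<Longrightarrow> norm (\<phi> a) \<le> K * norm a"
    using bounded_on_positive by blast
  have sa: "norm (\<phi> u) \<le> 2 * K * norm u" if su: "star u = u" for u
  proof -
    obtain p q where pq: "positive p" "positive q" "u = p - q" "norm p \<le> norm u" "norm q \<le> norm u"
      using sa_eq_diff_positive[OF su] by metis
    have "norm (\<phi> u) \<le> norm (\<phi> p) + norm (\<phi> q)" unfolding pq(3) diff by (rule norm_triangle_ineq4)
    also have "\<dots> \<le> K * norm u + K * norm u"
      using K pq by (intro add_mono) (meson mult_left_mono order_trans)+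
    finally show ?thesis by simp
  qed
  show ?thesis
  proof (rule bounded_linear_intro[where K="4 * K"])
    fix x :: 'a
    obtain u v where uv: "star u = u" "star v = v" "x = u + \<i> *\<^sub>C v" "norm u \<le> norm x" "norm v \<le> norm x"
      using sa_decomposition by metis
    have "norm (\<phi> x) \<le> norm (\<phi> u) + norm (\<phi> v)"
      unfolding uv(3) add scaleC by (rule norm_triangle_le) (simp add: norm_scaleC)
    also have "\<dots> \<le> 2 * K * norm x + 2 * K * norm x"
    proof (rule add_mono)
      show "norm (\<phi> u) \<le> 2 * K * norm x" "norm (\<phi> v) \<le> 2 * K * norm x"
        using sa[OF uv(1)] sa[OF uv(2)] mult_left_mono[OF uv(4), of "2 * K"] mult_left_mono[OF uv(5), of "2 * K"] K(1)
        by simp_all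
    qed
    finally show "norm (\<phi> x) \<le> norm x * (4 * K)" by (simp add: ac_simps)
  qed (simp_all only: add scaleR)
qed

lemmas tendsto = bounded_linear.tendsto[OF bounded_linear]

text \<open>Compressing by \<open>c\<close> gives
  \<open>star (p c) (p c) + star (q c) (q c) = 0\<close>, which kills \<open>p c\<close> and
  \<open>q c\<close>, and \<open>\<phi> (b * w)\<close> has \<open>p\<close> and \<open>q\<close> as
  right factors. The factor \<open>b\<close> takes the place of a unit;
  \<open>mult_eq_0_cancel\<close> removes it.\<close>

lemma mult_eq_0_of_square:
  assumes "\<phi> (star w * w) * c = 0"
  shows "\<phi> (b * w) * c = 0"
proof -
  obtain p q r s where eq: "\<phi> (star w * w) = star p * p + star q * q" "\<phi> (b * w) = star r * p + star s * q"
    using gram by metis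
  have "star (p * c) * (p * c) + star (q * c) * (q * c) = star c * (\<phi> (star w * w) * c)"
    by (simp add: eq(1) star_mult algebra_simps)
  then have 0: "star (p * c) * (p * c) + star (q * c) * (q * c) = 0" using assms by simp
  have "p * c = 0" using norm_power2_le_norm_add[of "p * c" "q * c"] 0 by simp
  moreover have "q * c = 0" using norm_power2_le_norm_add[of "q * c" "p * c"] 0 by (simp add: add.commute)
  ultimately show ?thesis by (simp add: eq(2) distrib_right mult.assoc)
qed

end

lemma approximate_left_unit:
  obtains u where "(\<lambda>n. u n * a) \<longlonglongrightarrow> (a::'a::c_star_algebra)"
proof -
  have "\<exists>u. norm (u * a - a) < 1 / real (Suc n)" for n
    using approximate_unit[of "{a}" "1 / real (Suc n)"] by (metis finite.emptyI finite.insertI insertI1 of_nat_0_less_iff zero_less_Suc zero_less_divide_1_iff)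
  then obtain u where u: "\<And>n. norm (u n * a - a) < 1 / real (Suc n)" by metis
  have "(\<lambda>n. u n * a - a) \<longlonglongrightarrow> 0"
    by (rule Lim_null_comparison[OF _ lim_1_over_n[THEN LIMSEQ_Suc]])
      (use u in \<open>auto intro!: always_eventually less_imp_le\<close>)
  then have "(\<lambda>n. u n * a) \<longlonglongrightarrow> a" by (rule LIM_zero_cancel)
  then show thesis by (rule that)
qed

context cp_order_zero
begin

lemma mult_eq_0_cancel:
  assumes "\<And>b. \<phi> (b * w) * c = 0"
  shows "\<phi> w * c = 0"
proof -
  obtain u where u: "(\<lambda>n. u n * w) \<longlonglongrightarrow> w" using approximate_left_unit by blast
  have "(\<lambda>n. \<phi> (u n * w) * c) \<longlonglongrightarrow> \<phi> w * c" by (intro tendsto_mult tendsto u tendsto_const)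
  then show ?thesis by (simp add: assms LIMSEQ_const_iff)
qed

lemma zero_product:
  assumes "w * v = 0"
  shows "\<phi> w * \<phi> v = 0"
proof -
  define p q where "p = star w * w" and "q = star (star v) * star v"
  have pq: "p * q = 0" by (metis assms mult.assoc mult_zero_left mult_zero_right p_def q_def star_star)
  have sp: "star p = p" "star q = q" by (simp_all add: p_def q_def star_mult star_star)
  have qp: "q * p = 0" by (metis pq sp star_mult star_zero)
  have "p \<bottom>\<^sub>C q" by (simp add: orthogonal_elements_def sp pq qp)
  then have "\<phi> p \<bottom>\<^sub>C \<phi> q" using oz by (simp add: order_zero_def p_def q_def)
  then have "\<phi> p * \<phi> q = 0" by (simp add: orthogonal_elements_def)
  then have "\<phi> w * \<phi> q = 0" unfolding p_def by (rule mult_eq_0_cancel[OF mult_eq_0_of_square])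
  then have "\<phi> q * \<phi> (star w) = 0" by (metis sp(2) star star_mult star_zero)
  then have "\<phi> (star v) * \<phi> (star w) = 0" unfolding q_def by (rule mult_eq_0_cancel[OF mult_eq_0_of_square])
  then show ?thesis by (metis star star_mult star_star star_zero)
qed

lemma mult_shift: "\<phi> (a * b) * \<phi> c = \<phi> a * \<phi> (b * c)"
proof -
  have sa: "\<phi> (a * x) * \<phi> c = \<phi> a * \<phi> (x * c)" if "star x = x" for x
  proof -
    \<comment> \<open>On the unitization 1 is available and \<open>W x 1 = W 1 x\<close> is the
      claim. \<open>incl a * f\<close> and \<open>g * incl c\<close> have scalar part 0, so
      \<open>elem\<close> loses nothing.\<close>
    define W where "W f g = \<phi> (elem (incl a * f)) * \<phi> (elem (g * incl c))" for f g
    have "bounded_linear (\<lambda>f. \<phi> (elem (incl a * f)))" "bounded_linear (\<lambda>g. \<phi> (elem (g * incl c)))"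
      by (intro bounded_linear_compose[OF bounded_linear] bounded_linear_compose[OF bounded_linear_elem]
          bounded_linear_mult_right bounded_linear_mult_left)+
    then have "bounded_bilinear W"
      unfolding W_def by (rule bounded_bilinear.comp[OF bounded_bilinear_mult])
    moreover have "W f g = 0" if "f * g = 0" for f g
    proof -
      have "incl (elem (incl a * f) * elem (g * incl c)) = (incl a * f) * (g * incl c)"
        by (rule unitization_eqI) simp_all
      also have "\<dots> = incl a * (f * g) * incl c" by (simp only: mult.assoc)
      also have "\<dots> = incl 0" by (simp add: that incl_algebra)
      finally show ?thesis unfolding W_def by (intro zero_product) simp
    qed
    ultimately have "W (incl x) 1 = W 1 (incl x)"
      using that by (intro zero_product_bilinear_sa) simp_all
    then show ?thesis by (simp add: W_def)
  qed
  obtain u v where uv: "star u = u" "star v = v" "b = u + \<i> *\<^sub>C v" using sa_decomposition by metis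
  show ?thesis
    unfolding uv(3) distrib_left distrib_right mult_scaleC_left mult_scaleC_right add scaleC
    by (simp only: sa uv(1,2))
qed

end


section \<open>Two limit arguments and the generated subalgebra\<close>

text \<open>Taking \<open>2 ^ n\<close>-th roots removes the constants \<open>c\<close> and
  \<open>K\<close>.\<close>

lemma le_of_power_le:
  fixes \<alpha> \<beta> c K :: real
  assumes "\<beta> \<ge> 0" "c > 0" and le: "\<And>n. c * \<alpha> ^ (2 ^ n) \<le> K * \<beta> ^ (2 ^ n)"
  shows "\<alpha> \<le> \<beta>"
proof (rule ccontr)
  assume "\<not> \<alpha> \<le> \<beta>"
  then have lt: "\<beta> < \<alpha>" by simp
  show False
  proof (cases "\<beta> = 0")
    case True
    then have "c * \<alpha> \<le> 0" using le[of 0] by simp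
    moreover have "c * \<alpha> > 0" using lt True assms(2) by simp
    ultimately show False by simp
  next
    case False
    then have \<beta>: "\<beta> > 0" using assms(1) by simp
    define r where "r = \<alpha> / \<beta>"
    have r: "r > 1" using lt \<beta> by (simp add: r_def)
    obtain m where m: "K / c < r ^ m" using real_arch_pow[OF r] by blast
    have "r ^ m \<le> r ^ (2 ^ m)" using r by (intro power_increasing) (simp_all add: less_imp_le)
    moreover have "c * r ^ (2 ^ m) \<le> K"
      using le[of m] \<beta> by (simp add: r_def power_divide pos_divide_le_eq)
    then have "r ^ (2 ^ m) \<le> K / c" using assms(2) by (simp add: pos_le_divide_eq mult.commute)
    ultimately show False using m by simp
  qed
qed

text \<open>A Cauchy criterion along filters, since an approximate unit of a non-separable algebra
  is in general not a sequence.\<close>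

lemma tendsto_exI:
  fixes f :: "'a \<Rightarrow> 'b::banach"
  assumes F: "F \<noteq> bot" and ev: "\<And>e. e > 0 \<Longrightarrow> \<exists>l. eventually (\<lambda>u. norm (f u - l) < e) F"
  shows "\<exists>l. (f \<longlongrightarrow> l) F"
proof -
  have "\<exists>l. eventually (\<lambda>u. norm (f u - l) < 1 / real (Suc n)) F" for n by (intro ev) simp
  then obtain l where l: "\<And>n. eventually (\<lambda>u. norm (f u - l n) < 1 / real (Suc n)) F" by metis
  have dist: "norm (l m - l n) < 1 / real (Suc m) + 1 / real (Suc n)" for m n
  proof -
    obtain u where "norm (f u - l m) < 1 / real (Suc m)" "norm (f u - l n) < 1 / real (Suc n)"
      using eventually_happens'[OF F eventually_conj[OF l[of m] l[of n]]] by blast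
    then show ?thesis using norm_triangle_ineq4[of "f u - l n" "f u - l m"] by simp
  qed
  have "Cauchy l"
  proof (rule CauchyI)
    fix e :: real assume e: "e > 0"
    obtain M where M: "1 / real (Suc M) < e / 2"
      using e reals_Archimedean[of "e / 2"] by (auto simp: inverse_eq_divide)
    have "norm (l m - l n) < e" if "m \<ge> M" "n \<ge> M" for m n
    proof -
      have "1 / real (Suc m) \<le> 1 / real (Suc M)" "1 / real (Suc n) \<le> 1 / real (Suc M)"
        using that by (simp_all add: frac_le)
      then show ?thesis using dist[of m n] M by linarith
    qed
    then show "\<exists>M. \<forall>m\<ge>M. \<forall>n\<ge>M. norm (l m - l n) < e" by blast
  qed
  then obtain L where L: "l \<longlonglongrightarrow> L" by (auto simp: Cauchy_convergent_iff convergent_def)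
  have "(f \<longlongrightarrow> L) F"
  proof (rule tendstoI)
    fix e :: real assume e: "e > 0"
    have "eventually (\<lambda>n. dist (l n) L < e / 2) sequentially" using e by (intro tendstoD[OF L]) simp
    moreover have "eventually (\<lambda>n. 1 / real (Suc n) < e / 2) sequentially"
      using e by (intro order_tendstoD(2)[OF lim_1_over_n[THEN LIMSEQ_Suc]]) simp
    ultimately obtain n where n: "dist (l n) L < e / 2" "1 / real (Suc n) < e / 2"
      using eventually_happens'[OF sequentially_bot eventually_conj] by blast
    show "eventually (\<lambda>u. dist (f u) L < e) F"
      using l[of n]
    proof eventually_elim
      case (elim u)
      then have "dist (f u) (l n) < e / 2" using n(2) by (simp add: dist_norm)
      then show ?case using n(1) dist_triangle[of "f u" L "l n"] by simp
    qed
  qed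
  then show ?thesis by blast
qed

lemma c_star_subalgebra_generated: "c_star_subalgebra (c_star_generated S)"
  unfolding c_star_generated_def
  by (rule hull_in) (auto simp: c_star_subalgebra_def intro: closed_Inter)

context cp_order_zero
begin

section \<open>The multipliers given by the domain\<close>

definition C where "C = c_star_generated (range \<phi>)"

lemma C_sub: "c_star_subalgebra C"
  unfolding C_def by (rule c_star_subalgebra_generated)

lemma C_closed: "closed C"
  and C_0: "0 \<in> C"
  and C_add: "x \<in> C \<Longrightarrow> y \<in> C \<Longrightarrow> x + y \<in> C"
  and C_scaleC: "x \<in> C \<Longrightarrow> c *\<^sub>C x \<in> C"
  and C_mult: "x \<in> C \<Longrightarrow> y \<in> C \<Longrightarrow> x * y \<in> C"
  and C_star: "x \<in> C \<Longrightarrow> star x \<in> C"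
  using C_sub by (simp_all add: c_star_subalgebra_def)

lemma C_scaleR: "x \<in> C \<Longrightarrow> r *\<^sub>R x \<in> C"
  by (metis C_scaleC scaleC_of_real)

lemma C_diff: "x \<in> C \<Longrightarrow> y \<in> C \<Longrightarrow> x - y \<in> C"
  using C_add[of x "(-1) *\<^sub>R y"] C_scaleR[of y "-1"] by simp

lemma C_phi: "\<phi> a \<in> C"
  unfolding C_def c_star_generated_def using hull_subset[of "range \<phi>" c_star_subalgebra] by blast

text \<open>The leading factor \<open>\<phi> b\<close> is kept visible because \<pi>(a) acts on it.
  Scalars and adjoints are covered, as \<open>\<phi>\<close> is linear and preserves the
  involution.\<close>

inductive_set words where
  base: "\<phi> b \<in> words"
| step: "x \<in> words \<Longrightarrow> \<phi> b * x \<in> words"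
| add: "x \<in> words \<Longrightarrow> y \<in> words \<Longrightarrow> x + y \<in> words"

lemma words_C: "x \<in> words \<Longrightarrow> x \<in> C"
  by (induction rule: words.induct) (auto intro: C_phi C_mult C_add)

lemma words_scaleC: "x \<in> words \<Longrightarrow> c *\<^sub>C x \<in> words"
proof (induction rule: words.induct)
  case (base b)
  then show ?case using words.base[of "c *\<^sub>C b"] by (simp add: scaleC)
next
  case (step x b)
  then show ?case using words.step[of x "c *\<^sub>C b"] by (simp add: scaleC mult_scaleC_left)
next
  case (add x y)
  then show ?case by (simp add: scaleC_add_right words.add)
qed

lemma words_diff: "x \<in> words \<Longrightarrow> y \<in> words \<Longrightarrow> x - y \<in> words"
  using words.add[of x "(-1) *\<^sub>C y"] words_scaleC[of y "-1"] by simp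

lemma words_mult: "x \<in> words \<Longrightarrow> y \<in> words \<Longrightarrow> x * y \<in> words"
  by (induction rule: words.induct) (auto simp: mult.assoc distrib_right intro: words.intros)

lemma words_star: "x \<in> words \<Longrightarrow> star x \<in> words"
proof (induction rule: words.induct)
  case (step x b)
  have "star x * \<phi> (star b) \<in> words" by (rule words_mult[OF step.IH words.base])
  then show ?case by (simp add: star_mult star)
qed (auto simp: star_add intro: words.add simp flip: star intro: words.base)

lemma closure_words_sub: "c_star_subalgebra (closure words)"
  unfolding c_star_subalgebra_def
proof (intro conjI ballI allI)
  show "0 \<in> closure words" using words.base[of 0] closure_subset by (auto simp: zero)
next
  fix x y assume "x \<in> closure words" "y \<in> closure words"
  then obtain f g where fg: "\<And>n. f n \<in> words" "f \<longlonglongrightarrow> x" "\<And>n. g n \<in> words" "g \<longlonglongrightarrow> y"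
    unfolding closure_sequential by metis
  show "x + y \<in> closure words" unfolding closure_sequential
    by (rule exI[of _ "\<lambda>n. f n + g n"]) (simp add: words.add fg tendsto_add)
  show "x * y \<in> closure words" unfolding closure_sequential
    by (rule exI[of _ "\<lambda>n. f n * g n"]) (simp add: words_mult fg tendsto_mult)
next
  fix x assume "x \<in> closure words"
  then obtain f where f: "\<And>n. f n \<in> words" "f \<longlonglongrightarrow> x" unfolding closure_sequential by metis
  show "c *\<^sub>C x \<in> closure words" for c unfolding closure_sequential
    by (rule exI[of _ "\<lambda>n. c *\<^sub>C f n"]) (simp add: words_scaleC f tendsto_scaleC)
  show "star x \<in> closure words" unfolding closure_sequential
    by (rule exI[of _ "\<lambda>n. star (f n)"]) (simp add: words_star f tendsto_star)
qed simp

lemma C_approx: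
  assumes "x \<in> C"
  obtains f where "\<And>n. f n \<in> words" "f \<longlonglongrightarrow> x"
proof -
  have "C \<subseteq> closure words"
    unfolding C_def c_star_generated_def
  proof (rule hull_minimal)
    show "range \<phi> \<subseteq> closure words" using words.base closure_subset by blast
  qed (rule closure_words_sub)
  then have "x \<in> closure words" using assms by blast
  then obtain f where "\<forall>n. f n \<in> words" "f \<longlonglongrightarrow> x" unfolding closure_sequential by blast
  then show thesis using that by blast
qed

lemma C_induct_limit:
  assumes "x \<in> C" "\<And>x. x \<in> words \<Longrightarrow> P x"
    and "\<And>f x. (\<And>n. f n \<in> words) \<Longrightarrow> (\<And>n. P (f n)) \<Longrightarrow> f \<longlonglongrightarrow> x \<Longrightarrow> x \<in> C \<Longrightarrow> P x"
  shows "P x"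
proof -
  obtain f where f: "\<And>n. f n \<in> words" "f \<longlonglongrightarrow> x" using C_approx[OF assms(1)] by blast
  show ?thesis by (rule assms(3)[OF f(1) assms(2)[OF f(1)] f(2) assms(1)])
qed

text \<open>The graph of \<open>\<pi>(a)\<close>, described without reference to a representation of \<open>x\<close> by values of \<open>\<phi>\<close>.\<close>

definition rel :: "'a \<Rightarrow> 'b \<Rightarrow> 'b \<Rightarrow> bool" where
  "rel a x y \<longleftrightarrow> y \<in> C \<and> (\<forall>b. \<phi> b * y = \<phi> (b * a) * x)"

text \<open>\<open>star y\<close> is a limit of words, all of which annihilate \<open>y\<close> from
  the left, so \<open>star y * y = 0\<close>. This makes \<open>rel\<close> single-valued.\<close>

lemma C_faithful:
  assumes y: "y \<in> C" and 0: "\<And>b. \<phi> b * y = 0"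
  shows "y = 0"
proof -
  have D0: "z * y = 0" if "z \<in> words" for z
    using that by (induction rule: words.induct) (simp_all add: 0 distrib_right mult.assoc)
  obtain f where f: "\<And>n. f n \<in> words" "f \<longlonglongrightarrow> star y" using C_approx[OF C_star[OF y]] by blast
  have "(\<lambda>n. f n * y) \<longlonglongrightarrow> star y * y" by (intro tendsto_mult f tendsto_const)
  then have "star y * y = 0" by (simp add: D0 f LIMSEQ_const_iff)
  then show ?thesis by simp
qed

lemma rel_unique: "rel a x y \<Longrightarrow> rel a x y' \<Longrightarrow> y = y'"
  using C_faithful[of "y - y'"] by (simp add: rel_def C_diff right_diff_distrib)

lemma rel_add: "rel a x y \<Longrightarrow> rel a x' y' \<Longrightarrow> rel a (x + x') (y + y')"
  by (simp add: rel_def C_add distrib_left)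

lemma rel_scaleC: "rel a x y \<Longrightarrow> rel a (c *\<^sub>C x) (c *\<^sub>C y)"
  by (simp add: rel_def C_scaleC mult_scaleC_right)

lemma rel_diff: "rel a x y \<Longrightarrow> rel a x' y' \<Longrightarrow> rel a (x - x') (y - y')"
  by (simp add: rel_def C_diff right_diff_distrib)

lemma rel_mult: "rel a x y \<Longrightarrow> z \<in> C \<Longrightarrow> rel a (x * z) (y * z)"
  by (simp add: rel_def C_mult flip: mult.assoc)

lemma rel_phi: "rel a (\<phi> b) (\<phi> (a * b))"
  by (simp add: rel_def C_phi mult_shift)

lemma rel_comp: "rel b x y \<Longrightarrow> rel a y z \<Longrightarrow> rel (a * b) x z"
  by (simp add: rel_def mult.assoc)

lemma rel_phi_mult: "x \<in> C \<Longrightarrow> rel a (\<phi> b * x) (\<phi> (a * b) * x)"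
  by (rule rel_mult[OF rel_phi])

lemma norm_phi_le: "norm (\<phi> a) \<le> onorm \<phi> * norm a"
  by (rule onorm[OF bounded_linear])

lemma onorm_nonneg: "0 \<le> onorm \<phi>"
  by (rule onorm_pos_le[OF bounded_linear])

text \<open>\<open>K\<close> depends on an expression of \<open>x\<close> by values of
  \<open>\<phi>\<close> but not on \<open>a\<close>. This uniformity lets
  \<open>words_rel_norm\<close> replace \<open>a\<close> by \<open>star a * a\<close>
  repeatedly.\<close>

lemma words_rel:
  assumes "x \<in> words"
  shows "\<exists>f K. K \<ge> 0 \<and> (\<forall>a. f a \<in> words \<and> rel a x (f a) \<and> norm (f a) \<le> K * norm a)"
  using assms
proof (induction rule: words.induct)
  case (base b)
  have "norm (\<phi> (a * b)) \<le> onorm \<phi> * norm b * norm a" for a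
  proof -
    have "onorm \<phi> * norm (a * b) \<le> onorm \<phi> * (norm a * norm b)"
      by (intro mult_left_mono norm_mult_ineq onorm_nonneg)
    then show ?thesis using norm_phi_le[of "a * b"] by (simp add: ac_simps)
  qed
  then show ?case
    by (intro exI[of _ "\<lambda>a. \<phi> (a * b)"] exI[of _ "onorm \<phi> * norm b"])
      (simp add: rel_phi words.base onorm_nonneg)
next
  case (step x b)
  have "norm (\<phi> (a * b) * x) \<le> onorm \<phi> * norm b * norm x * norm a" for a
  proof -
    have "norm (\<phi> (a * b) * x) \<le> norm (\<phi> (a * b)) * norm x" by (rule norm_mult_ineq)
    also have "\<dots> \<le> onorm \<phi> * norm (a * b) * norm x" by (intro mult_right_mono norm_phi_le norm_ge_zero)
    also have "\<dots> \<le> onorm \<phi> * (norm a * norm b) * norm x"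
      by (intro mult_left_mono mult_right_mono norm_mult_ineq onorm_nonneg norm_ge_zero)
    finally show ?thesis by (simp add: ac_simps)
  qed
  then show ?case
    by (intro exI[of _ "\<lambda>a. \<phi> (a * b) * x"] exI[of _ "onorm \<phi> * norm b * norm x"])
      (simp add: rel_phi_mult words_C step words.step onorm_nonneg)
next
  case (add x y)
  then obtain f K g L where f: "K \<ge> 0" "\<And>a. f a \<in> words" "\<And>a. rel a x (f a)" "\<And>a. norm (f a) \<le> K * norm a"
    and g: "L \<ge> 0" "\<And>a. g a \<in> words" "\<And>a. rel a y (g a)" "\<And>a. norm (g a) \<le> L * norm a"
    by metis
  have "norm (f a + g a) \<le> (K + L) * norm a" for a
    using norm_triangle_mono[OF f(4) g(4)] by (simp add: distrib_right)
  then show ?case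
    by (intro exI[of _ "\<lambda>a. f a + g a"] exI[of _ "K + L"]) (simp add: f g words.add rel_add)
qed

text \<open>The adjoint of \<open>rel (star a) x' y'\<close> is the case
  \<open>x = \<phi> b\<close>; right factors and sums do the rest. Only \<open>x\<close> is
  restricted to \<open>words\<close>, so the later limit argument runs in one variable.\<close>

lemma words_rel_adjoint:
  assumes "x \<in> words" "rel a x y" "rel (star a) x' y'"
  shows "star y' * x = star x' * y"
proof -
  have phi: "star y' * \<phi> b = star x' * \<phi> (a * b)" for b
  proof -
    have "star (\<phi> (star b) * y') = star (\<phi> (star b * star a) * x')"
      using assms(3) by (simp add: rel_def)
    moreover have "star (\<phi> (star b * star a)) = \<phi> (a * b)" by (simp add: star_mult star_star flip: star)
    ultimately show ?thesis by (simp add: star_mult star star_star)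
  qed
  have "\<exists>y. rel a x y \<and> star y' * x = star x' * y"
    using assms(1)
  proof (induction rule: words.induct)
    case (base b)
    show ?case by (intro exI[of _ "\<phi> (a * b)"] conjI rel_phi phi)
  next
    case (step x b)
    have "star y' * (\<phi> b * x) = star x' * (\<phi> (a * b) * x)"
      by (simp only: phi flip: mult.assoc)
    then show ?case by (intro exI[of _ "\<phi> (a * b) * x"] conjI rel_phi_mult words_C step.hyps)
  next
    case (add x y)
    then obtain z z' where "rel a x z" "star y' * x = star x' * z" "rel a y z'" "star y' * y = star x' * z'"
      by blast
    then show ?case by (intro exI[of _ "z + z'"]) (simp add: rel_add distrib_left)
  qed
  then show ?thesis using rel_unique assms(2) by blast
qed

text \<open>The C*-identity turns a bound \<open>\<parallel>f a\<parallel> \<le> K \<parallel>a\<parallel>\<close>, with \<open>K\<close> depending on \<open>x\<close>, into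
  \<open>\<parallel>x\<parallel> \<parallel>f a\<parallel>\<^sup>m \<le> K (\<parallel>x\<parallel> \<parallel>a\<parallel>)\<^sup>m\<close> for all powers \<open>m\<close> of \<open>2\<close>.\<close>

lemma words_rel_norm:
  assumes x: "x \<in> words" and y: "rel a x y"
  shows "norm y \<le> norm a * norm x"
proof -
  obtain f K where f: "\<And>a. f a \<in> words" "\<And>a. rel a x (f a)" "\<And>a. norm (f a) \<le> K * norm a"
    using words_rel[OF x] by metis
  have y_eq: "y = f a" by (rule rel_unique[OF y f(2)])
  have sq: "(norm (f a))\<^sup>2 \<le> norm x * norm (f (star a * a))" for a
  proof -
    have "rel (star a) (f a) (f (star a * a))"
      using f(2)[of a] f(2)[of "star a * a"] by (simp add: rel_def mult.assoc)
    then have "star (f a) * f a = star x * f (star a * a)"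
      by (rule words_rel_adjoint[OF f(1)]) (simp only: star_star f(2))
    then have "(norm (f a))\<^sup>2 = norm (star x * f (star a * a))" by (simp flip: norm_star_mult_self)
    also have "\<dots> \<le> norm (star x) * norm (f (star a * a))" by (rule norm_mult_ineq)
    finally show ?thesis by simp
  qed
  have pow: "norm x * norm (f a) ^ (2 ^ n) \<le> K * (norm a * norm x) ^ (2 ^ n)" for n a
  proof (induction n arbitrary: a)
    case 0
    have "norm x * norm (f a) \<le> norm x * (K * norm a)" by (intro mult_left_mono f norm_ge_zero)
    then show ?case by (simp add: ac_simps)
  next
    case (Suc n)
    let ?m = "2 ^ n :: nat" and ?b = "star a * a"
    have "norm x * norm (f a) ^ (2 ^ Suc n) = norm x * ((norm (f a))\<^sup>2) ^ ?m"
      by (simp flip: power_mult)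
    also have "\<dots> \<le> norm x * (norm x * norm (f ?b)) ^ ?m"
      by (intro mult_left_mono power_mono sq) simp_all
    also have "\<dots> = norm x ^ ?m * (norm x * norm (f ?b) ^ ?m)" by (simp add: power_mult_distrib)
    also have "\<dots> \<le> norm x ^ ?m * (K * (norm ?b * norm x) ^ ?m)"
      by (intro mult_left_mono Suc) simp
    also have "\<dots> = K * ((norm a * norm x)\<^sup>2) ^ ?m"
      by (simp add: norm_star_mult_self power_mult_distrib power2_eq_square)
    also have "\<dots> = K * (norm a * norm x) ^ (2 ^ Suc n)"
      by (simp flip: power_mult)
    finally show ?case .
  qed
  show ?thesis
  proof (cases "x = 0")
    case True
    then have "(norm (f a))\<^sup>2 \<le> 0" using sq[of a] by simp
    then show ?thesis using True y_eq by simp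
  next
    case False
    then show ?thesis unfolding y_eq by (intro le_of_power_le[OF _ _ pow]) simp_all
  qed
qed

lemma rel_exists:
  assumes x: "x \<in> C"
  shows "\<exists>y. rel a x y \<and> norm y \<le> norm a * norm x"
proof -
  obtain f where f: "\<And>n. f n \<in> words" "f \<longlonglongrightarrow> x" using C_approx[OF x] by blast
  have "\<exists>y. rel a (f n) y" for n using words_rel[OF f(1)] by blast
  then obtain g where g: "\<And>n. rel a (f n) (g n)" by metis
  have "Cauchy g"
  proof (rule CauchyI)
    fix e :: real assume e: "e > 0"
    have "Cauchy f" using f(2) by (rule LIMSEQ_imp_Cauchy)
    moreover have "e / (norm a + 1) > 0" using e by (simp add: add_nonneg_pos)
    ultimately obtain M where M: "\<And>m n. m \<ge> M \<Longrightarrow> n \<ge> M \<Longrightarrow> norm (f m - f n) < e / (norm a + 1)"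
      using CauchyD by metis
    have "norm (g m - g n) < e" if "m \<ge> M" "n \<ge> M" for m n
    proof -
      have "norm (g m - g n) \<le> norm a * norm (f m - f n)"
        by (rule words_rel_norm[OF words_diff[OF f(1) f(1)] rel_diff[OF g g]])
      also have "\<dots> \<le> (norm a + 1) * norm (f m - f n)" by (intro mult_right_mono) simp_all
      also have "\<dots> < e" using M[OF that] by (simp add: pos_less_divide_eq add_nonneg_pos mult.commute)
      finally show ?thesis .
    qed
    then show "\<exists>M. \<forall>m\<ge>M. \<forall>n\<ge>M. norm (g m - g n) < e" by blast
  qed
  then obtain y where y: "g \<longlonglongrightarrow> y" by (auto simp: Cauchy_convergent_iff convergent_def)
  have "y \<in> C" using closed_sequentially[OF C_closed _ y] g by (simp add: rel_def)
  moreover have "\<phi> b * y = \<phi> (b * a) * x" for b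
  proof (rule LIMSEQ_unique)
    show "(\<lambda>n. \<phi> b * g n) \<longlonglongrightarrow> \<phi> b * y" by (intro tendsto_mult tendsto_const y)
    show "(\<lambda>n. \<phi> b * g n) \<longlonglongrightarrow> \<phi> (b * a) * x"
      using g by (simp add: rel_def tendsto_mult f)
  qed
  moreover have "norm y \<le> norm a * norm x"
  proof (rule LIMSEQ_le)
    show "(\<lambda>n. norm (g n)) \<longlonglongrightarrow> norm y" by (intro tendsto_norm y)
    show "(\<lambda>n. norm a * norm (f n)) \<longlonglongrightarrow> norm a * norm x" by (intro tendsto_mult tendsto_norm tendsto_const f)
    show "\<exists>N. \<forall>n\<ge>N. norm (g n) \<le> norm a * norm (f n)" using words_rel_norm[OF f(1) g] by blast
  qed
  ultimately show ?thesis by (auto simp: rel_def)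
qed

definition lact :: "'a \<Rightarrow> 'b \<Rightarrow> 'b" where
  "lact a x = (THE y. rel a x y)"

lemma lact_eqI: "rel a x y \<Longrightarrow> lact a x = y"
  unfolding lact_def using rel_unique by blast

lemma lact_rel: "x \<in> C \<Longrightarrow> rel a x (lact a x)"
  using rel_exists lact_eqI by blast

lemma lact_norm: "x \<in> C \<Longrightarrow> norm (lact a x) \<le> norm a * norm x"
  using rel_exists lact_eqI by blast

lemma lact_in: "x \<in> C \<Longrightarrow> lact a x \<in> C"
  and phi_mult_lact: "x \<in> C \<Longrightarrow> \<phi> b * lact a x = \<phi> (b * a) * x"
  using lact_rel by (auto simp: rel_def)

lemma lact_add: "x \<in> C \<Longrightarrow> y \<in> C \<Longrightarrow> lact a (x + y) = lact a x + lact a y"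
  by (intro lact_eqI rel_add lact_rel)

lemma lact_diff: "x \<in> C \<Longrightarrow> y \<in> C \<Longrightarrow> lact a (x - y) = lact a x - lact a y"
  by (intro lact_eqI rel_diff lact_rel)

lemma lact_scaleC: "x \<in> C \<Longrightarrow> lact a (c *\<^sub>C x) = c *\<^sub>C lact a x"
  by (intro lact_eqI rel_scaleC lact_rel)

lemma lact_mult: "x \<in> C \<Longrightarrow> y \<in> C \<Longrightarrow> lact a (x * y) = lact a x * y"
  by (intro lact_eqI rel_mult lact_rel)

lemma lact_comp: "x \<in> C \<Longrightarrow> lact (a * b) x = lact a (lact b x)"
  by (intro lact_eqI rel_comp[OF lact_rel lact_rel] lact_in)

lemma lact_plus: "x \<in> C \<Longrightarrow> lact (a + b) x = lact a x + lact b x"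
  by (rule lact_eqI) (simp add: rel_def C_add lact_in phi_mult_lact distrib_left distrib_right cp_order_zero.add[OF cp_order_zero_axioms])

lemma lact_scale: "x \<in> C \<Longrightarrow> lact (c *\<^sub>C a) x = c *\<^sub>C lact a x"
  by (rule lact_eqI) (simp add: rel_def C_scaleC lact_in phi_mult_lact mult_scaleC_left mult_scaleC_right scaleC)

lemma lact_tendsto:
  assumes "f \<longlonglongrightarrow> x" "\<And>n. f n \<in> C" "x \<in> C"
  shows "(\<lambda>n. lact a (f n)) \<longlonglongrightarrow> lact a x"
proof (rule LIM_zero_cancel, rule Lim_null_comparison)
  have "norm (lact a (f n) - lact a x) \<le> norm a * norm (f n - x)" for n
    using lact_norm[OF C_diff[OF assms(2,3)], of a n] by (simp add: lact_diff assms)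
  then show "eventually (\<lambda>n. norm (lact a (f n) - lact a x) \<le> norm a * norm (f n - x)) sequentially" by simp
  show "(\<lambda>n. norm a * norm (f n - x)) \<longlonglongrightarrow> 0"
    by (intro tendsto_mult_right_zero tendsto_norm_zero LIM_zero assms)
qed

lemma lact_adjoint:
  assumes x: "x \<in> C" and x': "x' \<in> C"
  shows "star (lact (star a) x') * x = star x' * lact a x"
  using x
proof (rule C_induct_limit)
  show "star (lact (star a) x') * x = star x' * lact a x" if "x \<in> words" for x
    by (rule words_rel_adjoint[OF that lact_rel[OF words_C[OF that]] lact_rel[OF x']])
  fix f x assume f: "\<And>n. f n \<in> words" "\<And>n. star (lact (star a) x') * f n = star x' * lact a (f n)"
    "f \<longlonglongrightarrow> x" "x \<in> C"
  show "star (lact (star a) x') * x = star x' * lact a x"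
  proof (rule LIMSEQ_unique)
    show "(\<lambda>n. star (lact (star a) x') * f n) \<longlonglongrightarrow> star (lact (star a) x') * x"
      by (intro tendsto_mult tendsto_const f)
    show "(\<lambda>n. star (lact (star a) x') * f n) \<longlonglongrightarrow> star x' * lact a x"
      unfolding f(2) by (intro tendsto_mult tendsto_const lact_tendsto f words_C)
  qed
qed

section \<open>The positive central multiplier\<close>

definition unit_ball :: "'a set" where
  "unit_ball = {u. positive u \<and> norm u \<le> 1}"

text \<open>A filter in place of a net: a basic set consists of the positive contractions that act
  as a unit on one element up to one error.\<close>

definition unit_filter :: "'a filter" where
  "unit_filter = (INF i\<in>UNIV \<times> {0<..}. principal {u \<in> unit_ball. norm (u * fst i - fst i) < snd i})"

lemma eventually_unit_filter:
  assumes "e > 0"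
  shows "eventually (\<lambda>u. u \<in> unit_ball \<and> norm (u * a - a) < e) unit_filter"
proof -
  have "unit_filter \<le> principal {u \<in> unit_ball. norm (u * a - a) < e}"
    unfolding unit_filter_def by (rule INF_lower2[of "(a, e)"]) (use assms in auto)
  then show ?thesis by (simp add: le_principal)
qed

lemma unit_filter_nonbot: "unit_filter \<noteq> bot"
proof
  assume "unit_filter = bot"
  then have "eventually (\<lambda>u. False) unit_filter" by simp
  then have "\<exists>X\<subseteq>UNIV \<times> {0<..}. finite X \<and>
      eventually (\<lambda>u. False) (INF i\<in>X. principal {u \<in> unit_ball. norm (u * fst i - fst i) < snd i})"
    unfolding unit_filter_def by (rule eventually_INF[THEN iffD1])
  then obtain X :: "('a \<times> real) set" where X: "X \<subseteq> UNIV \<times> {0<..}" "finite X"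
    "eventually (\<lambda>u. False) (INF i\<in>X. principal {u \<in> unit_ball. norm (u * fst i - fst i) < snd i})"
    by blast
  \<comment> \<open>The inserted 1 covers the empty family.\<close>
  define \<epsilon> where "\<epsilon> = Min (insert 1 (snd ` X))"
  have "e > 0" if "e \<in> snd ` X" for e using that X(1) by auto
  then have \<epsilon>: "\<epsilon> > 0" unfolding \<epsilon>_def using X(2) by simp
  have \<epsilon>_le: "\<epsilon> \<le> snd i" if "i \<in> X" for i
    unfolding \<epsilon>_def using X(2) that by simp
  obtain u where u: "positive u" "norm u \<le> 1" "\<And>a. a \<in> fst ` X \<Longrightarrow> norm (u * a - a) < \<epsilon>"
    by (rule approximate_unit[OF finite_imageI[OF X(2)] \<epsilon>, of fst]) (rule that; assumption)
  have "u \<in> (\<Inter>i\<in>X. {u \<in> unit_ball. norm (u * fst i - fst i) < snd i})"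
  proof (rule INT_I)
    fix i assume i: "i \<in> X"
    then have "norm (u * fst i - fst i) < \<epsilon>" by (intro u(3)) simp
    then show "u \<in> {u \<in> unit_ball. norm (u * fst i - fst i) < snd i}"
      using \<epsilon>_le[OF i] u(1,2) by (simp add: unit_ball_def)
  qed
  moreover have "eventually (\<lambda>u. False) (principal (\<Inter>i\<in>X. {u \<in> unit_ball. norm (u * fst i - fst i) < snd i}))"
    using X(3) by (simp only: INF_principal_finite[OF X(2)])
  ultimately show False unfolding eventually_principal by blast
qed

lemma unit_filter_left: "((\<lambda>u. u * a) \<longlongrightarrow> a) unit_filter"
proof (rule tendstoI)
  fix e :: real assume "e > 0"
  then show "eventually (\<lambda>u. dist (u * a) a < e) unit_filter"
    unfolding dist_norm by (rule eventually_mono[OF eventually_unit_filter[of e a]]) simp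
qed

lemma eventually_unit_ball: "eventually (\<lambda>u. u \<in> unit_ball) unit_filter"
  by (rule eventually_mono[OF eventually_unit_filter[of 1 0]]) simp_all

lemma unit_filter_right: "((\<lambda>u. a * u) \<longlongrightarrow> a) unit_filter"
proof -
  have "((\<lambda>u. star (u * star a)) \<longlongrightarrow> star (star a)) unit_filter" by (intro tendsto_star unit_filter_left)
  moreover have "eventually (\<lambda>u. star (u * star a) = a * u) unit_filter"
    using eventually_unit_ball
    by (rule eventually_mono) (simp add: unit_ball_def star_mult star_star positive_star)
  ultimately show ?thesis by (simp add: star_star tendsto_cong)
qed

lemma norm_phi_unit_ball: "u \<in> unit_ball \<Longrightarrow> norm (\<phi> u) \<le> onorm \<phi>"
  using norm_phi_le[of u] mult_left_le[of "norm u" "onorm \<phi>"] onorm_nonneg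
  by (auto simp: unit_ball_def)

text \<open>On \<open>\<phi> (v * c)\<close> the limit exists because
  \<open>\<phi> u * \<phi> (v * c) = \<phi> (u * v) * \<phi> c\<close>. The uniform bound on
  \<open>\<phi> u\<close> carries this from \<open>v n * c\<close> to \<open>c\<close>, and from
  \<open>words\<close> to \<open>C\<close>.\<close>

lemma unit_filter_limit_exists:
  assumes "x \<in> C"
  shows "\<exists>l. ((\<lambda>u. \<phi> u * x) \<longlongrightarrow> l) unit_filter"
proof -
  have lim: "\<exists>l. ((\<lambda>u. \<phi> u * x) \<longlongrightarrow> l) unit_filter"
    if f: "f \<longlonglongrightarrow> x" and l: "\<And>n. \<exists>l. ((\<lambda>u. \<phi> u * f n) \<longlongrightarrow> l) unit_filter" for f x
  proof (rule tendsto_exI[OF unit_filter_nonbot])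
    fix e :: real assume e: "e > 0"
    define d where "d = e / 2 / (onorm \<phi> + 1)"
    have "d > 0" using e onorm_nonneg by (simp add: d_def add_nonneg_pos)
    then obtain n where n: "norm (f n - x) < d"
      using LIMSEQ_D[OF f] by blast
    obtain l' where l': "((\<lambda>u. \<phi> u * f n) \<longlongrightarrow> l') unit_filter" using l by blast
    have "eventually (\<lambda>u. dist (\<phi> u * f n) l' < e / 2) unit_filter" using e by (intro tendstoD[OF l']) simp
    then have "eventually (\<lambda>u. norm (\<phi> u * x - l') < e) unit_filter"
      using eventually_unit_ball
    proof eventually_elim
      case (elim u)
      have "norm (\<phi> u * (f n - x)) \<le> onorm \<phi> * norm (f n - x)"
        by (rule order_trans[OF norm_mult_ineq]) (intro mult_right_mono norm_phi_unit_ball elim norm_ge_zero)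
      also have "\<dots> \<le> (onorm \<phi> + 1) * norm (f n - x)" by (intro mult_right_mono) simp_all
      also have "\<dots> < (onorm \<phi> + 1) * d" using n onorm_nonneg by (intro mult_strict_left_mono) simp_all
      also have "\<dots> = e / 2"
      proof -
        have "onorm \<phi> + 1 \<noteq> 0" using onorm_nonneg by linarith
        then show ?thesis by (subst d_def, subst times_divide_eq_right, intro nonzero_mult_div_cancel_left)
      qed
      finally have "norm (\<phi> u * (f n - x)) < e / 2" .
      moreover have "norm (\<phi> u * f n - l') < e / 2" using elim(1) by (simp add: dist_norm)
      moreover have "norm (\<phi> u * x - l') \<le> norm (\<phi> u * f n - l') + norm (\<phi> u * (f n - x))"
      proof -
        have "\<phi> u * x - l' = (\<phi> u * f n - l') - \<phi> u * (f n - x)" by (simp add: right_diff_distrib)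
        then show ?thesis by (simp only: norm_triangle_ineq4)
      qed
      ultimately show ?case by linarith
    qed
    then show "\<exists>l. eventually (\<lambda>u. norm (\<phi> u * x - l) < e) unit_filter" by blast
  qed
  have phi: "\<exists>l. ((\<lambda>u. \<phi> u * \<phi> c) \<longlongrightarrow> l) unit_filter" for c
  proof -
    obtain v where v: "(\<lambda>n. v n * c) \<longlonglongrightarrow> c" using approximate_left_unit by blast
    have "\<exists>l. ((\<lambda>u. \<phi> u * \<phi> (v n * c)) \<longlongrightarrow> l) unit_filter" for n
      unfolding mult_shift[symmetric] by (rule exI, rule tendsto_mult[OF tendsto[OF unit_filter_left] tendsto_const])
    then show ?thesis by (rule lim[OF tendsto[OF v]])
  qed
  have "\<exists>l. ((\<lambda>u. \<phi> u * x) \<longlongrightarrow> l) unit_filter" if "x \<in> words" for x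
    using that
  proof (induction rule: words.induct)
    case (base b)
    then show ?case by (rule phi)
  next
    case (step x b)
    obtain l where "((\<lambda>u. \<phi> u * \<phi> b) \<longlongrightarrow> l) unit_filter" using phi by blast
    then have "((\<lambda>u. \<phi> u * \<phi> b * x) \<longlongrightarrow> l * x) unit_filter" by (intro tendsto_mult tendsto_const)
    then show ?case unfolding mult.assoc by (rule exI)
  next
    case (add x y)
    then obtain l l' where "((\<lambda>u. \<phi> u * x) \<longlongrightarrow> l) unit_filter" "((\<lambda>u. \<phi> u * y) \<longlongrightarrow> l') unit_filter" by blast
    from tendsto_add[OF this] show ?case unfolding distrib_left by (rule exI)
  qed
  moreover obtain f where "\<And>n. f n \<in> words" "f \<longlonglongrightarrow> x" using C_approx[OF assms] by blast
  ultimately show ?thesis using lim by simp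
qed

definition H :: "'b \<Rightarrow> 'b" where
  "H x = Lim unit_filter (\<lambda>u. \<phi> u * x)"

lemma H_eqI: "((\<lambda>u. \<phi> u * x) \<longlongrightarrow> l) unit_filter \<Longrightarrow> H x = l"
  unfolding H_def by (rule tendsto_Lim[OF unit_filter_nonbot])

lemma H_tendsto: "x \<in> C \<Longrightarrow> ((\<lambda>u. \<phi> u * x) \<longlongrightarrow> H x) unit_filter"
  using unit_filter_limit_exists[of x] by (auto simp: H_eqI)

lemma H_in: "x \<in> C \<Longrightarrow> H x \<in> C"
  by (rule Lim_in_closed_set[OF C_closed _ unit_filter_nonbot H_tendsto]) (simp_all add: C_mult C_phi)

lemma H_add: "x \<in> C \<Longrightarrow> y \<in> C \<Longrightarrow> H (x + y) = H x + H y"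
  by (rule H_eqI) (simp add: distrib_left tendsto_add H_tendsto)

lemma H_scaleC: "x \<in> C \<Longrightarrow> H (c *\<^sub>C x) = c *\<^sub>C H x"
  by (rule H_eqI) (simp add: mult_scaleC_right tendsto_scaleC H_tendsto)

lemma H_scaleR: "x \<in> C \<Longrightarrow> H (r *\<^sub>R x) = r *\<^sub>R H x"
  by (metis H_scaleC scaleC_of_real)

lemma H_diff: "x \<in> C \<Longrightarrow> y \<in> C \<Longrightarrow> H (x - y) = H x - H y"
  by (rule H_eqI) (simp add: right_diff_distrib tendsto_diff H_tendsto)

lemma H_mult_right: "x \<in> C \<Longrightarrow> H (x * y) = H x * y"
  by (rule H_eqI) (simp add: tendsto_mult H_tendsto flip: mult.assoc)

lemma H_norm: "x \<in> C \<Longrightarrow> norm (H x) \<le> onorm \<phi> * norm x"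
proof (rule tendsto_upperbound[OF tendsto_norm[OF H_tendsto] _ unit_filter_nonbot])
  show "eventually (\<lambda>u. norm (\<phi> u * x) \<le> onorm \<phi> * norm x) unit_filter"
    using eventually_unit_ball
  proof eventually_elim
    case (elim u)
    show ?case
      by (rule order_trans[OF norm_mult_ineq]) (intro mult_right_mono norm_phi_unit_ball elim norm_ge_zero)
  qed
qed

lemma H_complement_norm: "x \<in> C \<Longrightarrow> norm (onorm \<phi> *\<^sub>R x - H x) \<le> onorm \<phi> * norm x"
proof -
  assume x: "x \<in> C"
  have "((\<lambda>u. norm (onorm \<phi> *\<^sub>R x - \<phi> u * x)) \<longlongrightarrow> norm (onorm \<phi> *\<^sub>R x - H x)) unit_filter"
    by (intro tendsto_intros H_tendsto x)
  moreover have "eventually (\<lambda>u. norm (onorm \<phi> *\<^sub>R x - \<phi> u * x) \<le> onorm \<phi> * norm x) unit_filter"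
    using eventually_unit_ball
    by (rule eventually_mono)
      (auto intro!: norm_scaleR_diff_mult_le positive norm_phi_unit_ball simp: unit_ball_def)
  ultimately show ?thesis by (rule tendsto_upperbound[OF _ _ unit_filter_nonbot])
qed

lemma H_cont:
  assumes "f \<longlonglongrightarrow> x" "\<And>n. f n \<in> C" "x \<in> C"
  shows "(\<lambda>n. H (f n)) \<longlonglongrightarrow> H x"
proof (rule LIM_zero_cancel, rule Lim_null_comparison)
  have "norm (H (f n) - H x) \<le> onorm \<phi> * norm (f n - x)" for n
    using H_norm[OF C_diff[OF assms(2,3)], of n] by (simp add: H_diff assms)
  then show "eventually (\<lambda>n. norm (H (f n) - H x) \<le> onorm \<phi> * norm (f n - x)) sequentially" by simp
  show "(\<lambda>n. onorm \<phi> * norm (f n - x)) \<longlonglongrightarrow> 0"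
    by (intro tendsto_mult_right_zero tendsto_norm_zero LIM_zero assms)
qed

text \<open>\<open>h\<close> acts as \<phi>(1) would: \<phi>(a b) \<phi>(u) = \<phi>(a) \<phi>(b u)
  gives \<phi>(a b) h = \<phi>(a) \<phi>(b). The mirror image \<open>H_phi_mult\<close> has the same
  right-hand side, and comparing the two in \<open>H_phi\<close> makes \<open>h\<close>
  central.\<close>

lemma phi_mult_H: "x \<in> C \<Longrightarrow> \<phi> (a * b) * H x = \<phi> a * \<phi> b * x"
proof (rule tendsto_unique[OF unit_filter_nonbot])
  assume x: "x \<in> C"
  show "((\<lambda>u. \<phi> (a * b) * (\<phi> u * x)) \<longlongrightarrow> \<phi> (a * b) * H x) unit_filter"
    by (intro tendsto_mult tendsto_const H_tendsto x)
  have "((\<lambda>u. \<phi> a * \<phi> (b * u) * x) \<longlongrightarrow> \<phi> a * \<phi> b * x) unit_filter"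
    by (intro tendsto_mult tendsto_const tendsto unit_filter_right)
  then show "((\<lambda>u. \<phi> (a * b) * (\<phi> u * x)) \<longlongrightarrow> \<phi> a * \<phi> b * x) unit_filter"
    by (simp add: mult_shift flip: mult.assoc)
qed

lemma H_phi_mult: "H (\<phi> (a * b) * x) = \<phi> a * \<phi> b * x"
proof (rule H_eqI)
  have "((\<lambda>u. \<phi> (u * a) * \<phi> b * x) \<longlongrightarrow> \<phi> a * \<phi> b * x) unit_filter"
    by (intro tendsto_mult tendsto_const tendsto unit_filter_left)
  then show "((\<lambda>u. \<phi> u * (\<phi> (a * b) * x)) \<longlongrightarrow> \<phi> a * \<phi> b * x) unit_filter"
    by (simp add: mult_shift flip: mult.assoc)
qed

lemma H_phi: "x \<in> C \<Longrightarrow> H (\<phi> b * x) = \<phi> b * H x"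
proof -
  assume x: "x \<in> C"
  obtain v where v: "(\<lambda>n. v n * b) \<longlonglongrightarrow> b" using approximate_left_unit by blast
  have "(\<lambda>n. H (\<phi> (v n * b) * x)) \<longlonglongrightarrow> H (\<phi> b * x)"
    by (intro H_cont tendsto_mult tendsto_const C_mult C_phi x tendsto[OF v])
  moreover have "(\<lambda>n. \<phi> (v n * b) * H x) \<longlonglongrightarrow> \<phi> b * H x"
    by (intro tendsto_mult tendsto v tendsto_const)
  ultimately show ?thesis by (simp add: H_phi_mult phi_mult_H x LIMSEQ_unique)
qed

lemma H_mult_left:
  assumes "y \<in> C" "x \<in> C"
  shows "H (y * x) = y * H x"
  using assms(1)
proof (rule C_induct_limit)
  show "H (y * x) = y * H x" if "y \<in> words" for y
    using that
    by (induction rule: words.induct)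
      (simp_all add: H_phi assms C_mult C_phi words_C mult.assoc distrib_right H_add)
  fix f y assume f: "\<And>n. f n \<in> words" "\<And>n. H (f n * x) = f n * H x" "f \<longlonglongrightarrow> y" "y \<in> C"
  have "(\<lambda>n. H (f n * x)) \<longlonglongrightarrow> H (y * x)"
    by (intro H_cont tendsto_mult f tendsto_const C_mult assms words_C)
  moreover have "(\<lambda>n. f n * H x) \<longlonglongrightarrow> y * H x" by (intro tendsto_mult tendsto_const f)
  ultimately show "H (y * x) = y * H x" by (simp add: f(2) LIMSEQ_unique)
qed

text \<open>Each \<open>\<phi> u\<close> is self-adjoint, so
  \<open>star (H x) * y = star x * H y\<close> in the limit, and centrality moves \<open>H\<close>
  over to \<open>star x\<close>.\<close>

lemma H_star:
  assumes x: "x \<in> C"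
  shows "H (star x) = star (H x)"
proof -
  have eq: "star (H x) * y = H (star x) * y" if y: "y \<in> C" for y
  proof -
    have limx: "((\<lambda>u. star (\<phi> u * x) * y) \<longlongrightarrow> star (H x) * y) unit_filter"
      by (intro tendsto_mult tendsto_star tendsto_const H_tendsto x)
    have limy: "((\<lambda>u. star x * (\<phi> u * y)) \<longlongrightarrow> star x * H y) unit_filter"
      by (intro tendsto_mult tendsto_const H_tendsto y)
    have cong: "eventually (\<lambda>u. star (\<phi> u * x) * y = star x * (\<phi> u * y)) unit_filter"
      using eventually_unit_ball
      by (rule eventually_mono) (simp add: unit_ball_def star_mult positive_star mult.assoc flip: star)
    have "((\<lambda>u. star x * (\<phi> u * y)) \<longlongrightarrow> star (H x) * y) unit_filter"
      by (rule tendsto_cong[OF cong, THEN iffD1, OF limx])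
    then have "star (H x) * y = star x * H y" by (rule tendsto_unique[OF unit_filter_nonbot _ limy])
    also have "\<dots> = H (star x) * y"
      by (simp add: H_mult_left[symmetric] H_mult_right C_star x y)
    finally show ?thesis .
  qed
  let ?z = "star (H x) - H (star x)"
  have z: "?z \<in> C" by (intro C_diff C_star H_in x)
  have "?z * star ?z = 0" using eq[OF C_star[OF z]] by (simp add: left_diff_distrib)
  then have "norm ?z = 0" using norm_mult_star_self[of ?z] by simp
  then show ?thesis by simp
qed

lemma lact_H: "x \<in> C \<Longrightarrow> lact a (H x) = \<phi> a * x"
  by (rule lact_eqI) (simp add: rel_def C_mult C_phi phi_mult_H mult.assoc)

lemma H_lact: "x \<in> C \<Longrightarrow> H (lact a x) = \<phi> a * x"
proof -
  assume x: "x \<in> C"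
  have "rel a (H x) (H (lact a x))"
    by (simp add: rel_def H_in lact_in x phi_mult_lact flip: H_phi)
  then show ?thesis using lact_eqI lact_H x by metis
qed


section \<open>The square root of \<open>h\<close>\<close>

text \<open>This is \<open>1 - h / \<parallel>\<phi>\<parallel>\<close>. If \<open>\<phi>\<close>
  has norm 0, the division yields 0 and the operator is the identity, still a contraction.\<close>

definition H_defect :: "'b \<Rightarrow> 'b" where
  "H_defect x = x - (1 / onorm \<phi>) *\<^sub>R H x"

lemma contraction_H_defect: "contraction_on C H_defect"
proof
  show "subspace C" by (simp add: subspace_def C_0 C_add C_scaleR)
  show "norm (H_defect x) \<le> norm x" if x: "x \<in> C" for x
  proof (cases "onorm \<phi> = 0")
    case False
    then have t: "onorm \<phi> > 0" using onorm_nonneg by simp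
    have "H_defect x = (1 / onorm \<phi>) *\<^sub>R (onorm \<phi> *\<^sub>R x - H x)"
      using t by (simp add: H_defect_def scaleR_diff_right)
    then have "norm (H_defect x) = norm (onorm \<phi> *\<^sub>R x - H x) / onorm \<phi>" using t by simp
    then show ?thesis using H_complement_norm[OF x] t by (simp add: pos_divide_le_eq mult.commute)
  qed (simp add: H_defect_def)
qed (simp_all add: C_closed H_defect_def C_diff C_scaleR H_in H_add H_scaleR scaleR_add_right scaleR_diff_right)

definition H_root :: "'b \<Rightarrow> 'b" where
  "H_root x = sqrt (onorm \<phi>) *\<^sub>R root_op H_defect x"

lemma H_root_in: "x \<in> C \<Longrightarrow> H_root x \<in> C"
  unfolding H_root_def by (intro C_scaleR contraction_on.root_in[OF contraction_H_defect])

lemma H_root_add: "x \<in> C \<Longrightarrow> y \<in> C \<Longrightarrow> H_root (x + y) = H_root x + H_root y"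
  by (simp add: H_root_def contraction_on.root_add[OF contraction_H_defect] scaleR_add_right)

lemma H_root_H_root: assumes x: "x \<in> C" shows "H_root (H_root x) = H x"
proof -
  have "H_root (H_root x) = onorm \<phi> *\<^sub>R root_op H_defect (root_op H_defect x)"
    using onorm_nonneg
    by (simp add: H_root_def contraction_on.root_scale[OF contraction_H_defect] contraction_on.root_in[OF contraction_H_defect] x)
  also have "\<dots> = onorm \<phi> *\<^sub>R (1 / onorm \<phi>) *\<^sub>R H x"
    by (simp add: contraction_on.root_root[OF contraction_H_defect x] H_defect_def)
  also have "\<dots> = H x"
    using H_norm[OF x] by (cases "onorm \<phi> = 0") simp_all
  finally show ?thesis .
qed

text \<open>With \<open>X\<close> a scaling, the involution or a multiplication by an element of
  \<open>C\<close>, the properties of a central self-adjoint multiplier pass from \<open>H\<close>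
  to its root.\<close>

lemma H_root_intertwine:
  assumes X: "bounded_linear X" and "\<And>x. x \<in> C \<Longrightarrow> X x \<in> C" "\<And>x. x \<in> C \<Longrightarrow> X (H x) = H (X x)" "x \<in> C"
  shows "H_root (X x) = X (H_root x)"
proof -
  interpret X: bounded_linear X by fact
  have "X (root_op H_defect x) = root_op H_defect (X x)"
    by (rule root_op_intertwine[OF contraction_H_defect contraction_H_defect])
      (use assms in \<open>simp_all add: H_defect_def X.diff X.scaleR\<close>)
  then show ?thesis by (simp add: H_root_def X.scaleR)
qed

lemma H_root_scaleC: "x \<in> C \<Longrightarrow> H_root (c *\<^sub>C x) = c *\<^sub>C H_root x"
  by (rule H_root_intertwine) (simp_all add: bounded_linear_scaleC C_scaleC H_scaleC)

lemma H_root_star: "x \<in> C \<Longrightarrow> H_root (star x) = star (H_root x)"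
  by (rule H_root_intertwine) (simp_all add: bounded_linear_star C_star H_star)

lemma H_root_mult_right: "x \<in> C \<Longrightarrow> y \<in> C \<Longrightarrow> H_root (x * y) = H_root x * y"
  by (rule H_root_intertwine[where X="\<lambda>x. x * y"]) (simp_all add: bounded_linear_mult_left C_mult H_mult_right)

lemma H_root_mult_left: "x \<in> C \<Longrightarrow> y \<in> C \<Longrightarrow> H_root (y * x) = y * H_root x"
  by (rule H_root_intertwine[where X="\<lambda>x. y * x"]) (simp_all add: bounded_linear_mult_right C_mult H_mult_left)

lemma H_root_norm: assumes x: "x \<in> C" shows "norm (H_root x) \<le> (sqrt (onorm \<phi>) * 2) * norm x"
proof -
  have "norm (root_op H_defect x) \<le> norm x + norm (x - root_op H_defect x)"
    using norm_triangle_ineq4[of x "x - root_op H_defect x"] by simp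
  also have "\<dots> \<le> 2 * norm x" using contraction_on.root_contr[OF contraction_H_defect x] by simp
  finally have "sqrt (onorm \<phi>) * norm (root_op H_defect x) \<le> sqrt (onorm \<phi>) * (2 * norm x)"
    using onorm_nonneg by (intro mult_left_mono) simp_all
  then show ?thesis using onorm_nonneg by (simp add: H_root_def)
qed

section \<open>Passage to double centralizers\<close>

definition central :: "('b \<Rightarrow> 'b) \<Rightarrow> 'b multiplier" where
  "central T = (restrict T C, restrict T C)"

lemma central_multiplier:
  assumes "\<And>x. x \<in> C \<Longrightarrow> T x \<in> C" "\<And>x y. x \<in> C \<Longrightarrow> y \<in> C \<Longrightarrow> T (x + y) = T x + T y"
    "\<And>c x. x \<in> C \<Longrightarrow> T (c *\<^sub>C x) = c *\<^sub>C T x" "\<And>x. x \<in> C \<Longrightarrow> norm (T x) \<le> B * norm x"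
    "\<And>x y. x \<in> C \<Longrightarrow> y \<in> C \<Longrightarrow> T (x * y) = T x * y" "\<And>x y. x \<in> C \<Longrightarrow> y \<in> C \<Longrightarrow> T (y * x) = y * T x"
  shows "central T \<in> multipliers C"
proof -
  have "bounded_clinear_on C (restrict T C)"
    unfolding bounded_clinear_on_def using assms(1-4)
    by (auto simp: C_add C_scaleC intro!: exI[of _ B])
  moreover have "T x * y = x * T y" if "x \<in> C" "y \<in> C" for x y
    using assms(5)[of x y] assms(6)[of y x] that by simp
  ultimately show ?thesis
    using assms by (auto simp: multipliers_def central_def C_mult)
qed

lemma multiplier_eqI:
  assumes "\<And>x. x \<in> C \<Longrightarrow> f x = f' x" "\<And>x. x \<in> C \<Longrightarrow> g x = g' x"
  shows "(restrict f C, restrict g C) = (restrict f' C, restrict g' C)"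
  using assms by (simp add: restrict_def fun_eq_iff)

definition h :: "'b multiplier" where "h = central H"

lemma h_multiplier: "h \<in> multipliers C"
  unfolding h_def
  by (rule central_multiplier[where B="onorm \<phi>"])
    (rule H_in H_add H_scaleC H_norm H_mult_right H_mult_left; assumption)+

lemma h_commutant: "h \<in> m_commutant C (m_embed C ` C)"
  unfolding m_commutant_def
proof (intro CollectI conjI ballI h_multiplier)
  fix s assume "s \<in> m_embed C ` C"
  then obtain c where c: "c \<in> C" "s = m_embed C c" by blast
  show "m_mult C h s = m_mult C s h"
    unfolding c(2) m_mult_def m_embed_def h_def central_def compose_def fst_conv snd_conv
    by (rule multiplier_eqI) (simp_all add: c H_in C_mult H_mult_left, simp add: c H_mult_left[symmetric] H_mult_right)
qed

lemma h_positive: "m_positive C h"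
proof -
  have k: "central H_root \<in> multipliers C"
    by (rule central_multiplier[where B="sqrt (onorm \<phi>) * 2"])
      (rule H_root_in H_root_add H_root_scaleC H_root_norm H_root_mult_right H_root_mult_left; assumption)+
  have "m_star C (central H_root) = central H_root"
    unfolding m_star_def central_def fst_conv snd_conv
    by (rule multiplier_eqI) (simp_all add: C_star H_root_star star_star)
  moreover have "m_mult C (central H_root) (central H_root) = h"
    unfolding m_mult_def h_def central_def compose_def fst_conv snd_conv
    by (rule multiplier_eqI) (simp_all add: H_root_in H_root_H_root)
  ultimately show ?thesis unfolding m_positive_def using k by metis
qed

text \<open>For the lower bound, \<phi>(a) = \<pi>(a) h is applied to
  \<open>star (\<phi> a)\<close>: \<open>\<parallel>\<phi> a\<parallel>^2 \<le>
  \<parallel>a\<parallel> \<parallel>h\<parallel> \<parallel>\<phi> a\<parallel>\<close>, because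
  \<open>lact a\<close> is bounded by \<open>\<parallel>a\<parallel>\<close>.\<close>

lemma h_norm: "m_norm C h = onorm \<phi>"
proof (rule antisym)
  let ?B = "{x \<in> C. norm x \<le> 1}"
  have ne: "?B \<noteq> {}" using C_0 by (auto intro: exI[of _ 0])
  have H1: "norm (H x) \<le> onorm \<phi>" if "x \<in> C" "norm x \<le> 1" for x
    using H_norm[OF that(1)] mult_left_le[OF that(2) onorm_nonneg] by simp
  have eq: "m_norm C h = (SUP x\<in>?B. norm (H x))"
    unfolding m_norm_def h_def central_def by (rule SUP_cong) simp_all
  show "m_norm C h \<le> onorm \<phi>"
    unfolding eq using H1 by (intro cSUP_least ne) simp
  have bdd: "bdd_above ((\<lambda>x. norm (H x)) ` ?B)" using H1 by (intro bdd_aboveI2[where M="onorm \<phi>"]) simp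
  have m: "norm (H x) \<le> m_norm C h" if "x \<in> C" "norm x \<le> 1" for x
    unfolding eq by (rule cSUP_upper[OF _ bdd]) (simp add: that)
  have m0: "0 \<le> m_norm C h" by (rule order_trans[OF norm_ge_zero m[OF C_0]]) simp
  have Hx: "norm (H x) \<le> m_norm C h * norm x" if x: "x \<in> C" for x
  proof (cases "x = 0")
    case True
    then show ?thesis using H_norm[OF x] by simp
  next
    case False
    have "norm (H ((1 / norm x) *\<^sub>R x)) \<le> m_norm C h"
      by (rule m) (simp_all add: C_scaleR x)
    then show ?thesis using False by (simp add: H_scaleR x pos_divide_le_eq)
  qed
  show "onorm \<phi> \<le> m_norm C h"
  proof (rule onorm_bound[OF m0])
    fix a
    let ?y = "star (\<phi> a)"
    have y: "?y \<in> C" by (intro C_star C_phi)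
    have "(norm (\<phi> a))\<^sup>2 = norm (lact a (H ?y))" by (simp add: lact_H y norm_mult_star_self)
    also have "\<dots> \<le> norm a * norm (H ?y)" by (rule lact_norm[OF H_in[OF y]])
    also have "\<dots> \<le> norm a * (m_norm C h * norm ?y)" by (intro mult_left_mono Hx y norm_ge_zero)
    finally have "norm (\<phi> a) * norm (\<phi> a) \<le> (m_norm C h * norm a) * norm (\<phi> a)"
      by (simp add: power2_eq_square ac_simps)
    then show "norm (\<phi> a) \<le> m_norm C h * norm a"
      using m0 by (cases "\<phi> a = 0") simp_all
  qed
qed

text \<open>Right multiplication by \<pi>(a), forced by the demand that \<pi> preserve the
  involution; \<open>lact_adjoint\<close> links it to \<open>lact a\<close> as a double centralizer
  requires.\<close>

definition ract :: "'a \<Rightarrow> 'b \<Rightarrow> 'b" where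
  "ract a x = star (lact (star a) (star x))"

lemma ract_in: "x \<in> C \<Longrightarrow> ract a x \<in> C"
  by (simp add: ract_def C_star lact_in)

definition \<pi> :: "'a \<Rightarrow> 'b multiplier" where
  "\<pi> a = (restrict (lact a) C, restrict (ract a) C)"

lemma pi_multiplier: "\<pi> a \<in> multipliers C"
proof -
  have "bounded_clinear_on C (restrict (lact a) C)"
    unfolding bounded_clinear_on_def
    by (auto simp: C_add C_scaleC lact_add lact_scaleC lact_norm intro!: exI[of _ "norm a"])
  moreover have "bounded_clinear_on C (restrict (ract a) C)"
    unfolding bounded_clinear_on_def
  proof (intro conjI ballI allI exI[of _ "norm a"])
    fix x assume x: "x \<in> C"
    show "norm (restrict (ract a) C x) \<le> norm a * norm x"
      using lact_norm[OF C_star[OF x], of "star a"] x by (simp add: ract_def)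
  qed (simp_all add: ract_def C_add C_scaleC C_star star_add star_scaleC lact_add lact_scaleC)
  moreover have "ract a x * y = x * lact a y" if "x \<in> C" "y \<in> C" for x y
    using lact_adjoint[OF that(2) C_star[OF that(1)]] by (simp add: ract_def star_star)
  moreover have "ract a (x * y) = x * ract a y" if "x \<in> C" "y \<in> C" for x y
    using that by (simp add: ract_def star_mult lact_mult C_star star_star)
  ultimately show ?thesis
    by (auto simp: multipliers_def \<pi>_def lact_in ract_in lact_mult C_mult)
qed

lemma pi_star_hom: "star_hom_to_multipliers C \<pi>"
  unfolding star_hom_to_multipliers_def
proof (intro conjI allI pi_multiplier)
  fix a b c
  show "\<pi> (a + b) = m_add C (\<pi> a) (\<pi> b)"
    unfolding m_add_def \<pi>_def fst_conv snd_conv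
    by (rule multiplier_eqI) (simp_all add: lact_plus ract_def C_star star_add)
  show "\<pi> (c *\<^sub>C a) = m_scale C c (\<pi> a)"
    unfolding m_scale_def \<pi>_def fst_conv snd_conv
    by (rule multiplier_eqI) (simp_all add: lact_scale ract_def C_star star_scaleC)
  show "\<pi> (a * b) = m_mult C (\<pi> a) (\<pi> b)"
    unfolding m_mult_def \<pi>_def fst_conv snd_conv compose_def
    by (rule multiplier_eqI) (simp_all add: lact_comp lact_in ract_in, simp add: ract_def C_star star_mult star_star lact_comp)
  show "\<pi> (star a) = m_star C (\<pi> a)"
    unfolding m_star_def \<pi>_def fst_conv snd_conv
    by (rule multiplier_eqI) (simp_all add: ract_def C_star star_star)
qed

lemma H_ract: "x \<in> C \<Longrightarrow> H (ract a x) = x * \<phi> a"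
  by (simp add: ract_def H_star lact_in C_star H_lact star_mult star star_star)

lemma ract_H: "x \<in> C \<Longrightarrow> ract a (H x) = x * \<phi> a"
  by (simp add: ract_def C_star lact_H star_mult star star_star flip: H_star)

lemma pi_commutes: "\<pi> a \<in> m_commutant C {h}"
proof -
  have "m_mult C (\<pi> a) h = m_mult C h (\<pi> a)"
    unfolding m_mult_def \<pi>_def h_def central_def fst_conv snd_conv compose_def
    by (rule multiplier_eqI) (simp_all add: H_in lact_in ract_in lact_H H_lact H_ract ract_H)
  then show ?thesis by (simp add: m_commutant_def pi_multiplier)
qed

lemma pi_h: "m_mult C (\<pi> a) h = m_embed C (\<phi> a)"
  unfolding m_mult_def m_embed_def \<pi>_def h_def central_def fst_conv snd_conv compose_def
  by (rule multiplier_eqI) (simp_all add: H_in ract_in lact_H H_ract)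

text \<open>Since \<open>u = u * e\<close>, the filter itself converges to \<open>e\<close> in norm,
  and \<open>\<phi> u\<close> to \<open>\<phi> e\<close>. The right component follows by taking
  adjoints.\<close>

lemma h_unital:
  assumes e: "is_unit_element e"
  shows "h = m_embed C (\<phi> e)"
proof -
  have "((\<lambda>u. u * e) \<longlongrightarrow> e) unit_filter" by (rule unit_filter_left)
  then have u: "((\<lambda>u. u) \<longlongrightarrow> e) unit_filter" using e by (simp add: is_unit_element_def)
  have left: "H x = \<phi> e * x" for x
    by (intro H_eqI tendsto_mult tendsto u tendsto_const)
  have se: "star e = e" using e unfolding is_unit_element_def by (metis star_mult star_star)
  have "H x = x * \<phi> e" if x: "x \<in> C" for x
  proof -
    have "star (H x) = \<phi> e * star x" using H_star[OF x] left by simp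
    then have "star (star (H x)) = star (\<phi> e * star x)" by simp
    then show ?thesis by (simp add: star_mult star_star se flip: star)
  qed
  then show ?thesis
    unfolding h_def central_def m_embed_def using left by (intro multiplier_eqI) simp_all
qed

end

theorem theorem2p3:
  fixes \<phi> :: "'a::c_star_algebra \<Rightarrow> 'b::c_star_algebra"
    and C :: "'b set"
  assumes "completely_positive \<phi>"
    and "order_zero \<phi>"
    and "C = c_star_generated (range \<phi>)"
  shows "\<exists>h \<pi>.
           h \<in> m_commutant C (m_embed C ` C) \<and>
           m_positive C h \<and>
           m_norm C h = onorm \<phi> \<and>
           star_hom_to_multipliers C \<pi> \<and>
           (\<forall>a. \<pi> a \<in> m_commutant C {h}) \<and>
           (\<forall>a. m_mult C (\<pi> a) h = m_embed C (\<phi> a)) \<and>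
           (\<forall>e. is_unit_element e \<longrightarrow> h = m_embed C (\<phi> e) \<and> \<phi> e \<in> C)"
proof -
  interpret cp_order_zero \<phi> by standard (rule assms)+
  have "C = cp_order_zero.C \<phi>" by (simp add: assms(3) C_def)
  then show ?thesis
    using h_commutant h_positive h_norm pi_star_hom pi_commutes pi_h h_unital C_phi by blast
qed

end
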